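(* Let $S$ be a numerical semigroup, $E$ an ideal of $S$ with $0\notin E$, $b\in S$ an odd integer, and $k$ a field. Let $T=S\Join^b E$, let $D=k[\![T]\!]$ with maximal ideal $\mathfrak n$, and let $\mathfrak m$ be the maximal ideal of $k[\![S]\!]$. Then: (1) $T$ has $\gamma$-rectangular (resp. $\beta$-rectangular) Apéry set if and only if $S$ has $\gamma$-rectangular (resp. $\beta$-rectangular) Apéry set and $E$ is principal; (2) $\operatorname{gr}_{\mathfrak n}(D)$ is a complete intersection if and only if $\operatorname{gr}_{\mathfrak m}(k[\![S]\!])$ is a complete intersection and $E$ is principal.
   Context: A numerical semigroup is a submonoid $S$ of $(\mathbb N,+)$ with $\mathbb N\setminus S$ finite; $k[\![S]\!]=k[\![t^s\mid s\in S]\!]\subseteq k[\![t]\!]$, with maximal ideal $(t^s\mid0\ne s\in S)$. An ideal of $S$ is a non-empty set $E\subseteq S$ with $E+S\subseteq E$; it is principal if $E=e+S$ for some $e\in S$. The numerical duplication is the numerical semigroup $S\Join^b E=\{2s\mid s\in S\}\cup\{2e+b\mid e\in E\}$. For a local ring $(A,\mathfrak a)$, $\operatorname{gr}_{\mathfrak a}(A)=\bigoplus_{i\ge0}\mathfrak a^i/\mathfrak a^{i+1}$. Let $U$ be a numerical semigroup of multiplicity $\mu$ (its smallest nonzero element), $M_U=U\setminus\{0\}$, and let $\mu=g_1,g_2,\dots,g_p$ be its minimal generators. $\operatorname{Ap}_\mu(U)=\{u\in U\mid u-\mu\notin U\}$ and $\operatorname{ord}_U(u)=\max\{l\mid u\in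 lM_U\}$, where $lM_U$ is the $l$-fold sum of $M_U$ and $0M_U=U$. A representation $u=\sum_i c_ig_i$ ($c_i\in\mathbb N$) is maximal if $\sum_ic_i=\operatorname{ord}_U(u)$. For $i=2,\dots,p$ put $$\beta_U(g_i)=\max\{h\in\mathbb N\mid hg_i\in\operatorname{Ap}_\mu(U),\ \operatorname{ord}_U(hg_i)=h\},$$ $$\gamma_U(g_i)=\max\{h\in\mathbb N\mid hg_i\in\operatorname{Ap}_\mu(U),\ \operatorname{ord}_U(hg_i)=h,\ hg_i\text{ has a unique maximal representation}\}.$$ Let $B(U)=\{\sum_{i=2}^p\lambda_ig_i\mid0\le\lambda_i\le\beta_U(g_i)\}$ and $\Gamma(U)=\{\sum_{i=2}^p\lambda_ig_i\mid0\le\lambda_i\le\gamma_U(g_i)\}$, with $\lambda_i \in \mathbb N$. $U$ has $\beta$-rectangular (resp. $\gamma$-rectangular) Apéry set if $\operatorname{Ap}_\mu(U)=B(U)$ (resp. $\operatorname{Ap}_\mu(U)=\Gamma(U)$). *)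

theory Defs
  imports
    "HOL-Computational_Algebra.Formal_Power_Series"
    "HOL-Library.Poly_Mapping"
    "HOL-Algebra.Ideal_Product"
    "HOL-Algebra.RingHom"
begin

definition numerical_semigroup :: "nat set \<Rightarrow> bool" where
  "numerical_semigroup S \<longleftrightarrow> 0 \<in> S \<and> (\<forall>x\<in>S. \<forall>y\<in>S. x + y \<in> S) \<and> finite (- S)"

definition semigroup_ideal :: "nat set \<Rightarrow> nat set \<Rightarrow> bool" where
  "semigroup_ideal S E \<longleftrightarrow> E \<noteq> {} \<and> E \<subseteq> S \<and> (\<forall>e\<in>E. \<forall>s\<in>S. e + s \<in> E)"

definition principal_semigroup_ideal :: "nat set \<Rightarrow> nat set \<Rightarrow> bool" where
  "principal_semigroup_ideal S E \<longleftrightarrow> (\<exists>e\<in>S. E = {e + s | s. s \<in> S})"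

definition numerical_duplication :: "nat set \<Rightarrow> nat \<Rightarrow> nat set \<Rightarrow> nat set" where
  "numerical_duplication S b E = {2 * s | s. s \<in> S} \<union> {2 * e + b | e. e \<in> E}"

definition multiplicity_of :: "nat set \<Rightarrow> nat" where
  "multiplicity_of U = (LEAST u. u \<in> U \<and> u \<noteq> 0)"

text \<open>The unique minimal generating system of a numerical semigroup consists of the nonzero
  elements that are not sums of two nonzero elements.\<close>

definition minimal_generators :: "nat set \<Rightarrow> nat set" where
  "minimal_generators U = {g \<in> U - {0}. \<not> (\<exists>x\<in>U - {0}. \<exists>y\<in>U - {0}. g = x + y)}"

text \<open>Subtraction in the condition \<open>u - \<mu> \<notin> U\<close> takes place in the integers.\<close>

definition apery_set :: "nat set \<Rightarrow> nat set" where
  "apery_set U = {u \<in> U. int u - int (multiplicity_of U) \<notin> int ` U}"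

primrec fold_sum :: "nat set \<Rightarrow> nat \<Rightarrow> nat set" where
  "fold_sum U 0 = U"
| "fold_sum U (Suc l) = {x + y | x y. x \<in> U - {0} \<and> y \<in> fold_sum U l}"

definition semigroup_order :: "nat set \<Rightarrow> nat \<Rightarrow> nat" where
  "semigroup_order U u = Max {l. u \<in> fold_sum U l}"

text \<open>A representation assigns a coefficient to each minimal generator; coefficients outside the
  minimal generators are normalised to zero, so that uniqueness is meaningful.\<close>

definition semigroup_representation :: "nat set \<Rightarrow> nat \<Rightarrow> (nat \<Rightarrow> nat) \<Rightarrow> bool" where
  "semigroup_representation U u c \<longleftrightarrow>
     (\<forall>g. g \<notin> minimal_generators U \<longrightarrow> c g = 0) \<and> u = (\<Sum>g\<in>minimal_generators U. c g * g)"

definition maximal_representation :: "nat set \<Rightarrow> nat \<Rightarrow> (nat \<Rightarrow> nat) \<Rightarrow> bool" where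
  "maximal_representation U u c \<longleftrightarrow>
     semigroup_representation U u c \<and> (\<Sum>g\<in>minimal_generators U. c g) = semigroup_order U u"

definition beta :: "nat set \<Rightarrow> nat \<Rightarrow> nat" where
  "beta U g = Max {h. h * g \<in> apery_set U \<and> semigroup_order U (h * g) = h}"

definition gamma :: "nat set \<Rightarrow> nat \<Rightarrow> nat" where
  "gamma U g = Max {h. h * g \<in> apery_set U \<and> semigroup_order U (h * g) = h \<and>
                       (\<exists>!c. maximal_representation U (h * g) c)}"

definition rectangle :: "nat set \<Rightarrow> (nat \<Rightarrow> nat) \<Rightarrow> nat set" where
  "rectangle U bound =
     {\<Sum>g\<in>minimal_generators U - {multiplicity_of U}. l g * g | l.
        \<forall>g\<in>minimal_generators U - {multiplicity_of U}. l g \<le> bound g}"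

definition beta_rectangular :: "nat set \<Rightarrow> bool" where
  "beta_rectangular U \<longleftrightarrow> apery_set U = rectangle U (beta U)"

definition gamma_rectangular :: "nat set \<Rightarrow> bool" where
  "gamma_rectangular U \<longleftrightarrow> apery_set U = rectangle U (gamma U)"

text \<open>\<open>k[[S]]\<close> consists of the power series all of whose exponents lie in \<open>S\<close>.\<close>

definition semigroup_ring :: "nat set \<Rightarrow> 'k::field fps ring" where
  "semigroup_ring S =
     \<lparr>carrier = {f. \<forall>n. fps_nth f n \<noteq> 0 \<longrightarrow> n \<in> S}, monoid.mult = (*), one = 1, zero = 0, add = (+)\<rparr>"

definition semigroup_ring_max :: "nat set \<Rightarrow> 'k::field fps set" where
  "semigroup_ring_max S = Idl\<^bsub>semigroup_ring S\<^esub> {fps_X ^ s | s. s \<in> S \<and> s \<noteq> 0}"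

primrec ideal_power :: "('a, 'b) ring_scheme \<Rightarrow> 'a set \<Rightarrow> nat \<Rightarrow> 'a set" where
  "ideal_power A I 0 = carrier A"
| "ideal_power A I (Suc n) = ideal_prod A I (ideal_power A I n)"

text \<open>An element of the associated graded ring is a finitely supported family \<open>x\<close>, where
  \<open>x i\<close> is a coset of \<open>I\<^sup>i\<^sup>+\<^sup>1\<close> in \<open>I\<^sup>i\<close>. The \<open>n\<close>-th component of a product is the class of
  \<open>f 0 * g n + \<dots> + f n * g 0\<close> for representatives \<open>f i\<close> of \<open>x i\<close> and \<open>g i\<close> of \<open>y i\<close>; the union over
  all representatives is a single coset.\<close>

definition degree_zero_class :: "('a, 'b) ring_scheme \<Rightarrow> 'a set \<Rightarrow> 'a \<Rightarrow> nat \<Rightarrow> 'a set" where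
  "degree_zero_class A I r =
     (\<lambda>i. if i = 0 then ideal_power A I (Suc 0) +>\<^bsub>A\<^esub> r else ideal_power A I (Suc i))"

definition assoc_graded :: "('a, 'b) ring_scheme \<Rightarrow> 'a set \<Rightarrow> (nat \<Rightarrow> 'a set) ring" where
  "assoc_graded A I =
     \<lparr>carrier = {x. (\<forall>i. \<exists>f\<in>ideal_power A I i. x i = ideal_power A I (Suc i) +>\<^bsub>A\<^esub> f) \<and>
                    finite {i. x i \<noteq> ideal_power A I (Suc i)}},
      monoid.mult = (\<lambda>x y n. \<Union>f\<in>{f. \<forall>i\<le>n. f i \<in> x i}. \<Union>g\<in>{g. \<forall>i\<le>n. g i \<in> y i}.
                ideal_power A I (Suc n) +>\<^bsub>A\<^esub> (\<Oplus>\<^bsub>A\<^esub>i\<in>{..n}. f i \<otimes>\<^bsub>A\<^esub> g (n - i))),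
      one = degree_zero_class A I \<one>\<^bsub>A\<^esub>,
      zero = (\<lambda>i. ideal_power A I (Suc i)),
      add = (\<lambda>x y i. x i <+>\<^bsub>A\<^esub> y i)\<rparr>"

definition assoc_graded_component :: "('a, 'b) ring_scheme \<Rightarrow> 'a set \<Rightarrow> nat \<Rightarrow>
    (nat \<Rightarrow> 'a set) set" where
  "assoc_graded_component A I d =
     {x \<in> carrier (assoc_graded A I). \<forall>i. i \<noteq> d \<longrightarrow> x i = ideal_power A I (Suc i)}"

text \<open>The polynomial ring \<open>k[x\<^sub>0, \<dots>, x\<^bsub>n-1\<^esub>]\<close>: a monomial is its exponent vector, a polynomial
  is a finitely supported family of coefficients, and multiplication is convolution.\<close>

type_synonym 'k mpoly = "(nat \<Rightarrow>\<^sub>0 nat) \<Rightarrow>\<^sub>0 'k"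

definition mpoly_ring :: "nat \<Rightarrow> 'k::field mpoly ring" where
  "mpoly_ring n =
     \<lparr>carrier = {p. \<forall>m\<in>Poly_Mapping.keys p. Poly_Mapping.keys m \<subseteq> {..<n}},
      monoid.mult = (*), one = 1, zero = 0, add = (+)\<rparr>"

definition mpoly_const :: "'k::field \<Rightarrow> 'k mpoly" where
  "mpoly_const c = Poly_Mapping.single 0 c"

definition homogeneous_mpoly :: "nat \<Rightarrow> 'k::field mpoly \<Rightarrow> bool" where
  "homogeneous_mpoly d p \<longleftrightarrow>
     (\<forall>m\<in>Poly_Mapping.keys p. (\<Sum>i\<in>Poly_Mapping.keys m. Poly_Mapping.lookup m i) = d)"

definition regular_sequence :: "('a, 'b) ring_scheme \<Rightarrow> 'a list \<Rightarrow> bool" where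
  "regular_sequence R fs \<longleftrightarrow>
     set fs \<subseteq> carrier R \<and>
     (\<forall>i<length fs. \<forall>g\<in>carrier R.
        fs ! i \<otimes>\<^bsub>R\<^esub> g \<in> Idl\<^bsub>R\<^esub> (set (take i fs)) \<longrightarrow> g \<in> Idl\<^bsub>R\<^esub> (set (take i fs))) \<and>
     Idl\<^bsub>R\<^esub> (set fs) \<noteq> carrier R"

text \<open>Let \<open>G\<close> be a graded \<open>k\<close>-algebra with structure map \<open>\<iota>\<close> and graded components \<open>Gr d\<close>.
  It is a (standard graded) complete intersection if it is isomorphic, as a graded \<open>k\<close>-algebra, to
  \<open>k[x\<^sub>0, \<dots>, x\<^bsub>n-1\<^esub>] / (f\<^sub>1, \<dots>, f\<^sub>c)\<close> with variables of degree one and \<open>f\<^sub>1, \<dots>, f\<^sub>c\<close> a regular sequence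
  of forms; the isomorphism is given as a surjection with kernel \<open>(f\<^sub>1, \<dots>, f\<^sub>c)\<close>.\<close>

definition graded_complete_intersection ::
    "('k::field \<Rightarrow> 'g) \<Rightarrow> ('g, 'b) ring_scheme \<Rightarrow> (nat \<Rightarrow> 'g set) \<Rightarrow> bool" where
  "graded_complete_intersection \<iota> G Gr \<longleftrightarrow>
     (\<exists>n \<phi> fs.
        \<phi> \<in> ring_hom (mpoly_ring n :: 'k mpoly ring) G \<and>
        (\<forall>c. \<phi> (mpoly_const c) = \<iota> c) \<and>
        (\<forall>d. \<forall>p\<in>carrier (mpoly_ring n). homogeneous_mpoly d p \<longrightarrow> \<phi> p \<in> Gr d) \<and>
        \<phi> ` carrier (mpoly_ring n) = carrier G \<and>
        regular_sequence (mpoly_ring n) fs \<and>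
        (\<forall>f\<in>set fs. \<exists>d. homogeneous_mpoly d f) \<and>
        a_kernel (mpoly_ring n) G \<phi> = Idl\<^bsub>mpoly_ring n\<^esub> (set fs))"

text \<open>For \<open>A = k[[S]]\<close> with maximal ideal \<open>m\<close>, the associated graded ring is a \<open>k\<close>-algebra via
  \<open>k \<rightarrow> A \<rightarrow> A/m\<close>.\<close>

definition gr_semigroup_ring_CI :: "'k::field itself \<Rightarrow> nat set \<Rightarrow> bool" where
  "gr_semigroup_ring_CI _ S \<longleftrightarrow>
     (let A = (semigroup_ring S :: 'k fps ring); m = semigroup_ring_max S in
        graded_complete_intersection (\<lambda>c. degree_zero_class A m (fps_const c))
          (assoc_graded A m) (assoc_graded_component A m))"

end

theory Submission
  imports Defs "HOL-Computational_Algebra.Polynomial_FPS"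
begin

text \<open>Every odd element of \<open>T\<close> exceeds twice the multiplicity, and a sum of two odd elements has a
  representation by strictly more generators consisting of even elements. Hence \<open>ord\<close> on the
  even part of \<open>T\<close> is \<open>ord\<close> on \<open>S\<close>, \<open>\<beta>\<close> and \<open>\<gamma>\<close> are inherited by the even generators, and they equal \<open>1\<close>
  on the odd ones. As the Apery set is always contained in both rectangles, two odd
  generators would produce an element of \<open>Ap(S)\<close> larger than the top of the rectangle of \<open>S\<close>.

  The associated graded ring has a basis indexed by the semigroup and graded by \<open>ord\<close>. Forms
  \<open>f\<^sub>1, \<dots>, f\<^sub>c\<close> are a regular sequence iff the Hilbert series of the quotient is
  \<open>\<Prod>(1 - X\<^bsup>d\<^sub>i\<^esup>) / (1 - X)\<^sup>n\<close>; this reduces the complete intersection property to the existence of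
  generators of the right degrees for the ideal of relations between the minimal generators. If
  \<open>S\<close> and \<open>T\<close> need \<open>p\<close> and \<open>p + r\<close> generators, the ideal of \<open>T\<close> has fewer than \<open>p + r\<close> generators
  when \<open>T\<close> gives a complete intersection. More than \<open>r\<close> of them can be taken to be products of two
  odd variables if \<open>r > 1\<close>, which leaves fewer than \<open>p - 1\<close> for the ideal of \<open>S\<close>, too few for a
  quotient of dimension one. For \<open>r = 1\<close> the relations of \<open>T\<close> are those of \<open>S\<close> and \<open>y\<^sup>2\<close>.\<close>

section \<open>Numerical semigroups\<close>

text \<open>The gain in order comes from \<open>b\<close>: (2e + b) + (2f + b) = 2e + 2f + 2b, where
  \<open>e\<close> and \<open>f\<close> are nonzero because \<open>0 \<notin> E\<close>, and
  \<open>b \<in> S\<close> is nonzero because it is odd. Two odd summands thus become three nonzero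
  even ones. The definition of a complete intersection leaves open the number of variables, the
  forms and their order. Hilbert series remove these choices: the condition becomes an identity
  between products of factors 1 - X^d, which can be reordered and cancelled. The count that forces
  one odd generator plays off two properties of the graded ring. Its Hilbert function never
  vanishes, since d times the multiplicity has order d; so a complete intersection has fewer
  relations than variables. The function is also bounded by the multiplicity, since distinct
  elements of equal order are incongruent modulo it; so p variables for \<open>S\<close> need at
  least p - 1 relations. Among the products of two odd variables, the r squares and one mixed
  product are already one too many.\<close>

locale num_semigroup =
  fixes U :: "nat set"
  assumes nsg: "numerical_semigroup U"
begin

abbreviation "gens \<equiv> minimal_generators U"
abbreviation "mu \<equiv> multiplicity_of U"
abbreviation "ord \<equiv> semigroup_order U"

lemma zero_in [simp]: "0 \<in> U" and add_in: "\<lbrakk>x \<in> U; y \<in> U\<rbrakk> \<Longrightarrow> x + y \<in> U"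
  and fin_compl: "finite (- U)"
  using nsg by (auto simp: numerical_semigroup_def)

lemma mult_in: "u \<in> U \<Longrightarrow> k * u \<in> U"
  by (induction k) (auto intro: add_in)

lemma sum_in: "(\<And>i. i \<in> I \<Longrightarrow> f i \<in> U) \<Longrightarrow> (\<Sum>i\<in>I. f i) \<in> U"
  by (induction I rule: infinite_finite_induct) (auto intro: add_in)

lemma eventually_in: "\<exists>N. \<forall>n\<ge>N. n \<in> U"
  using fin_compl by (metis ComplI finite_nat_set_iff_bounded leD)

lemma mu_in [simp]: "mu \<in> U" and mu_pos: "mu > 0"
  and mu_le: "\<lbrakk>u \<in> U; u \<noteq> 0\<rbrakk> \<Longrightarrow> mu \<le> u"
proof -
  obtain N where N: "\<forall>n\<ge>N. n \<in> U" using eventually_in by blast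
  hence ex: "\<exists>u. u \<in> U \<and> u \<noteq> 0" by (intro exI[of _ "Suc N"]) auto
  show "mu \<in> U" "mu > 0" using LeastI_ex[OF ex] by (auto simp: multiplicity_of_def)
  show "mu \<le> u" if "u \<in> U" "u \<noteq> 0"
    using that by (auto simp: multiplicity_of_def intro: Least_le)
qed

lemma gens_subset: "g \<in> gens \<Longrightarrow> g \<in> U" and gens_pos: "g \<in> gens \<Longrightarrow> g > 0"
  by (auto simp: minimal_generators_def)

lemma gens_indec: "\<lbrakk>x \<in> U; y \<in> U; x \<noteq> 0; y \<noteq> 0\<rbrakk> \<Longrightarrow> x + y \<notin> gens"
  by (auto simp: minimal_generators_def)

lemma finite_gens [simp]: "finite gens"
proof -
  obtain N where N: "\<forall>n\<ge>N. n \<in> U" using eventually_in by blast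
  have "gens \<subseteq> {..N + mu}"
  proof
    fix g assume g: "g \<in> gens"
    show "g \<in> {..N + mu}"
    proof (rule ccontr)
      assume "g \<notin> {..N + mu}"
      hence "g > N + mu" by simp
      hence "mu + (g - mu) \<notin> gens" using N mu_pos by (intro gens_indec) auto
      with g \<open>g > N + mu\<close> show False by simp
    qed
  qed
  thus ?thesis by (rule finite_subset) simp
qed

lemma mu_gens: "mu \<in> gens"
proof -
  have "mu \<noteq> x + y" if "x \<in> U" "y \<in> U" "x \<noteq> 0" "y \<noteq> 0" for x y
    using mu_le[OF that(1,3)] mu_le[OF that(2,4)] mu_pos by linarith
  thus ?thesis using mu_pos by (auto simp: minimal_generators_def)
qed

section \<open>Representations by generators and the order of an element\<close>

lemma rep_add:
  "\<lbrakk>semigroup_representation U u c; semigroup_representation U v d\<rbrakk>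
    \<Longrightarrow> semigroup_representation U (u + v) (\<lambda>g. c g + d g)"
  by (auto simp: semigroup_representation_def algebra_simps sum.distrib)

lemma rep_gen:
  assumes "g \<in> gens"
  shows "semigroup_representation U (h * g) (\<lambda>x. if x = g then h else 0)"
proof -
  have "(\<Sum>x\<in>gens. (if x = g then h else 0) * x) = (\<Sum>x\<in>gens. if x = g then h * g else 0)"
    by (rule sum.cong) auto
  thus ?thesis using assms by (auto simp: semigroup_representation_def)
qed

lemma rep_in: "semigroup_representation U u c \<Longrightarrow> u \<in> U"
  unfolding semigroup_representation_def by (simp add: sum_in mult_in gens_subset)

lemma rep_exists: "u \<in> U \<Longrightarrow> \<exists>c. semigroup_representation U u c"
proof (induction u rule: less_induct)
  case (less u)
  consider "u = 0" | "u \<in> gens" | x y where "x \<in> U" "y \<in> U" "x \<noteq> 0" "y \<noteq> 0" "u = x + y"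
    using less.prems by (auto simp: minimal_generators_def)
  thus ?case
  proof cases
    case 1 thus ?thesis
      by (intro exI[of _ "\<lambda>_. 0"]) (auto simp: semigroup_representation_def)
  next
    case 2 thus ?thesis using rep_gen[of u 1] by auto
  next
    case 3 thus ?thesis using less.IH[of x] less.IH[of y] rep_add by fastforce
  qed
qed

text \<open>A nonzero summand contributes at least one generator, and conversely a generator with
  positive coefficient can be split off. The number of generators is only bounded below by
  \<open>l\<close>, because the recursion ends in \<open>fold_sum U 0 = U\<close>, where the last
  summand may be any element.\<close>

lemma fold_sum_iff:
  "u \<in> fold_sum U l \<longleftrightarrow> (\<exists>c. semigroup_representation U u c \<and> l \<le> (\<Sum>g\<in>gens. c g))"
proof (induction l arbitrary: u)
  case 0 thus ?case using rep_exists rep_in by auto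
next
  case (Suc l)
  show ?case
  proof
    assume "u \<in> fold_sum U (Suc l)"
    then obtain x y where xy: "u = x + y" "x \<in> U" "x \<noteq> 0" "y \<in> fold_sum U l" by auto
    obtain c where c: "semigroup_representation U x c" using rep_exists xy by blast
    obtain d where d: "semigroup_representation U y d" "l \<le> sum d gens" using Suc xy by blast
    have "sum c gens > 0"
    proof (rule ccontr, unfold not_gr_zero)
      assume "sum c gens = 0"
      hence "x = 0" using c by (auto simp: semigroup_representation_def)
      thus False using xy by simp
    qed
    thus "\<exists>c. semigroup_representation U u c \<and> Suc l \<le> sum c gens"
      using rep_add[OF c d(1)] d(2) xy(1)
        by (intro exI[of _ "\<lambda>g. c g + d g"]) (simp add: sum.distrib)
  next
    assume "\<exists>c. semigroup_representation U u c \<and> Suc l \<le> sum c gens"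
    then obtain c where c: "semigroup_representation U u c" "Suc l \<le> sum c gens" by blast
    then obtain g k where g: "g \<in> gens" "c g = Suc k"
      by (metis Suc_le_D not0_implies_Suc nat.distinct(1) sum.neutral)
    define d where "d = c(g := k)"
    have "sum c gens = Suc (sum d gens)"
      using g by (simp add: d_def sum.remove[OF finite_gens g(1)])
    moreover have "(\<Sum>g\<in>gens. c g * g) = g + (\<Sum>g\<in>gens. d g * g)"
      using g by (simp add: d_def sum.remove[OF finite_gens g(1)])
    moreover have "\<forall>g. g \<notin> gens \<longrightarrow> d g = 0"
      using c(1) g(1) by (auto simp: d_def semigroup_representation_def)
    ultimately have "u = g + (\<Sum>g\<in>gens. d g * g)" "(\<Sum>g\<in>gens. d g * g) \<in> fold_sum U l"
      using Suc c by (auto simp: semigroup_representation_def)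
    thus "u \<in> fold_sum U (Suc l)" using gens_subset[OF g(1)] gens_pos[OF g(1)] by auto
  qed
qed

lemma rep_sum_le: "semigroup_representation U u c \<Longrightarrow> (\<Sum>g\<in>gens. c g) \<le> u"
proof -
  assume r: "semigroup_representation U u c"
  have "(\<Sum>g\<in>gens. c g) \<le> (\<Sum>g\<in>gens. c g * g)"
    by (rule sum_mono) (use gens_pos in \<open>auto simp: Suc_leI\<close>)
  thus ?thesis using r by (auto simp: semigroup_representation_def)
qed

lemma finite_orders: "finite {l. u \<in> fold_sum U l}"
  by (rule finite_subset[of _ "{..u}"]) (auto simp: fold_sum_iff dest: rep_sum_le intro: order_trans)

lemma fold_sum_subset: "u \<in> fold_sum U l \<Longrightarrow> u \<in> U"
  using fold_sum_iff rep_in by blast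

text \<open>This makes \<open>ord\<close> usable: the \<open>Max\<close> in its definition is
  attained, the set being bounded by \<open>u\<close> and containing 0 for
  \<open>u \<in> U\<close>.\<close>

lemma in_fold_sum_iff: "u \<in> fold_sum U l \<longleftrightarrow> u \<in> U \<and> l \<le> ord u"
proof
  assume a: "u \<in> fold_sum U l"
  thus "u \<in> U \<and> l \<le> ord u"
    using fold_sum_subset finite_orders by (auto simp: semigroup_order_def intro!: Max_ge)
next
  assume a: "u \<in> U \<and> l \<le> ord u"
  hence "0 \<in> {l. u \<in> fold_sum U l}" by simp
  hence "ord u \<in> {l. u \<in> fold_sum U l}"
    unfolding semigroup_order_def by (intro Max_in finite_orders) blast
  thus "u \<in> fold_sum U l" using a by (auto simp: fold_sum_iff)
qed

lemma rep_le_ord: "semigroup_representation U u c \<Longrightarrow> (\<Sum>g\<in>gens. c g) \<le> ord u"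
  using fold_sum_iff in_fold_sum_iff by blast

lemma maximal_rep_exists: "u \<in> U \<Longrightarrow> \<exists>c. maximal_representation U u c"
  using in_fold_sum_iff[of u "ord u"] rep_le_ord
  by (auto simp: fold_sum_iff maximal_representation_def intro: antisym)

lemma ord_add: assumes "u \<in> U" "v \<in> U" shows "ord u + ord v \<le> ord (u + v)"
proof -
  obtain c d where "maximal_representation U u c" "maximal_representation U v d"
    using assms maximal_rep_exists by blast
  thus ?thesis using rep_le_ord[OF rep_add, of u c v d]
    by (auto simp: maximal_representation_def sum.distrib)
qed

lemma ord_le: "u \<in> U \<Longrightarrow> ord u \<le> u"
  using maximal_rep_exists[of u] rep_sum_le by (metis maximal_representation_def)

lemma ord_zero [simp]: "ord 0 = 0"
  using ord_le[of 0] by simp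

lemma ord_pos: assumes "u \<in> U" "u \<noteq> 0" shows "ord u \<ge> 1"
proof -
  have "u \<in> fold_sum U (Suc 0)" using assms unfolding fold_sum.simps mem_Collect_eq
    by (intro exI[of _ u] exI[of _ 0]) simp
  thus ?thesis using in_fold_sum_iff by (metis One_nat_def)
qed

lemma ord_gen: assumes "g \<in> gens" shows "ord g = 1"
proof -
  have "\<not> 2 \<le> ord g"
  proof
    assume "2 \<le> ord g"
    hence "g \<in> fold_sum U (Suc (Suc 0))" using assms gens_subset in_fold_sum_iff
      by (metis numeral_2_eq_2)
    then obtain x y z where *: "g = x + (y + z)" "x \<in> U - {0}" "y \<in> U - {0}" "z \<in> U" by auto
    hence "x + (y + z) \<notin> gens" by (intro gens_indec add_in) auto
    thus False using * assms by simp
  qed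
  moreover have "ord g \<ge> 1" using assms gens_subset gens_pos ord_pos by force
  ultimately show ?thesis by linarith
qed

text \<open>Generators are recognised by their order, so that in the duplication they can be found
  from the computation of orders alone.\<close>

lemma gens_iff_ord: "g \<in> gens \<longleftrightarrow> g \<in> U \<and> ord g = 1"
proof
  assume g: "g \<in> U \<and> ord g = 1"
  have "g \<noteq> x + y" if "x \<in> U" "y \<in> U" "x \<noteq> 0" "y \<noteq> 0" for x y
    using ord_add[OF that(1,2)] ord_pos[OF that(1,3)] ord_pos[OF that(2,4)] g by auto
  moreover have "g \<noteq> 0" using g by (metis ord_zero zero_neq_one)
  ultimately show "g \<in> gens" using g by (auto simp: minimal_generators_def)
qed (use ord_gen gens_subset in auto)

lemma ord_mult_ge: "u \<in> U \<Longrightarrow> k * ord u \<le> ord (k * u)"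
proof (induction k)
  case (Suc k) thus ?case using ord_add[of u "k * u"] mult_in[of u k] by simp
qed auto

text \<open>Every generator is at least \<open>mu\<close>, so a sum of more than \<open>k\<close>
  generators exceeds \<open>k * mu\<close>.\<close>

lemma ord_mult_mu: "ord (k * mu) = k"
proof -
  obtain c where c: "maximal_representation U (k * mu) c"
    using maximal_rep_exists mult_in by (metis mu_in)
  have "(\<Sum>g\<in>gens. c g) * mu \<le> (\<Sum>g\<in>gens. c g * g)"
    unfolding sum_distrib_right by (rule sum_mono) (use mu_le gens_subset gens_pos in force)
  hence "ord (k * mu) * mu \<le> k * mu"
    using c by (auto simp: maximal_representation_def semigroup_representation_def)
  moreover have "k \<le> ord (k * mu)" using ord_mult_ge[of mu k] mu_gens by (simp add: ord_gen)
  ultimately show ?thesis using mu_pos by simp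
qed

section \<open>The Apery set and maximal representations\<close>

lemma apery_iff: "u \<in> apery_set U \<longleftrightarrow> u \<in> U \<and> (\<forall>v\<in>U. u \<noteq> v + mu)"
  by (auto simp: apery_set_def)

lemma apery_in: "u \<in> apery_set U \<Longrightarrow> u \<in> U" by (simp add: apery_iff)

lemma apery_divisor: "\<lbrakk>u + v \<in> apery_set U; u \<in> U; v \<in> U\<rbrakk> \<Longrightarrow> u \<in> apery_set U"
  unfolding apery_iff using add_in by (metis add.assoc add.commute)

lemma finite_apery [simp]: "finite (apery_set U)"
proof -
  obtain N where N: "\<forall>n\<ge>N. n \<in> U" using eventually_in by blast
  have "apery_set U \<subseteq> {..N + mu}"
  proof
    fix u assume u: "u \<in> apery_set U"
    show "u \<in> {..N + mu}"
    proof (rule ccontr)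
      assume "u \<notin> {..N + mu}"
      hence "u - mu \<in> U" "u = (u - mu) + mu" using N by auto
      thus False using u by (auto simp: apery_iff)
    qed
  qed
  thus ?thesis by (rule finite_subset) simp
qed

lemma apery_gen: assumes "g \<in> gens" "g \<noteq> mu" shows "g \<in> apery_set U"
  unfolding apery_iff
proof (intro conjI ballI)
  fix v assume v: "v \<in> U"
  show "g \<noteq> v + mu" using gens_indec[OF v mu_in] mu_pos assms by (cases "v = 0") auto
qed (use assms gens_subset in auto)

lemma apery_mu: "k * mu \<in> apery_set U \<Longrightarrow> k = 0"
  by (cases k) (auto simp: apery_iff mult_in algebra_simps dest: bspec[where x = "(k - 1) * mu"])

text \<open>Superadditivity of \<open>ord\<close> leaves no slack: if a part of a maximal
  representation could be lengthened, the whole could be too.\<close>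

lemma maximal_rep_split:
  assumes "maximal_representation U u (\<lambda>g. c g + d g)" 
  shows "\<exists>v w. u = v + w \<and> maximal_representation U v c \<and> maximal_representation U w d"
proof -
  let ?v = "\<Sum>g\<in>gens. c g * g" and ?w = "\<Sum>g\<in>gens. d g * g"
  have rv: "semigroup_representation U ?v c" and rw: "semigroup_representation U ?w d"
    and u: "u = ?v + ?w"
    using assms by (auto simp: maximal_representation_def semigroup_representation_def
        algebra_simps sum.distrib)
  have "sum c gens + sum d gens = ord u"
    using assms by (simp add: maximal_representation_def sum.distrib)
  moreover have "ord ?v + ord ?w \<le> ord u" using ord_add rep_in rv rw u by auto
  ultimately have "sum c gens = ord ?v" "sum d gens = ord ?w"
    using rep_le_ord[OF rv] rep_le_ord[OF rw] by linarith+
  thus ?thesis using rv rw u by (auto simp: maximal_representation_def)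
qed

lemma maximal_rep_gen_multiple:
  assumes "maximal_representation U u c" "h \<le> c g" "g \<in> gens"
  shows "maximal_representation U (h * g) (\<lambda>x. if x = g then h else 0)" "ord (h * g) = h"
    and "\<exists>w. u = h * g + w \<and> maximal_representation U w (c(g := c g - h))"
proof -
  have eq: "c = (\<lambda>x. (if x = g then h else 0) + (c(g := c g - h)) x)" using assms by auto
  obtain v w where vw: "u = v + w" "maximal_representation U v (\<lambda>x. if x = g then h else 0)"
      "maximal_representation U w (c(g := c g - h))"
    using maximal_rep_split[OF back_subst[where P = "maximal_representation U u", OF assms(1) eq]]
    by blast
  have v: "v = h * g" using vw(2) rep_gen[OF assms(3), of h]
    by (auto simp: maximal_representation_def semigroup_representation_def)
  thus "maximal_representation U (h * g) (\<lambda>x. if x = g then h else 0)"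
    "\<exists>w. u = h * g + w \<and> maximal_representation U w (c(g := c g - h))" using vw by auto
  thus "ord (h * g) = h" using assms(3) by (simp add: maximal_representation_def)
qed

definition beta_ok :: "nat \<Rightarrow> nat \<Rightarrow> bool" where
  "beta_ok g h \<longleftrightarrow> h * g \<in> apery_set U \<and> ord (h * g) = h"

definition gamma_ok :: "nat \<Rightarrow> nat \<Rightarrow> bool" where
  "gamma_ok g h \<longleftrightarrow> h * g \<in> apery_set U \<and> ord (h * g) = h \<and>
     (\<exists>!c. maximal_representation U (h * g) c)"

lemma beta_eq: "beta U g = Max {h. beta_ok g h}" and gamma_eq: "gamma U g = Max {h. gamma_ok g h}"
  by (auto simp: beta_def gamma_def beta_ok_def gamma_ok_def)

lemma gamma_imp_beta: "gamma_ok g h \<Longrightarrow> beta_ok g h"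
  by (simp add: gamma_ok_def beta_ok_def)

lemma finite_beta_ok: assumes "g \<in> gens" shows "finite {h. beta_ok g h}"
proof -
  have "(\<lambda>h. h * g) ` {h. beta_ok g h} \<subseteq> apery_set U" by (auto simp: beta_ok_def)
  moreover have "inj_on (\<lambda>h. h * g) {h. beta_ok g h}"
    using gens_pos[OF assms] by (auto simp: inj_on_def)
  ultimately show ?thesis using finite_apery inj_on_finite by blast
qed

lemma beta_le: "\<lbrakk>g \<in> gens; beta_ok g h\<rbrakk> \<Longrightarrow> h \<le> beta U g"
  unfolding beta_eq by (rule Max_ge) (auto simp: finite_beta_ok)

lemma maximal_rep_zero: "maximal_representation U 0 c \<longleftrightarrow> c = (\<lambda>_. 0)"
proof
  assume "maximal_representation U 0 c"
  thus "c = (\<lambda>_. 0)"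
    by (auto simp: maximal_representation_def semigroup_representation_def fun_eq_iff)
next
  assume "c = (\<lambda>_. 0)"
  thus "maximal_representation U 0 c"
    by (auto simp: maximal_representation_def semigroup_representation_def)
qed

text \<open>\<open>Max\<close> needs a nonempty set. Zero always qualifies, its empty representation
  being the only one.\<close>

lemma gamma_ok_0: "gamma_ok g 0"
  using mu_pos by (auto simp: gamma_ok_def maximal_rep_zero apery_iff)

lemma finite_gamma_ok: "g \<in> gens \<Longrightarrow> finite {h. gamma_ok g h}"
  using finite_beta_ok[of g] gamma_imp_beta by (auto intro: finite_subset[OF Collect_mono])

lemma gamma_le: "\<lbrakk>g \<in> gens; gamma_ok g h\<rbrakk> \<Longrightarrow> h \<le> gamma U g"
  unfolding gamma_eq by (rule Max_ge) (auto simp: finite_gamma_ok)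

lemma gamma_le_beta: assumes "g \<in> gens" shows "gamma U g \<le> beta U g"
proof -
  have "gamma_ok g (gamma U g)"
    unfolding gamma_eq using Max_in[OF finite_gamma_ok[OF assms]] gamma_ok_0 by auto
  thus ?thesis using assms beta_le gamma_imp_beta by blast
qed

text \<open>Among the maximal representations, one with the largest value of \<open>\<Sum>c\<^sub>g g\<^sup>2\<close> has all its
  coefficients bounded by \<open>\<gamma>\<close>: replacing a multiple of a generator by another
  representation with the same number of summands increases this sum, by strict convexity.\<close>

lemma apery_subset_rectangle_gamma: "apery_set U \<subseteq> rectangle U (gamma U)"
proof
  fix u assume u: "u \<in> apery_set U"
  define Q where "Q c = (\<Sum>g\<in>gens. c g * g\<^sup>2)" for c :: "nat \<Rightarrow> nat"
  obtain c0 where c0: "maximal_representation U u c0" using u apery_in maximal_rep_exists by blast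
  \<comment> \<open>A bound on the generators bounds \<open>Q\<close> over all maximal
    representations of \<open>u\<close>, so that a maximum of \<open>Q\<close> exists.\<close>
  obtain B where B: "\<And>g. g \<in> gens \<Longrightarrow> g \<le> B" using finite_gens
    by (meson finite_nat_set_iff_bounded_le)
  have bound: "Q c \<le> u * B" if "maximal_representation U u c" for c
  proof -
    have "Q c \<le> (\<Sum>g\<in>gens. c g * g * B)" unfolding Q_def
      by (rule sum_mono) (auto simp: power2_eq_square B)
    also have "\<dots> = u * B" using that
      by (auto simp: maximal_representation_def semigroup_representation_def sum_distrib_right)
    finally show ?thesis .
  qed
  obtain c where c: "maximal_representation U u c"
    and cmax: "\<And>d. maximal_representation U u d \<Longrightarrow> Q d \<le> Q c"
    using ex_has_greatest_nat[where P = "maximal_representation U u" and f = Q and k = c0 and b = "Suc (u * B)"]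
      c0 bound by (auto simp: less_Suc_eq_le)
  have le: "c g \<le> gamma U g" if g: "g \<in> gens" for g
  proof (rule ccontr)
    assume "\<not> c g \<le> gamma U g"
    define h where "h = Suc (gamma U g)"
    have hc: "h \<le> c g" using \<open>\<not> c g \<le> gamma U g\<close> h_def by simp
    note m = maximal_rep_gen_multiple[OF c hc g]
    obtain w where w: "u = h * g + w" "maximal_representation U w (c(g := c g - h))" using m(3)
      by blast
    have "w \<in> U" using w(2) rep_in by (auto simp: maximal_representation_def)
    hence "h * g \<in> apery_set U" using apery_divisor[of "h * g" w] u w(1) mult_in gens_subset g
      by auto
    moreover have "\<not> gamma_ok g h" using gamma_le[OF g, of h] by (auto simp: h_def)
    ultimately have "\<not> (\<exists>!c. maximal_representation U (h * g) c)" using m(2)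
      by (simp add: gamma_ok_def)
    then obtain d where d: "maximal_representation U (h * g) d" "d \<noteq> (\<lambda>x. if x = g then h else 0)"
      using m(1) by blast
    have d1: "sum d gens = h" "(\<Sum>x\<in>gens. d x * x) = h * g" "\<And>x. x \<notin> gens \<Longrightarrow> d x = 0"
      using d(1) m(2) by (auto simp: maximal_representation_def semigroup_representation_def)
    let ?e = "\<lambda>x. d x + (c(g := c g - h)) x"
    have "semigroup_representation U u ?e"
      unfolding w(1) using d(1) w(2)
        by (intro rep_add) (simp_all add: maximal_representation_def del: fun_upd_apply)
    moreover have "sum ?e gens = ord u"
    proof -
      have "ord u = sum c gens" using c by (simp add: maximal_representation_def)
      also have "\<dots> = h + sum (c(g := c g - h)) gens"
        using hc by (simp add: sum.remove[OF finite_gens g])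
      finally show ?thesis using d1 by (simp add: sum.distrib)
    qed
    ultimately have "maximal_representation U u ?e" by (simp add: maximal_representation_def)
    hence "Q ?e \<le> Q c" by (rule cmax)
    moreover have "Q ?e = Q d + Q (c(g := c g - h))"
      by (simp add: Q_def algebra_simps sum.distrib)
    moreover have "Q c = h * g\<^sup>2 + Q (c(g := c g - h))"
    proof -
      have "c g * g\<^sup>2 = h * g\<^sup>2 + (c g - h) * g\<^sup>2"
        using hc by (metis add_mult_distrib le_add_diff_inverse)
      thus ?thesis by (simp add: Q_def sum.remove[OF finite_gens g])
    qed
    ultimately have "Q d \<le> h * g\<^sup>2" by simp
    hence Qd: "(\<Sum>x\<in>gens. int (d x) * (int x)\<^sup>2) \<le> int h * (int g)\<^sup>2"
      unfolding Q_def by (simp add: of_nat_mono flip: of_nat_power of_nat_mult of_nat_sum)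
    have s0: "(\<Sum>x\<in>gens. int (d x)) = int h" and s1: "(\<Sum>x\<in>gens. int (d x) * int x) = int h * int g"
      using d1(1,2) by (simp_all flip: of_nat_mult of_nat_sum)
    \<comment> \<open>This is \<open>h\<close> times the variance of the generators weighted by
      \<open>d\<close>, whose mean is \<open>g\<close>. Being both nonnegative and at most 0, it
      vanishes and concentrates \<open>d\<close> on \<open>g\<close>.\<close>
    have "(\<Sum>x\<in>gens. int (d x) * (int x - int g)\<^sup>2) =
       (\<Sum>x\<in>gens. int (d x) * (int x)\<^sup>2 - 2 * int g * (int (d x) * int x) + (int g)\<^sup>2 * int (d x))"
      by (rule sum.cong) (auto simp: power2_eq_square algebra_simps)
    also have "\<dots> = (\<Sum>x\<in>gens. int (d x) * (int x)\<^sup>2) - 2 * int g * (int h * int g) + (int g)\<^sup>2 * int h"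
      by (simp only: sum.distrib sum_subtractf sum_distrib_left[symmetric] s0 s1)
    also have "\<dots> \<le> 0" using Qd by (simp add: power2_eq_square algebra_simps)
    finally have "(\<Sum>x\<in>gens. int (d x) * (int x - int g)\<^sup>2) = 0"
      by (intro antisym sum_nonneg) auto
    hence "\<forall>x\<in>gens. int (d x) * (int x - int g)\<^sup>2 = 0"
      by (subst (asm) sum_nonneg_eq_0_iff) auto
    hence dz: "d x = 0" if "x \<noteq> g" for x using that d1(3) by (cases "x \<in> gens") auto
    have "d g = h" using d1(1) dz by (simp add: sum.remove[OF finite_gens g])
    with dz have "d = (\<lambda>x. if x = g then h else 0)" by auto
    with d(2) show False ..
  qed
  have "c mu = 0"
  proof -
    obtain w where w: "u = c mu * mu + w" "maximal_representation U w (c(mu := c mu - c mu))"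
      using maximal_rep_gen_multiple(3)[OF c order_refl mu_gens] by blast
    have "w \<in> U" using w(2) rep_in by (auto simp: maximal_representation_def)
    hence "c mu * mu \<in> apery_set U" using apery_divisor[of "c mu * mu" w] u w(1) mult_in by auto
    thus ?thesis by (rule apery_mu)
  qed
  hence "u = (\<Sum>g\<in>gens - {mu}. c g * g)"
    using c by (auto simp: maximal_representation_def semigroup_representation_def
        sum.remove[OF finite_gens mu_gens])
  thus "u \<in> rectangle U (gamma U)" using le by (auto simp: rectangle_def)
qed

lemma apery_subset_rectangle_beta: "apery_set U \<subseteq> rectangle U (beta U)"
proof -
  have "x \<in> rectangle U (beta U)" if x: "x \<in> rectangle U (gamma U)" for x
  proof -
    obtain l where l: "x = (\<Sum>g\<in>gens - {mu}. l g * g)" "\<forall>g\<in>gens - {mu}. l g \<le> gamma U g"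
      using x by (auto simp: rectangle_def)
    have "\<forall>g\<in>gens - {mu}. l g \<le> beta U g"
      using l(2) gamma_le_beta by (meson DiffD1 order_trans)
    thus ?thesis using l(1) unfolding rectangle_def by blast
  qed
  thus ?thesis using apery_subset_rectangle_gamma by blast
qed

end

section \<open>The numerical duplication\<close>

locale semigroup_duplication = S: num_semigroup S for S :: "nat set" +
  fixes E T :: "nat set" and b :: nat
  assumes ideal: "semigroup_ideal S E" and zero_notin: "0 \<notin> E" and b_in: "b \<in> S" and b_odd: "odd b"
    and T_def: "T = numerical_duplication S b E"
begin

lemma E_in: "e \<in> E \<Longrightarrow> e \<in> S" and E_add: "\<lbrakk>e \<in> E; s \<in> S\<rbrakk> \<Longrightarrow> e + s \<in> E" and E_ne: "E \<noteq> {}"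
  using ideal by (auto simp: semigroup_ideal_def)

lemma E_nonzero: "e \<in> E \<Longrightarrow> e \<noteq> 0"
  using zero_notin by metis

lemma b_nonzero: "b \<noteq> 0"
  using b_odd by (metis even_zero)

lemma even_in_iff [simp]: "2 * s \<in> T \<longleftrightarrow> s \<in> S"
proof -
  have "2 * s \<noteq> 2 * e + b" for e using b_odd by presburger
  thus ?thesis by (auto simp: T_def numerical_duplication_def)
qed

lemma odd_in_iff [simp]: "2 * e + b \<in> T \<longleftrightarrow> e \<in> E"
proof -
  have "2 * s \<noteq> 2 * e + b" for s using b_odd by presburger
  hence "2 * e + b \<noteq> 2 * s" for s by metis
  thus ?thesis by (auto simp: T_def numerical_duplication_def)
qed

lemma T_cases:
  assumes "x \<in> T"
  obtains (even) s where "s \<in> S" "x = 2 * s" | (odd) e where "e \<in> E" "x = 2 * e + b"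
  using assms by (auto simp: T_def numerical_duplication_def)

lemma even_T: assumes "x \<in> T" "even x" obtains s where "s \<in> S" "x = 2 * s"
  using assms b_odd by (cases rule: T_cases) auto

lemma odd_T: assumes "x \<in> T" "odd x" obtains e where "e \<in> E" "x = 2 * e + b"
  using assms b_odd by (cases rule: T_cases) auto

lemma numerical_semigroup_T: "numerical_semigroup T"
  unfolding numerical_semigroup_def
proof (intro conjI ballI)
  show "0 \<in> T" using even_in_iff[of 0] by simp
next
  fix x y assume xy: "x \<in> T" "y \<in> T"
  show "x + y \<in> T"
  proof (cases rule: T_cases[OF xy(1)]; cases rule: T_cases[OF xy(2)])
    fix s t assume "s \<in> S" "x = 2 * s" "t \<in> S" "y = 2 * t"
    thus ?thesis using even_in_iff[of "s + t"] S.add_in by (simp add: algebra_simps)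
  next
    fix s e assume "s \<in> S" "x = 2 * s" "e \<in> E" "y = 2 * e + b"
    thus ?thesis using odd_in_iff[of "e + s"] E_add by (simp add: algebra_simps)
  next
    fix s e assume "e \<in> E" "x = 2 * e + b" "s \<in> S" "y = 2 * s"
    thus ?thesis using odd_in_iff[of "e + s"] E_add by (simp add: algebra_simps)
  next
    fix e f assume "e \<in> E" "x = 2 * e + b" "f \<in> E" "y = 2 * f + b"
    thus ?thesis using even_in_iff[of "e + f + b"] S.add_in E_in b_in by (simp add: algebra_simps)
  qed
next
  obtain N where N: "\<forall>n\<ge>N. n \<in> S" using S.eventually_in by blast
  obtain e where e: "e \<in> E" using E_ne by blast
  have "x < 2 * (N + e) + b" if "x \<in> - T" for x
  proof (rule ccontr)
    assume x: "\<not> x < 2 * (N + e) + b"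
    show False
    proof (cases "even x")
      case True
      then obtain s where "x = 2 * s" by auto
      thus False using that x N by auto
    next
      case False
      then obtain k where k: "x = 2 * k + b" using b_odd x
        by (metis add_leD2 even_add even_diff_nat le_add_diff_inverse2 evenE linorder_not_less)
      have "e + (k - e) \<in> E" using x k N by (intro E_add e) auto
      thus False using that x k by auto
    qed
  qed
  thus "finite (- T)" unfolding finite_nat_set_iff_bounded by blast
qed

sublocale T: num_semigroup T
  by unfold_locales (rule numerical_semigroup_T)

section \<open>Multiplicity and order in the duplication\<close>

lemma mu_T: "T.mu = 2 * S.mu"
proof (rule antisym)
  show "T.mu \<le> 2 * S.mu" using S.mu_pos by (intro T.mu_le) auto
  show "2 * S.mu \<le> T.mu"
  proof (cases rule: T_cases[OF T.mu_in])
    case (1 s) thus ?thesis using S.mu_le[of s] T.mu_pos by auto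
  next
    case (2 e) thus ?thesis using S.mu_le[of e] E_in E_nonzero by fastforce
  qed
qed

text \<open>An odd element is tracked through one odd summand \<open>2 * e' + b\<close> and an even
  rest \<open>2 * s\<close>; the odd summand accounts for the \<open>Suc\<close>. With this
  invariant the induction never has to know how many odd summands a decomposition contains, since a
  pair of them is absorbed into the even part.\<close>

lemma fold_sum_T:
  "x \<in> fold_sum T l \<Longrightarrow>
    (\<forall>s. x = 2 * s \<longrightarrow> s \<in> S \<and> l \<le> S.ord s) \<and>
    (\<forall>e. x = 2 * e + b \<longrightarrow> (\<exists>e'\<in>E. \<exists>s\<in>S. e = e' + s \<and> l \<le> Suc (S.ord s)))"
proof (induction l arbitrary: x)
  case 0
  hence "x \<in> T" by simp
  moreover have "\<exists>e'\<in>E. \<exists>s\<in>S. e = e' + s" if "e \<in> E" for e using that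
    by (metis add_0_right S.zero_in)
  ultimately show ?case by auto
next
  case (Suc l)
  then obtain y z where yz: "x = y + z" "y \<in> T" "y \<noteq> 0" "z \<in> fold_sum T l" by auto
  have zT: "z \<in> T" using yz T.fold_sum_subset by blast
  note IH = Suc.IH[OF yz(4)]
  consider (ee) a s where "a \<in> S" "s \<in> S" "y = 2 * a" "z = 2 * s"
    | (eo) a e where "a \<in> S" "e \<in> E" "y = 2 * a" "z = 2 * e + b"
    | (oe) e s where "e \<in> E" "s \<in> S" "y = 2 * e + b" "z = 2 * s"
    | (oo) e f where "e \<in> E" "f \<in> E" "y = 2 * e + b" "z = 2 * f + b"
    using T_cases[OF yz(2)] T_cases[OF zT] by metis
  thus ?case
  proof cases
    case ee
    have "S.ord a + S.ord s \<le> S.ord (a + s)" using ee S.ord_add by blast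
    moreover have "S.ord a \<ge> 1" using ee yz S.ord_pos by auto
    moreover have "l \<le> S.ord s" using IH ee by blast
    ultimately have "Suc l \<le> S.ord (a + s)" "a + s \<in> S" using S.add_in ee by auto
    moreover have x: "x = 2 * (a + s)" using ee yz by simp
    moreover have "t = a + s" if "x = 2 * t" for t using that x by simp
    moreover have "x \<noteq> 2 * e + b" for e using b_odd x by presburger
    ultimately show ?thesis by metis
  next
    case eo
    obtain e' s where es: "e' \<in> E" "s \<in> S" "e = e' + s" "l \<le> Suc (S.ord s)" using IH eo by blast
    have "S.ord a + S.ord s \<le> S.ord (a + s)" using eo es S.ord_add by blast
    moreover have "S.ord a \<ge> 1" using eo yz S.ord_pos by auto
    moreover have x: "x = 2 * (e' + (a + s)) + b" using eo yz es by simp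
    moreover have "x \<noteq> 2 * t" for t using b_odd x by presburger
    moreover have "f = e' + (a + s)" if "x = 2 * f + b" for f using that x by simp
    moreover have "a + s \<in> S" "Suc l \<le> Suc (S.ord (a + s))"
      using es eo S.add_in[of a s] calculation by auto
    ultimately show ?thesis using es by metis
  next
    case oe
    have x: "x = 2 * (e + s) + b" using oe yz by simp
    moreover have "x \<noteq> 2 * t" for t using b_odd x by presburger
    moreover have "f = e + s" if "x = 2 * f + b" for f using that x by simp
    moreover have "Suc l \<le> Suc (S.ord s)" using IH oe by simp
    ultimately show ?thesis using oe by metis
  next
    case oo
    \<comment> \<open>Two odd summands become \<open>2 * ((e + f') + (b + s))\<close>. The nonzero
      elements \<open>e\<close>, \<open>f'\<close>, \<open>b\<close> of \<open>S\<close> add at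
      least three to the order of \<open>s\<close>, one more than the claim requires.\<close>
    obtain f' s where fs: "f' \<in> E" "s \<in> S" "f = f' + s" "l \<le> Suc (S.ord s)" using IH oo by blast
    have x: "x = 2 * ((e + f') + (b + s))" using oo yz fs by simp
    have "S.ord e \<ge> 1" "S.ord f' \<ge> 1" "S.ord b \<ge> 1"
      using S.ord_pos E_in oo fs E_nonzero b_in b_nonzero by blast+
    moreover have "S.ord (e + f') + S.ord (b + s) \<le> S.ord ((e + f') + (b + s))"
      "S.ord e + S.ord f' \<le> S.ord (e + f')" "S.ord b + S.ord s \<le> S.ord (b + s)"
      using S.ord_add S.add_in E_in oo fs b_in by blast+
    ultimately have "Suc l \<le> S.ord ((e + f') + (b + s))" using fs by linarith
    moreover have "(e + f') + (b + s) \<in> S"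
      by (intro S.add_in) (use E_in oo fs b_in in auto)
    moreover have "t = (e + f') + (b + s)" if "x = 2 * t" for t using that x by simp
    moreover have "x \<noteq> 2 * e + b" for e using b_odd x by presburger
    ultimately show ?thesis by metis
  qed
qed

lemma fold_sum_even: "s \<in> fold_sum S l \<Longrightarrow> 2 * s \<in> fold_sum T l"
proof (induction l arbitrary: s)
  case (Suc l)
  then obtain x y where "s = x + y" "x \<in> S" "x \<noteq> 0" "y \<in> fold_sum S l" by auto
  thus ?case using Suc.IH[of y] unfolding fold_sum.simps mem_Collect_eq
    by (intro exI[of _ "2 * x"] exI[of _ "2 * y"]) simp
qed simp

lemma ord_T_even: assumes "s \<in> S" shows "T.ord (2 * s) = S.ord s"
proof (rule antisym)
  show "S.ord s \<le> T.ord (2 * s)"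
    using fold_sum_even[of s "S.ord s"] assms T.in_fold_sum_iff S.in_fold_sum_iff by blast
  have "2 * s \<in> fold_sum T (T.ord (2 * s))" using assms by (simp add: T.in_fold_sum_iff)
  thus "T.ord (2 * s) \<le> S.ord s" using fold_sum_T by blast
qed

lemma ord_T_odd_le:
  assumes "e \<in> E"
  obtains e' s where "e' \<in> E" "s \<in> S" "e = e' + s" "T.ord (2 * e + b) \<le> Suc (S.ord s)"
proof -
  have "2 * e + b \<in> fold_sum T (T.ord (2 * e + b))" using assms by (simp add: T.in_fold_sum_iff)
  thus ?thesis using fold_sum_T that by blast
qed

lemma ord_T_odd_ge:
  assumes "e \<in> E" "s \<in> S"
  shows "Suc (S.ord s) \<le> T.ord (2 * (e + s) + b)"
proof -
  have "T.ord (2 * e + b) + T.ord (2 * s) \<le> T.ord ((2 * e + b) + 2 * s)"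
    using assms by (intro T.ord_add) auto
  moreover have "T.ord (2 * e + b) \<ge> 1" using assms b_nonzero by (intro T.ord_pos) auto
  moreover have "(2 * e + b) + 2 * s = 2 * (e + s) + b" by simp
  ultimately show ?thesis using assms by (simp add: ord_T_even)
qed

text \<open>The strictness is the effect of \<open>b\<close>: the two orders are at most
  \<open>Suc (S.ord s)\<close> and \<open>Suc (S.ord t)\<close>, while the sum is twice
  \<open>e' + f' + b + (s + t)\<close>, whose first three terms have order at least one each. The
  vanishing of products of odd classes in the graded ring rests on this inequality.\<close>

lemma ord_odd_odd:
  assumes "x \<in> T" "y \<in> T" "odd x" "odd y"
  shows "T.ord x + T.ord y < T.ord (x + y)"
proof -
  obtain e where e: "e \<in> E" "x = 2 * e + b" using odd_T assms by blast
  obtain f where f: "f \<in> E" "y = 2 * f + b" using odd_T assms by blast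
  obtain e' s where es: "e' \<in> E" "s \<in> S" "e = e' + s" "T.ord (2 * e + b) \<le> Suc (S.ord s)"
    using ord_T_odd_le e by blast
  obtain f' t where ft: "f' \<in> E" "t \<in> S" "f = f' + t" "T.ord (2 * f + b) \<le> Suc (S.ord t)"
    using ord_T_odd_le f by blast
  have "S.ord e' \<ge> 1" "S.ord f' \<ge> 1" "S.ord b \<ge> 1"
    using S.ord_pos E_in es ft E_nonzero b_in b_nonzero by blast+
  moreover have "S.ord (e' + f' + b) + S.ord (s + t) \<le> S.ord ((e' + f' + b) + (s + t))"
     "S.ord (e' + f') + S.ord b \<le> S.ord (e' + f' + b)"
     "S.ord e' + S.ord f' \<le> S.ord (e' + f')" "S.ord s + S.ord t \<le> S.ord (s + t)"
    by (intro S.ord_add S.add_in; use E_in es ft b_in in auto)+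
  moreover have "T.ord (x + y) = S.ord ((e' + f' + b) + (s + t))"
  proof -
    have "x + y = 2 * ((e' + f' + b) + (s + t))" using e f es ft by simp
    moreover have "(e' + f' + b) + (s + t) \<in> S"
      by (intro S.add_in) (use E_in es ft b_in in auto)
    ultimately show ?thesis using ord_T_even by metis
  qed
  moreover have "T.ord x \<le> Suc (S.ord s)" "T.ord y \<le> Suc (S.ord t)" using e f es ft by simp_all
  ultimately show ?thesis by linarith
qed

section \<open>Even and odd generators of the duplication\<close>

lemma gens_T_even: "2 * g \<in> T.gens \<longleftrightarrow> g \<in> S.gens"
  by (auto simp: T.gens_iff_ord S.gens_iff_ord ord_T_even)

definition "odd_gens = {x \<in> T.gens. odd x}"

lemma odd_gensD: "x \<in> odd_gens \<Longrightarrow> x \<in> T.gens" "x \<in> odd_gens \<Longrightarrow> odd x"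
  by (auto simp: odd_gens_def)

lemma double_notin_odd_gens [simp]: "2 * x \<notin> odd_gens"
  by (simp add: odd_gens_def)

lemma finite_odd_gens [simp]: "finite odd_gens"
  by (simp add: odd_gens_def)

lemma gens_T: "T.gens = (*) 2 ` S.gens \<union> odd_gens"
proof (rule Set.set_eqI)
  fix x show "x \<in> T.gens \<longleftrightarrow> x \<in> (*) 2 ` S.gens \<union> odd_gens"
  proof (cases "even x")
    case True
    then obtain y where "x = 2 * y" by auto
    thus ?thesis by (auto simp: gens_T_even odd_gens_def)
  qed (auto simp: odd_gens_def)
qed

text \<open>Descent on \<open>e\<close>: if \<open>2 * e + b\<close> is no generator, its order
  exceeds one and a nonzero \<open>s\<close> can be split off inside \<open>E\<close>. Thus the odd
  generators record a generating set of the ideal \<open>E\<close>.\<close>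

lemma E_generated: "e \<in> E \<Longrightarrow> \<exists>e' s. 2 * e' + b \<in> odd_gens \<and> s \<in> S \<and> e = e' + s"
proof (induction e rule: less_induct)
  case (less e)
  show ?case
  proof (cases "T.ord (2 * e + b) = 1")
    case True
    hence "2 * e + b \<in> odd_gens" using less.prems b_odd by (auto simp: odd_gens_def T.gens_iff_ord)
    thus ?thesis by (intro exI[of _ e] exI[of _ 0]) auto
  next
    case False
    have "T.ord (2 * e + b) \<ge> 1" using less.prems b_nonzero by (intro T.ord_pos) auto
    moreover obtain e' s where es: "e' \<in> E" "s \<in> S" "e = e' + s" "T.ord (2 * e + b) \<le> Suc (S.ord s)"
      using ord_T_odd_le less.prems by blast
    ultimately have "s \<noteq> 0" using False by (intro notI) simp
    then obtain f t where "2 * f + b \<in> odd_gens" "t \<in> S" "e' = f + t"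
      using less.IH[of e'] es by auto
    thus ?thesis using es S.add_in by (auto simp: add.assoc)
  qed
qed

lemma odd_gens_ne: "odd_gens \<noteq> {}"
  using E_ne E_generated by blast

text \<open>For \<open>E = e + S\<close> a generator \<open>2 * (e + s) + b\<close> has order one,
  but also order at least \<open>Suc (S.ord s)\<close>, so \<open>s = 0\<close>. The converse is
  \<open>E_generated\<close>.\<close>

lemma principal_iff: "principal_semigroup_ideal S E \<longleftrightarrow> (\<exists>x. odd_gens = {x})"
proof
  assume "principal_semigroup_ideal S E"
  then obtain e where e: "e \<in> S" "E = {e + s | s. s \<in> S}"
    by (auto simp: principal_semigroup_ideal_def)
  have eE: "e \<in> E" using e by (auto intro!: exI[of _ 0])
  have "x = 2 * e + b" if "x \<in> odd_gens" for x
  proof -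
    have "x \<in> T" "odd x" using that T.gens_subset odd_gensD by auto
    then obtain f where f: "f \<in> E" "x = 2 * f + b" using odd_T by blast
    then obtain s where s: "s \<in> S" "f = e + s" using e by auto
    have "T.ord x = 1" using that T.ord_gen odd_gensD by blast
    hence "S.ord s = 0" using ord_T_odd_ge[OF eE s(1)] f s by simp
    hence "s = 0" using S.ord_pos[OF s(1)] by (cases "s = 0") auto
    thus ?thesis using f s by simp
  qed
  thus "\<exists>x. odd_gens = {x}" using odd_gens_ne by blast
next
  assume "\<exists>x. odd_gens = {x}"
  then obtain x where x: "odd_gens = {x}" by blast
  hence "x \<in> T" "odd x" using T.gens_subset odd_gensD by auto
  then obtain e where e: "e \<in> E" "x = 2 * e + b" using odd_T by blast
  have "E = {e + s | s. s \<in> S}"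
  proof (intro equalityI subsetI)
    fix f assume "f \<in> E"
    then obtain e' s where "2 * e' + b \<in> odd_gens" "s \<in> S" "f = e' + s" using E_generated by blast
    thus "f \<in> {e + s | s. s \<in> S}" using x e by auto
  qed (auto intro: E_add e)
  thus "principal_semigroup_ideal S E"
    unfolding principal_semigroup_ideal_def using E_in[OF e(1)] by blast
qed

section \<open>Apery set, maximal representations and rectangles of the duplication\<close>

lemma apery_T_even: "2 * s \<in> apery_set T \<longleftrightarrow> s \<in> apery_set S"
proof -
  have "(\<forall>v\<in>T. 2 * s \<noteq> v + 2 * S.mu) \<longleftrightarrow> (\<forall>v\<in>S. s \<noteq> v + S.mu)"
  proof (intro iffI ballI)
    fix v assume "\<forall>v\<in>T. 2 * s \<noteq> v + 2 * S.mu" "v \<in> S"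
    hence "2 * s \<noteq> 2 * v + 2 * S.mu" by simp
    thus "s \<noteq> v + S.mu" by simp
  next
    fix v assume *: "\<forall>v\<in>S. s \<noteq> v + S.mu" "v \<in> T"
    show "2 * s \<noteq> v + 2 * S.mu"
    proof
      assume eq: "2 * s = v + 2 * S.mu"
      hence "even v" by presburger
      then obtain t where "t \<in> S" "v = 2 * t" using even_T * by blast
      thus False using * eq by auto
    qed
  qed
  thus ?thesis by (simp add: T.apery_iff S.apery_iff mu_T)
qed

lemma apery_T_odd: "2 * e + b \<in> apery_set T \<longleftrightarrow> e \<in> E \<and> (\<forall>f\<in>E. e \<noteq> f + S.mu)"
proof -
  have "(\<forall>v\<in>T. 2 * e + b \<noteq> v + 2 * S.mu) \<longleftrightarrow> (\<forall>f\<in>E. e \<noteq> f + S.mu)"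
  proof (intro iffI ballI)
    fix f assume "\<forall>v\<in>T. 2 * e + b \<noteq> v + 2 * S.mu" "f \<in> E"
    hence "2 * e + b \<noteq> (2 * f + b) + 2 * S.mu" by simp
    thus "e \<noteq> f + S.mu" by simp
  next
    fix v assume *: "\<forall>f\<in>E. e \<noteq> f + S.mu" "v \<in> T"
    show "2 * e + b \<noteq> v + 2 * S.mu"
    proof
      assume eq: "2 * e + b = v + 2 * S.mu"
      hence "odd v" using b_odd by presburger
      then obtain t where "t \<in> E" "v = 2 * t + b" using odd_T * by blast
      thus False using * eq by auto
    qed
  qed
  thus ?thesis by (simp add: T.apery_iff mu_T)
qed

definition double :: "(nat \<Rightarrow> nat) \<Rightarrow> nat \<Rightarrow> nat" where
  "double c = (\<lambda>x. if even x then c (x div 2) else 0)"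

lemma double_inj: "double c = double d \<longleftrightarrow> c = d"
proof
  assume "double c = double d"
  hence "double c (2 * x) = double d (2 * x)" for x by simp
  thus "c = d" by (simp add: double_def fun_eq_iff)
qed simp

lemma sum_gens_T:
  assumes "\<And>x. x \<in> odd_gens \<Longrightarrow> f x = 0"
  shows "(\<Sum>x\<in>T.gens. f x :: nat) = (\<Sum>g\<in>S.gens. f (2 * g))"
proof -
  have "(\<Sum>x\<in>T.gens. f x) = (\<Sum>x\<in>(*) 2 ` S.gens. f x)"
    using assms by (intro sum.mono_neutral_right) (auto simp: gens_T)
  also have "\<dots> = (\<Sum>g\<in>S.gens. f (2 * g))"
    by (subst sum.reindex) (auto simp: inj_on_def)
  finally show ?thesis .
qed

lemma double_rep:
  assumes "s \<in> S"
  shows "maximal_representation T (2 * s) (double c) \<longleftrightarrow> maximal_representation S s c"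
proof -
  have "(\<forall>x. x \<notin> T.gens \<longrightarrow> double c x = 0) \<longleftrightarrow> (\<forall>g. g \<notin> S.gens \<longrightarrow> c g = 0)"
  proof (intro iffI allI impI)
    fix g assume "\<forall>x. x \<notin> T.gens \<longrightarrow> double c x = 0" "g \<notin> S.gens"
    hence "double c (2 * g) = 0" by (simp add: gens_T_even)
    thus "c g = 0" by (simp add: double_def)
  next
    fix x assume "\<forall>g. g \<notin> S.gens \<longrightarrow> c g = 0" "x \<notin> T.gens"
    thus "double c x = 0" using gens_T_even[of "x div 2"] by (auto simp: double_def)
  qed
  moreover have "(\<Sum>x\<in>T.gens. double c x * x) = 2 * (\<Sum>g\<in>S.gens. c g * g)"
    by (subst sum_gens_T) (auto simp: double_def odd_gens_def sum_distrib_left algebra_simps)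
  moreover have "(\<Sum>x\<in>T.gens. double c x) = (\<Sum>g\<in>S.gens. c g)"
    by (subst sum_gens_T) (auto simp: double_def odd_gens_def)
  ultimately show ?thesis
    by (simp add: maximal_representation_def semigroup_representation_def ord_T_even assms)
qed

text \<open>An odd generator in a representation of an even element leaves an odd remainder; by
  \<open>ord_odd_odd\<close> the order then exceeds the number of summands.\<close>

lemma maximal_rep_even:
  assumes d: "maximal_representation T (2 * s) d"
  shows "d = double (\<lambda>g. d (2 * g))"
proof -
  have "d x = 0" if "odd x" for x
  proof (rule ccontr)
    assume dx: "d x \<noteq> 0"
    hence x: "x \<in> T.gens" using d
      by (auto simp: maximal_representation_def semigroup_representation_def)
    then obtain w where w: "2 * s = 1 * x + w" "maximal_representation T w (d(x := d x - 1))"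
      using T.maximal_rep_gen_multiple(3)[OF d, of 1 x] dx by auto
    have wT: "w \<in> T" using w(2) T.rep_in by (auto simp: maximal_representation_def)
    have "odd w" using w(1) that by presburger
    hence "T.ord x + T.ord w < T.ord (2 * s)"
      using ord_odd_odd[OF T.gens_subset[OF x] wT that] w(1) by simp
    moreover have "T.ord (2 * s) = sum d T.gens" "T.ord w = sum (d(x := d x - 1)) T.gens"
      using d w(2) by (simp_all add: maximal_representation_def)
    moreover have "sum d T.gens = Suc (sum (d(x := d x - 1)) T.gens)"
      using dx by (simp add: sum.remove[OF T.finite_gens x])
    ultimately show False using T.ord_gen[OF x] by linarith
  qed
  thus ?thesis by (auto simp: double_def)
qed

lemma unique_maximal_rep_even:
  assumes "s \<in> S"
  shows "(\<exists>!d. maximal_representation T (2 * s) d) \<longleftrightarrow> (\<exists>!c. maximal_representation S s c)"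
proof
  assume "\<exists>!d. maximal_representation T (2 * s) d"
  then obtain d where d: "maximal_representation T (2 * s) d"
    and uniq: "\<And>d'. maximal_representation T (2 * s) d' \<Longrightarrow> d' = d" by blast
  note eq = maximal_rep_even[OF d]
  have "maximal_representation S s (\<lambda>g. d (2 * g))"
    unfolding double_rep[OF assms, symmetric] using d eq by simp
  moreover have "c = (\<lambda>g. d (2 * g))" if "maximal_representation S s c" for c
    using uniq[of "double c"] that double_rep[OF assms] eq double_inj by metis
  ultimately show "\<exists>!c. maximal_representation S s c" by blast
next
  assume "\<exists>!c. maximal_representation S s c"
  then obtain c where c: "maximal_representation S s c"
    and uniq: "\<And>c'. maximal_representation S s c' \<Longrightarrow> c' = c" by blast
  have "d = double c" if d: "maximal_representation T (2 * s) d" for d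
  proof -
    note eq = maximal_rep_even[OF d]
    have "maximal_representation S s (\<lambda>g. d (2 * g))"
      unfolding double_rep[OF assms, symmetric] using d eq by simp
    thus ?thesis using eq uniq by metis
  qed
  thus "\<exists>!d. maximal_representation T (2 * s) d" using c double_rep[OF assms] by blast
qed

lemma beta_even: assumes "g \<in> S" shows "beta T (2 * g) = beta S g"
proof -
  have "T.beta_ok (2 * g) h \<longleftrightarrow> S.beta_ok g h" for h
    using apery_T_even[of "h * g"] ord_T_even[OF S.mult_in[OF assms], of h]
    by (simp add: T.beta_ok_def S.beta_ok_def mult.left_commute)
  thus ?thesis by (simp add: T.beta_eq S.beta_eq)
qed

lemma gamma_even: assumes "g \<in> S" shows "gamma T (2 * g) = gamma S g"
proof -
  have "T.gamma_ok (2 * g) h \<longleftrightarrow> S.gamma_ok g h" for h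
    using apery_T_even[of "h * g"] ord_T_even[OF S.mult_in[OF assms], of h]
      unique_maximal_rep_even[OF S.mult_in[OF assms], of h]
    by (simp add: T.gamma_ok_def S.gamma_ok_def mult.left_commute)
  thus ?thesis by (simp add: T.gamma_eq S.gamma_eq)
qed

text \<open>\<open>x + x\<close> has order at least three, so a multiple \<open>h * x\<close> with h
  \<ge> 2 has order above \<open>h\<close>.\<close>

lemma beta_ok_odd: assumes "x \<in> odd_gens" "T.beta_ok x h" shows "h \<le> 1"
proof (rule ccontr)
  assume "\<not> h \<le> 1"
  then obtain k where k: "h = k + 2"
    by (metis add.commute le_add_diff_inverse not_less_eq_eq numeral_2_eq_2 One_nat_def)
  have x: "x \<in> T" "odd x" "T.ord x = 1" using assms(1) odd_gensD T.gens_subset T.ord_gen by auto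
  have "T.ord (k * x) + T.ord (x + x) \<le> T.ord (k * x + (x + x))"
    using x T.mult_in T.add_in by (intro T.ord_add) auto
  moreover have "2 < T.ord (x + x)" using ord_odd_odd[of x x] x by simp
  moreover have "k \<le> T.ord (k * x)" using T.ord_mult_ge[of x k] x by simp
  ultimately have "h < T.ord (h * x)" by (simp add: k algebra_simps)
  thus False using assms(2) by (simp add: T.beta_ok_def)
qed

text \<open>A generator is indecomposable, so it has only itself as a maximal representation. It
  differs from the even number \<open>T.mu\<close>, hence lies in the Apery set.\<close>

lemma gamma_ok_odd: assumes "x \<in> odd_gens" shows "T.gamma_ok x 1"
proof -
  have x: "x \<in> T.gens" using assms odd_gensD by blast
  have "x \<noteq> T.mu" using odd_gensD(2)[OF assms] by (auto simp: mu_T)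
  moreover have "c = (\<lambda>y. if y = x then 1 else 0)" if c: "maximal_representation T x c" for c
  proof -
    have "sum c T.gens = 1" using c T.ord_gen[OF x] by (simp add: maximal_representation_def)
    then obtain g where g: "g \<in> T.gens" "1 \<le> c g"
      by (metis One_nat_def Suc_leI not_gr0 sum.neutral zero_neq_one)
    then obtain w where w: "x = 1 * g + w" "maximal_representation T w (c(g := c g - 1))"
      using T.maximal_rep_gen_multiple(3)[OF c g(2,1)] by blast
    have "w \<in> T" using w(2) T.rep_in by (auto simp: maximal_representation_def)
    hence "w = 0" using T.gens_indec[of g w] w(1) x g(1) T.gens_subset T.gens_pos by fastforce
    hence "c(g := c g - 1) = (\<lambda>_. 0)" using w(2) T.maximal_rep_zero by simp
    hence c0: "(c(g := c g - 1)) y = 0" for y by simp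
    have "c y = 0" if "y \<noteq> g" for y using c0[of y] that by simp
    moreover have "c g = 1" using c0[of g] g(2) by simp
    ultimately show ?thesis using w(1) \<open>w = 0\<close> by auto
  qed
  moreover have "maximal_representation T x (\<lambda>y. if y = x then 1 else 0)"
    using T.rep_gen[OF x, of 1] T.ord_gen[OF x] x by (simp add: maximal_representation_def)
  ultimately show ?thesis using T.apery_gen[OF x] T.ord_gen[OF x]
    by (auto simp: T.gamma_ok_def)
qed

lemma beta_odd: "x \<in> odd_gens \<Longrightarrow> beta T x = 1" and gamma_odd: "x \<in> odd_gens \<Longrightarrow> gamma T x = 1"
proof -
  assume x: "x \<in> odd_gens"
  have g: "x \<in> T.gens" using x odd_gensD by blast
  have "T.beta_ok x (beta T x)" unfolding T.beta_eq
    using Max_in[OF T.finite_beta_ok[OF g]] T.gamma_imp_beta[OF T.gamma_ok_0] by blast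
  hence "beta T x \<le> 1" using beta_ok_odd x by blast
  moreover have "1 \<le> gamma T x" using T.gamma_le[OF g] gamma_ok_odd[OF x] by blast
  moreover have "gamma T x \<le> beta T x" using T.gamma_le_beta[OF g] .
  ultimately show "beta T x = 1" "gamma T x = 1" by linarith+
qed

text \<open>Stated for arbitrary bounds, so that \<open>beta\<close> and \<open>gamma\<close> share
  one argument. As \<open>T.mu\<close> is twice \<open>S.mu\<close>, the generator left out of the
  rectangle is even and all odd ones take part.\<close>

lemma rectangle_T:
  assumes even: "\<And>g. g \<in> S.gens \<Longrightarrow> q (2 * g) = p g" and odd: "\<And>x. x \<in> odd_gens \<Longrightarrow> q x = 1"
  shows "rectangle T q =
    {2 * y + (\<Sum>x\<in>odd_gens. l x * x) | y l. y \<in> rectangle S p \<and> (\<forall>x\<in>odd_gens. l x \<le> 1)}"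
proof -
  have gens: "T.gens - {T.mu} = (*) 2 ` (S.gens - {S.mu}) \<union> odd_gens"
    using odd_gensD(2)[of "2 * S.mu"] by (auto simp: mu_T gens_T)
  have sum: "(\<Sum>x\<in>T.gens - {T.mu}. l x * x) =
     2 * (\<Sum>g\<in>S.gens - {S.mu}. l (2 * g) * g) + (\<Sum>x\<in>odd_gens. l x * x)" for l
  proof -
    have "(\<Sum>x\<in>T.gens - {T.mu}. l x * x) =
      (\<Sum>x\<in>(*) 2 ` (S.gens - {S.mu}). l x * x) + (\<Sum>x\<in>odd_gens. l x * x)"
      unfolding gens using odd_gensD by (intro sum.union_disjoint) auto
    also have "(\<Sum>x\<in>(*) 2 ` (S.gens - {S.mu}). l x * x) = 2 * (\<Sum>g\<in>S.gens - {S.mu}. l (2 * g) * g)"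
      by (subst sum.reindex) (auto simp: inj_on_def sum_distrib_left algebra_simps)
    finally show ?thesis .
  qed
  show ?thesis
  proof (intro equalityI subsetI)
    fix z assume "z \<in> rectangle T q"
    then obtain l where l: "z = (\<Sum>x\<in>T.gens - {T.mu}. l x * x)" "\<forall>x\<in>T.gens - {T.mu}. l x \<le> q x"
      by (auto simp: rectangle_def)
    have "l (2 * g) \<le> p g" if "g \<in> S.gens - {S.mu}" for g
    proof -
      have "2 * g \<in> T.gens - {T.mu}" unfolding gens using that by blast
      hence "l (2 * g) \<le> q (2 * g)" by (rule bspec[OF l(2)])
      thus ?thesis using even[of g] that by simp
    qed
    hence "(\<Sum>g\<in>S.gens - {S.mu}. l (2 * g) * g) \<in> rectangle S p"
      unfolding rectangle_def mem_Collect_eq by (intro exI[of _ "\<lambda>g. l (2 * g)"]) simp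
    moreover have "\<forall>x\<in>odd_gens. l x \<le> 1"
    proof
      fix x assume x: "x \<in> odd_gens"
      hence "x \<in> T.gens - {T.mu}" unfolding gens by blast
      hence "l x \<le> q x" by (rule bspec[OF l(2)])
      thus "l x \<le> 1" using odd[OF x] by simp
    qed
    ultimately show "z \<in> {2 * y + (\<Sum>x\<in>odd_gens. l x * x) | y l.
        y \<in> rectangle S p \<and> (\<forall>x\<in>odd_gens. l x \<le> 1)}"
      using l(1) sum by blast
  next
    fix z assume "z \<in> {2 * y + (\<Sum>x\<in>odd_gens. l x * x) | y l.
        y \<in> rectangle S p \<and> (\<forall>x\<in>odd_gens. l x \<le> 1)}"
    then obtain y l where z: "z = 2 * y + (\<Sum>x\<in>odd_gens. l x * x)" "y \<in> rectangle S p"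
      and l: "\<forall>x\<in>odd_gens. l x \<le> 1" by blast
    obtain k where k: "y = (\<Sum>g\<in>S.gens - {S.mu}. k g * g)" "\<forall>g\<in>S.gens - {S.mu}. k g \<le> p g"
      using z(2) by (auto simp: rectangle_def)
    define m where "m x = (if even x then k (x div 2) else l x)" for x
    have "(\<Sum>x\<in>odd_gens. m x * x) = (\<Sum>x\<in>odd_gens. l x * x)"
      by (rule sum.cong) (auto simp: m_def odd_gens_def)
    hence "z = (\<Sum>x\<in>T.gens - {T.mu}. m x * x)" unfolding sum using z k by (simp add: m_def)
    moreover have "\<forall>x\<in>T.gens - {T.mu}. m x \<le> q x"
    proof
      fix x assume "x \<in> T.gens - {T.mu}"
      then consider g where "g \<in> S.gens - {S.mu}" "x = 2 * g" | "x \<in> odd_gens"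
        unfolding gens by blast
      thus "m x \<le> q x"
      proof cases
        case 1 thus ?thesis using even[of g] k(2) by (simp add: m_def)
      next
        case 2 thus ?thesis using odd[of x] l odd_gensD(2)[of x] by (simp add: m_def)
      qed
    qed
    ultimately show "z \<in> rectangle T q" unfolding rectangle_def by blast
  qed
qed

text \<open>If there were two odd generators, their sum added to twice the largest element of the
  rectangle of \<open>S\<close> would lie in the rectangle of \<open>T\<close>, and halving it would give an
  element of the Apery set of \<open>S\<close> outside the rectangle of \<open>S\<close>.\<close>

lemma rectangular_iff:
  assumes even: "\<And>g. g \<in> S.gens \<Longrightarrow> q (2 * g) = p g" and odd: "\<And>x. x \<in> odd_gens \<Longrightarrow> q x = 1"
    and sub: "apery_set S \<subseteq> rectangle S p"
  shows "apery_set T = rectangle T q \<longleftrightarrow>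
    apery_set S = rectangle S p \<and> principal_semigroup_ideal S E"
proof -
  have rect: "rectangle T q =
    {2 * y + (\<Sum>x\<in>odd_gens. l x * x) | y l. y \<in> rectangle S p \<and> (\<forall>x\<in>odd_gens. l x \<le> 1)}"
    by (rule rectangle_T) (simp_all add: even odd)
  show ?thesis
  proof
  assume eq: "apery_set T = rectangle T q"
  have "y \<in> apery_set S" if "y \<in> rectangle S p" for y
  proof -
    have "2 * y \<in> rectangle T q"
      using that unfolding rect mem_Collect_eq by (intro exI[of _ y] exI[of _ "\<lambda>_. 0"]) simp
    thus ?thesis using eq apery_T_even by simp
  qed
  hence S: "apery_set S = rectangle S p" using sub by blast
  define w where "w = (\<Sum>g\<in>S.gens - {S.mu}. p g * g)"
  have w: "w \<in> rectangle S p" by (auto simp: w_def rectangle_def)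
  have w_max: "y \<le> w" if "y \<in> rectangle S p" for y
    using that by (auto simp: w_def rectangle_def intro!: sum_mono)
  have "x = y" if xy: "x \<in> odd_gens" "y \<in> odd_gens" for x y
  proof (rule ccontr)
    assume ne: "x \<noteq> y"
    have "x \<in> T" "y \<in> T" using xy odd_gensD T.gens_subset by auto
    then obtain e f where e: "e \<in> E" "x = 2 * e + b" and f: "f \<in> E" "y = 2 * f + b"
      using xy odd_gensD odd_T by metis
    let ?l = "\<lambda>z. if z = x \<or> z = y then 1 else 0 :: nat"
    have "(\<Sum>z\<in>odd_gens. ?l z * z) = (\<Sum>z\<in>{x, y}. z)"
      using xy by (intro sum.mono_neutral_cong_right) auto
    hence "2 * w + (x + y) = 2 * w + (\<Sum>z\<in>odd_gens. ?l z * z)" using ne by simp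
    moreover have "\<forall>x\<in>odd_gens. ?l x \<le> 1" by simp
    ultimately have "2 * w + (x + y) \<in> rectangle T q"
      unfolding rect mem_Collect_eq by (intro exI[of _ w] exI[of _ ?l] conjI w)
    hence "2 * (w + e + f + b) \<in> apery_set T" using eq e f by (simp add: algebra_simps)
    hence "w + e + f + b \<in> rectangle S p" using sub apery_T_even by blast
    thus False using w_max b_nonzero by fastforce
  qed
  hence "\<exists>x. odd_gens = {x}" using odd_gens_ne by blast
  thus "apery_set S = rectangle S p \<and> principal_semigroup_ideal S E" using S principal_iff by blast
next
  assume A: "apery_set S = rectangle S p \<and> principal_semigroup_ideal S E"
  then obtain x where x: "odd_gens = {x}" using principal_iff by blast
  hence "x \<in> T" "odd x" using odd_gensD T.gens_subset by auto
  then obtain e where e: "e \<in> E" "x = 2 * e + b" using odd_T by blast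
  have Egen: "\<exists>s\<in>S. f = e + s" if "f \<in> E" for f using E_generated[OF that] x e by auto
  \<comment> \<open>\<open>E = e + S\<close> identifies \<open>E\<close> with \<open>S\<close>, so
    the odd part of the Apery set is the translate by \<open>x\<close> of its even part.\<close>
  have ap_odd: "2 * (e + s) + b \<in> apery_set T \<longleftrightarrow> s \<in> apery_set S" if "s \<in> S" for s
    unfolding apery_T_odd S.apery_iff
  proof (intro iffI conjI ballI)
    fix v assume "e + s \<in> E \<and> (\<forall>f\<in>E. e + s \<noteq> f + S.mu)" "v \<in> S"
    thus "s \<noteq> v + S.mu" using E_add[OF e(1)] by fastforce
  next
    fix f assume "s \<in> S \<and> (\<forall>v\<in>S. s \<noteq> v + S.mu)" "f \<in> E"
    thus "e + s \<noteq> f + S.mu" using Egen[of f] by auto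
  qed (use that E_add e in auto)
  show "apery_set T = rectangle T q"
  proof (intro equalityI subsetI)
    fix z assume z: "z \<in> apery_set T"
    hence "z \<in> T" by (rule T.apery_in)
    thus "z \<in> rectangle T q"
    proof (cases rule: T_cases)
      case (even s)
      hence "s \<in> rectangle S p" using z apery_T_even A by blast
      hence "2 * s \<in> rectangle T q"
        unfolding rect mem_Collect_eq by (intro exI[of _ s] exI[of _ "\<lambda>_. 0"]) simp
      thus ?thesis using even by simp
    next
      case (odd f)
      then obtain s where s: "s \<in> S" "f = e + s" using Egen by blast
      hence "s \<in> rectangle S p" using z odd ap_odd A by blast
      hence "2 * s + x \<in> rectangle T q"
        unfolding rect x mem_Collect_eq by (intro exI[of _ s] exI[of _ "\<lambda>_. 1"]) simp
      thus ?thesis using odd s x e by (simp add: algebra_simps)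
    qed
  next
    fix z assume "z \<in> rectangle T q"
    then obtain y l where z: "z = 2 * y + l x * x" "y \<in> rectangle S p" "l x \<le> 1"
      unfolding rect x by auto
    have y: "y \<in> apery_set S" "y \<in> S" using A z S.apery_in by auto
    consider "l x = 0" | "l x = 1" using z by linarith
    thus "z \<in> apery_set T"
    proof cases
      case 1 thus ?thesis using z y apery_T_even by simp
    next
      case 2 thus ?thesis using z y ap_odd[OF y(2)] e by (simp add: algebra_simps)
    qed
  qed
qed
qed

lemma gamma_rectangular_T:
  "gamma_rectangular T \<longleftrightarrow> gamma_rectangular S \<and> principal_semigroup_ideal S E"
  unfolding gamma_rectangular_def
  by (rule rectangular_iff) (auto simp: gamma_even S.gens_subset gamma_odd
      intro: subsetD[OF S.apery_subset_rectangle_gamma])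

lemma beta_rectangular_T:
  "beta_rectangular T \<longleftrightarrow> beta_rectangular S \<and> principal_semigroup_ideal S E"
  unfolding beta_rectangular_def
  by (rule rectangular_iff) (auto simp: beta_even S.gens_subset beta_odd
      intro: subsetD[OF S.apery_subset_rectangle_beta])

end

section \<open>Dimensions of subspaces and subrings given by carriers\<close>

text \<open>\<open>dim\<close> is the cardinality of a basis and drops to 0 for an infinite one, so
  comparisons of dimensions need this guard. It applies to arbitrary sets, not just to
  subspaces.\<close>

definition findim :: "('a::field \<Rightarrow> 'b::ab_group_add \<Rightarrow> 'b) \<Rightarrow> 'b set \<Rightarrow> bool" where
  "findim s V \<longleftrightarrow> (\<exists>B. finite B \<and> V \<subseteq> module.span s B)"

context vector_space
begin

lemma findim_subset: "\<lbrakk>findim scale W; V \<subseteq> W\<rbrakk> \<Longrightarrow> findim scale V"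
  unfolding findim_def by blast

lemma findim_finite: "finite B \<Longrightarrow> findim scale B"
  unfolding findim_def using span_superset by blast

lemma findim_Un: assumes "findim scale V" "findim scale W" shows "findim scale (V \<union> W)"
proof -
  obtain A B where "finite A" "V \<subseteq> span A" "finite B" "W \<subseteq> span B"
    using assms unfolding findim_def by blast
  thus ?thesis unfolding findim_def
    by (intro exI[of _ "A \<union> B"]) (use span_mono[of A "A \<union> B"] span_mono[of B "A \<union> B"] in auto)
qed

lemma findim_basis:
  assumes "findim scale V"
  obtains B where "B \<subseteq> V" "independent B" "V \<subseteq> span B" "finite B" "card B = dim V"
proof -
  obtain B where B: "B \<subseteq> V" "independent B" "V \<subseteq> span B" "card B = dim V"
    using basis_exists by blast
  obtain C where "finite C" "V \<subseteq> span C" using assms unfolding findim_def by blast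
  hence "finite B" using independent_span_bound[of C B] B by auto
  thus ?thesis using B that by blast
qed

lemma dim_insert_notin:
  assumes "findim scale A" "x \<notin> span A" shows "dim (insert x A) = Suc (dim A)"
proof -
  obtain B where B: "B \<subseteq> A" "independent B" "A \<subseteq> span B" "finite B" "card B = dim A"
    by (rule findim_basis[OF assms(1)])
  have x: "x \<notin> span B" using assms span_mono[OF B(1)] by blast
  have "A \<subseteq> span (insert x B)" using B(3) span_mono[of B "insert x B"] by blast
  moreover have "x \<in> span (insert x B)" by (simp add: span_base)
  moreover have "x \<notin> B" using x span_base by blast
  ultimately show ?thesis
    using B independent_insertI[OF x B(2)] by (intro dim_unique[of "insert x B"]) auto
qed

lemma dim_mono_findim: assumes "findim scale W" "V \<subseteq> span W" shows "dim V \<le> dim W"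
proof -
  obtain B where B: "W \<subseteq> span B" "finite B" "card B = dim W"
    by (rule findim_basis[OF assms(1)])
  have "V \<subseteq> span B" using assms(2) span_minimal[OF B(1) subspace_span] by blast
  thus ?thesis using dim_le_card[of V B] B by simp
qed

lemma subspace_dim_eq:
  assumes "subspace V" "V \<subseteq> W" "findim scale W" "dim W \<le> dim V" shows "W = V"
proof (rule ccontr)
  assume "W \<noteq> V"
  then obtain x where x: "x \<in> W" "x \<notin> V" using assms(2) by blast
  hence "dim (insert x V) = Suc (dim V)"
    using span_minimal[OF order_refl assms(1)] findim_subset[OF assms(3,2)]
    by (intro dim_insert_notin) auto
  moreover have "dim (insert x V) \<le> dim W"
    using x assms(2,3) span_superset by (intro dim_mono_findim) auto
  ultimately show False using assms(4) by simp
qed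

end

text \<open>The map from \<open>V\<close> to the quotient by \<open>A\<close> induced by
  \<open>f\<close> has kernel \<open>{v \<in> V. f v \<in> A}\<close> and image (A + f V)/A. The
  proof starts from this kernel and adds a basis of \<open>V\<close> one vector at a time; the two
  dimensions then grow together. For \<open>A = {0}\<close> this is the usual rank-nullity
  formula.\<close>

lemma (in vector_space_pair) dim_sum_image:
  assumes lin: "Vector_Spaces.linear s1 s2 f" and V: "vs1.subspace V" "findim s1 V"
    and A: "vs2.subspace A" "findim s2 A"
  shows "vs2.dim {a + f v | a v. a \<in> A \<and> v \<in> V} + vs1.dim {v \<in> V. f v \<in> A} = vs2.dim A + vs1.dim V"
proof -
  interpret Vector_Spaces.linear s1 s2 f by (rule lin)
  define K where "K = {v \<in> V. f v \<in> A}"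
  have K: "vs1.subspace K"
    unfolding K_def vs1.subspace_def using V(1) A(1)
    by (auto simp: zero add scale vs1.subspace_0 vs2.subspace_0 vs1.subspace_add vs2.subspace_add
        vs1.subspace_scale vs2.subspace_scale)
  have span: "vs2.span (A \<union> f ` X) = {a + f v | a v. a \<in> A \<and> v \<in> vs1.span X}" for X
  proof -
    have A': "vs2.span A = A"
      using vs2.span_minimal[OF order_refl A(1)] vs2.span_superset by blast
    show ?thesis unfolding vs2.span_Un linear_span_image[OF lin] A' by auto
  qed
  obtain B where B: "finite B" "V \<subseteq> vs1.span B" "B \<subseteq> V" by (rule vs1.findim_basis[OF V(2)])
  have fin1: "findim s1 (K \<union> C)" if "C \<subseteq> V" for C
    using that V(2) by (intro vs1.findim_subset[OF V(2)]) (auto simp: K_def)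
  have fin2: "findim s2 (A \<union> f ` (K \<union> C))" if "C \<subseteq> V" for C
  proof (rule vs2.findim_Un[OF A(2)], unfold findim_def, intro exI[of _ "f ` B"] conjI)
    show "f ` (K \<union> C) \<subseteq> vs2.span (f ` B)"
      using that B(2) unfolding linear_span_image[OF lin] by (auto simp: K_def)
  qed (use B in auto)
  have "vs2.dim (A \<union> f ` (K \<union> C)) + vs1.dim K = vs2.dim A + vs1.dim (K \<union> C)"
    if "finite C" "C \<subseteq> V" for C
    using that
  proof (induction C rule: finite_induct)
    case empty
    have "A \<union> f ` K = A" by (auto simp: K_def)
    thus ?case by simp
  next
    case (insert c C)
    have C: "C \<subseteq> V" "c \<in> V" using insert by auto
    have eq: "A \<union> f ` (K \<union> insert c C) = insert (f c) (A \<union> f ` (K \<union> C))"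
      "K \<union> insert c C = insert c (K \<union> C)" by auto
    have sub: "vs1.span (K \<union> C) \<subseteq> V" using C V(1) by (intro vs1.span_minimal) (auto simp: K_def)
    show ?case
    proof (cases "c \<in> vs1.span (K \<union> C)")
      case True
      hence "f c \<in> vs2.span (A \<union> f ` (K \<union> C))"
        using A(1) vs2.subspace_0 by (auto simp: span intro!: exI[of _ 0] exI[of _ c])
      hence "vs2.dim (insert (f c) (A \<union> f ` (K \<union> C))) = vs2.dim (A \<union> f ` (K \<union> C))"
        by (intro vs2.span_eq_dim vs2.span_redundant)
      moreover have "vs1.dim (insert c (K \<union> C)) = vs1.dim (K \<union> C)"
        using True by (intro vs1.span_eq_dim vs1.span_redundant)
      ultimately show ?thesis using insert.IH C unfolding eq by simp
    next
      case False
      have "f c \<notin> vs2.span (A \<union> f ` (K \<union> C))"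
      proof
        assume "f c \<in> vs2.span (A \<union> f ` (K \<union> C))"
        then obtain a v where av: "f c = a + f v" "a \<in> A" "v \<in> vs1.span (K \<union> C)"
          by (auto simp: span)
        hence "f (c - v) \<in> A" by (simp add: diff)
        moreover have "c - v \<in> V" using av sub C V(1) by (auto intro: vs1.subspace_diff)
        ultimately have "c - v \<in> vs1.span (K \<union> C)" by (auto simp: K_def intro: vs1.span_base)
        hence "(c - v) + v \<in> vs1.span (K \<union> C)" using av(3) by (rule vs1.span_add)
        thus False using False by simp
      qed
      thus ?thesis using insert.IH C False unfolding eq
        by (simp add: vs1.dim_insert_notin vs2.dim_insert_notin fin1 fin2)
    qed
  qed
  from this[OF B(1,3)] have "vs2.dim (A \<union> f ` (K \<union> B)) + vs1.dim K = vs2.dim A + vs1.dim (K \<union> B)" .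
  moreover have VB: "vs1.span (K \<union> B) = V"
    using B vs1.span_mono[of B "K \<union> B"] V(1)
    by (intro antisym vs1.span_minimal) (auto simp: K_def)
  hence "vs1.dim (K \<union> B) = vs1.dim V" by (metis vs1.dim_span)
  moreover have "vs2.dim (A \<union> f ` (K \<union> B)) = vs2.dim {a + f v | a v. a \<in> A \<and> v \<in> V}"
    using span[of "K \<union> B"] unfolding VB by (metis vs2.dim_span)
  ultimately show ?thesis by (simp add: K_def)
qed

text \<open>Both \<^const>\<open>mpoly_ring\<close> and \<^const>\<open>semigroup_ring\<close> are subrings of a type of class
  \<^class>\<open>comm_ring_1\<close>.\<close>

locale sub_cring =
  fixes R :: "'a::comm_ring_1 ring" and C :: "'a set"
  assumes R_def: "R = \<lparr>carrier = C, monoid.mult = (*), one = 1, zero = 0, add = (+)\<rparr>"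
    and zero_C [simp]: "0 \<in> C" and one_C [simp]: "1 \<in> C"
    and add_C [simp]: "\<And>x y. \<lbrakk>x \<in> C; y \<in> C\<rbrakk> \<Longrightarrow> x + y \<in> C"
    and mult_C [simp]: "\<And>x y. \<lbrakk>x \<in> C; y \<in> C\<rbrakk> \<Longrightarrow> x * y \<in> C"
    and uminus_C [simp]: "\<And>x. x \<in> C \<Longrightarrow> - x \<in> C"
begin

lemma R_simps [simp]: "carrier R = C" "x \<otimes>\<^bsub>R\<^esub> y = x * y" "\<one>\<^bsub>R\<^esub> = 1" "\<zero>\<^bsub>R\<^esub> = 0" "x \<oplus>\<^bsub>R\<^esub> y = x + y"
  by (simp_all add: R_def)

lemma cring_R: "cring R"
proof (rule cringI)
  show "abelian_group R"
  proof (rule abelian_groupI)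
    fix x assume "x \<in> carrier R"
    thus "\<exists>y\<in>carrier R. y \<oplus>\<^bsub>R\<^esub> x = \<zero>\<^bsub>R\<^esub>" by (intro bexI[of _ "- x"]) auto
  qed (auto simp: algebra_simps)
  show "Group.comm_monoid R"
    by unfold_locales (auto simp: algebra_simps)
qed (auto simp: algebra_simps)

sublocale cring R by (rule cring_R)

text \<open>Ideals phrased with the type class operations, to which the ring laws apply directly;
  \<open>ideal_iff\<close> links them to the locale \<open>ideal\<close>.\<close>

definition is_ideal :: "'a set \<Rightarrow> bool" where
  "is_ideal I \<longleftrightarrow> I \<subseteq> C \<and> 0 \<in> I \<and> (\<forall>x\<in>I. \<forall>y\<in>I. x + y \<in> I) \<and> (\<forall>a\<in>C. \<forall>x\<in>I. a * x \<in> I)"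

lemma is_idealD:
  assumes "is_ideal I"
  shows "I \<subseteq> C" "x \<in> I \<Longrightarrow> x \<in> C" "0 \<in> I" "\<lbrakk>x \<in> I; y \<in> I\<rbrakk> \<Longrightarrow> x + y \<in> I" "\<lbrakk>a \<in> C; x \<in> I\<rbrakk> \<Longrightarrow> a * x \<in> I"
    "x \<in> I \<Longrightarrow> - x \<in> I" "\<lbrakk>x \<in> I; y \<in> I\<rbrakk> \<Longrightarrow> x - y \<in> I"
proof -
  show *: "x \<in> I \<Longrightarrow> - x \<in> I" for x
    using assms uminus_C[OF one_C] unfolding is_ideal_def by (metis mult_minus1)
  show "\<lbrakk>x \<in> I; y \<in> I\<rbrakk> \<Longrightarrow> x - y \<in> I" using assms * unfolding is_ideal_def
    by (metis diff_conv_add_uminus)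
qed (use assms in \<open>auto simp: is_ideal_def\<close>)

lemma is_ideal_sum: "\<lbrakk>is_ideal I; \<And>x. x \<in> A \<Longrightarrow> f x \<in> I\<rbrakk> \<Longrightarrow> sum f A \<in> I"
  by (induction A rule: infinite_finite_induct) (auto intro: is_idealD)

lemma minus_R: "x \<in> C \<Longrightarrow> \<ominus>\<^bsub>R\<^esub> x = - x"
  by (rule minus_equality) auto

lemma ideal_iff: "ideal I R \<longleftrightarrow> is_ideal I"
proof
  assume "ideal I R"
  then interpret I: ideal I R .
  show "is_ideal I" unfolding is_ideal_def
    using I.a_subset I.zero_closed I.a_closed I.I_l_closed by auto
next
  assume I: "is_ideal I"
  show "ideal I R"
  proof (rule idealI)
    show "ring R" ..
    show "subgroup I (add_monoid R)"
    proof (rule subgroup.intro)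
      fix x assume x: "x \<in> I"
      have "inv\<^bsub>add_monoid R\<^esub> x = - x" using minus_R is_idealD(2)[OF I x] by (simp add: a_inv_def)
      thus "inv\<^bsub>add_monoid R\<^esub> x \<in> I" using is_idealD(6)[OF I x] by simp
    qed (use is_idealD[OF I] in auto)
  next
    fix a x assume "a \<in> I" "x \<in> carrier R"
    hence "x * a \<in> I" using is_idealD(5)[OF I] by simp
    thus "x \<otimes>\<^bsub>R\<^esub> a \<in> I" "a \<otimes>\<^bsub>R\<^esub> x \<in> I" by (simp_all add: mult.commute)
  qed
qed

lemma is_ideal_genideal: "F \<subseteq> C \<Longrightarrow> is_ideal (Idl\<^bsub>R\<^esub> F)"
  using genideal_ideal by (simp add: ideal_iff[symmetric])

lemma genideal_least: "\<lbrakk>is_ideal I; F \<subseteq> I\<rbrakk> \<Longrightarrow> Idl\<^bsub>R\<^esub> F \<subseteq> I"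
  using genideal_minimal by (simp add: ideal_iff[symmetric])

lemma genideal_superset: "F \<subseteq> C \<Longrightarrow> F \<subseteq> Idl\<^bsub>R\<^esub> F"
  using genideal_self by simp

lemma genideal_mono: "\<lbrakk>F \<subseteq> G; G \<subseteq> C\<rbrakk> \<Longrightarrow> Idl\<^bsub>R\<^esub> F \<subseteq> Idl\<^bsub>R\<^esub> G"
  using genideal_least[OF is_ideal_genideal, of G F] genideal_superset[of G] by blast

lemma genideal_empty: "Idl\<^bsub>R\<^esub> {} = {0}"
proof
  have "is_ideal {0}" by (auto simp: is_ideal_def)
  thus "Idl\<^bsub>R\<^esub> {} \<subseteq> {0}" by (rule genideal_least) simp
  show "{0} \<subseteq> Idl\<^bsub>R\<^esub> {}" using is_ideal_genideal[of "{}"] by (auto simp: is_ideal_def)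
qed

text \<open>Ideals generated by a list are treated by adjoining one form at a time; this normal form
  feeds each induction step.\<close>

lemma genideal_insert:
  assumes "insert f F \<subseteq> C"
  shows "Idl\<^bsub>R\<^esub> (insert f F) = {x + a * f | x a. x \<in> Idl\<^bsub>R\<^esub> F \<and> a \<in> C}" (is "?L = ?R")
proof
  have f: "f \<in> C" and F: "F \<subseteq> C" using assms by auto
  note I = is_ideal_genideal[OF F]
  have "is_ideal ?R" unfolding is_ideal_def
  proof (intro conjI ballI subsetI)
    fix x y assume "x \<in> ?R" "y \<in> ?R"
    then obtain u a v c where *: "x = u + a * f" "y = v + c * f" "u \<in> Idl\<^bsub>R\<^esub> F" "v \<in> Idl\<^bsub>R\<^esub> F" "a \<in> C" "c \<in> C"
      by auto
    have "x + y = (u + v) + (a + c) * f" using * by (simp add: algebra_simps)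
    thus "x + y \<in> ?R" unfolding mem_Collect_eq using * is_idealD(4)[OF I]
      by (intro exI[of _ "u + v"] exI[of _ "a + c"]) auto
  next
    fix c x assume "c \<in> C" "x \<in> ?R"
    then obtain u a where *: "x = u + a * f" "u \<in> Idl\<^bsub>R\<^esub> F" "a \<in> C" by auto
    have "c * x = c * u + (c * a) * f" using * by (simp add: algebra_simps)
    thus "c * x \<in> ?R" unfolding mem_Collect_eq using * is_idealD(5)[OF I] \<open>c \<in> C\<close>
      by (intro exI[of _ "c * u"] exI[of _ "c * a"]) auto
  next
    fix x assume "x \<in> ?R"
    thus "x \<in> C" using is_idealD(2)[OF I] f by auto
  next
    show "0 \<in> ?R" unfolding mem_Collect_eq using is_idealD(3)[OF I]
      by (intro exI[of _ 0]) auto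
  qed
  moreover have "insert f F \<subseteq> ?R"
  proof -
    have "f = 0 + 1 * f" by simp
    hence "f \<in> ?R" using is_idealD(3)[OF I] one_C by blast
    moreover have "x \<in> ?R" if "x \<in> F" for x
    proof -
      have "x = x + 0 * f" by simp
      thus ?thesis using that genideal_superset[OF F] zero_C by blast
    qed
    ultimately show ?thesis by blast
  qed
  ultimately show "?L \<subseteq> ?R" by (rule genideal_least)
  show "?R \<subseteq> ?L"
  proof
    fix p assume "p \<in> ?R"
    then obtain x a where *: "p = x + a * f" "x \<in> Idl\<^bsub>R\<^esub> F" "a \<in> C" by auto
    note J = is_ideal_genideal[OF assms]
    have "x \<in> ?L" using * genideal_mono[of F "insert f F"] assms by auto
    moreover have "a * f \<in> ?L" using * genideal_superset[OF assms]
      by (intro is_idealD(5)[OF J]) auto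
    ultimately show "p \<in> ?L" using * is_idealD(4)[OF J] by simp
  qed
qed

lemma finsum_R: "(\<And>i. i \<in> A \<Longrightarrow> f i \<in> C) \<Longrightarrow> finite A \<Longrightarrow> finsum R f A = sum f A"
proof (induction A rule: infinite_finite_induct)
  case (insert x A)
  thus ?case by (subst finsum_insert) auto
qed auto

end

section \<open>Polynomials in finitely many variables\<close>

abbreviation "pkeys \<equiv> Poly_Mapping.keys"
abbreviation "coef \<equiv> Poly_Mapping.lookup"
abbreviation "mnm \<equiv> Poly_Mapping.single"

definition mdeg :: "(nat \<Rightarrow>\<^sub>0 nat) \<Rightarrow> nat" where
  "mdeg m = (\<Sum>i\<in>pkeys m. coef m i)"

lemma sum_superset_keys:
  "\<lbrakk>finite A; pkeys m \<subseteq> A\<rbrakk> \<Longrightarrow> (\<Sum>i\<in>pkeys m. coef m i * f i) = (\<Sum>i\<in>A. coef m i * (f i :: nat))"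
  by (rule sum.mono_neutral_left) (auto simp: in_keys_iff)

lemma keys_add_nat: "pkeys (m + m') = pkeys m \<union> pkeys (m' :: 'a \<Rightarrow>\<^sub>0 nat)"
  by (auto simp: in_keys_iff lookup_add)

lemma wsum_add:
  "(\<Sum>i\<in>pkeys (m + m'). coef (m + m') i * (f i :: nat)) =
    (\<Sum>i\<in>pkeys m. coef m i * f i) + (\<Sum>i\<in>pkeys m'. coef m' i * f i)"
proof -
  let ?A = "pkeys m \<union> pkeys m'"
  have "(\<Sum>i\<in>pkeys (m + m'). coef (m + m') i * f i) = (\<Sum>i\<in>?A. coef m i * f i) + (\<Sum>i\<in>?A. coef m' i * f i)"
    by (simp add: keys_add_nat lookup_add algebra_simps sum.distrib)
  thus ?thesis by (simp add: sum_superset_keys[of ?A])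
qed

lemma mdeg_add [simp]: "mdeg (m + m') = mdeg m + mdeg m'"
  using wsum_add[of m m' "\<lambda>_. 1"] by (simp add: mdeg_def)

lemma mdeg_0 [simp]: "mdeg 0 = 0" and mdeg_single [simp]: "mdeg (mnm i k) = k"
  by (simp_all add: mdeg_def)

lemma mdeg_eq_0: "mdeg m = 0 \<longleftrightarrow> m = 0"
proof
  assume "mdeg m = 0"
  hence "coef m i = 0" for i by (cases "i \<in> pkeys m") (auto simp: mdeg_def in_keys_iff)
  thus "m = 0" by (intro poly_mapping_eqI) simp
qed simp

lemma coef_le_mdeg: "coef m i \<le> mdeg m"
  by (cases "i \<in> pkeys m") (auto simp: mdeg_def in_keys_iff intro: member_le_sum)

lemma mono_split: assumes "coef m i \<noteq> 0" obtains m' where "m = m' + mnm i (1::nat)"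
proof
  show "m = (m - mnm i 1) + mnm i 1"
    using assms
      by (intro poly_mapping_eqI) (auto simp: lookup_add lookup_minus lookup_single when_def)
qed

lemma poly_sum_monos: "p = (\<Sum>m\<in>pkeys p. mnm m (coef p m))"
  by (intro poly_mapping_eqI) (auto simp: lookup_sum lookup_single when_def in_keys_iff)

text \<open>The monomial case is restricted to \<open>m \<in> pkeys r\<close>, so bounds on the
  variables of \<open>r\<close> are available there without being put into the predicate.\<close>

lemma poly_induct [case_names zero add mnm]:
  fixes r :: "'a \<Rightarrow>\<^sub>0 'b::comm_monoid_add"
  assumes "P 0" "\<And>p q. \<lbrakk>P p; P q\<rbrakk> \<Longrightarrow> P (p + q)" "\<And>m c. m \<in> pkeys r \<Longrightarrow> P (mnm m c)"
  shows "P r"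
proof -
  have "P (\<Sum>m\<in>A. mnm m (coef r m))" if "A \<subseteq> pkeys r" for A
    using finite_subset[OF that finite_keys] that
    by (induction A rule: finite_induct) (auto intro: assms)
  from this[OF order_refl] show ?thesis by (simp flip: poly_sum_monos)
qed

text \<open>The projection onto the span of the monomials with property \<open>P\<close>.
  Homogeneous components (\<open>hcomp\<close>) and the removal of odd variables
  (\<open>rho\<close>) are both of this form.\<close>

definition mfilter :: "('a \<Rightarrow> bool) \<Rightarrow> ('a \<Rightarrow>\<^sub>0 'b::zero) \<Rightarrow> 'a \<Rightarrow>\<^sub>0 'b" where
  "mfilter P p = Poly_Mapping.mapp (\<lambda>m c. if P m then c else 0) p"

lemma coef_mfilter [simp]: "coef (mfilter P p) m = (if P m then coef p m else 0)"
  by (simp add: mfilter_def lookup_mapp when_def in_keys_iff)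

lemma keys_mfilter [simp]: "pkeys (mfilter P p) = {m \<in> pkeys p. P m}"
  by (auto simp: in_keys_iff split: if_splits)

lemma mfilter_add: "mfilter P (p + q) = mfilter P p + mfilter P (q :: _ \<Rightarrow>\<^sub>0 'b::comm_monoid_add)"
  by (intro poly_mapping_eqI) (simp add: lookup_add)

lemma mfilter_id: "(\<And>m. m \<in> pkeys p \<Longrightarrow> P m) \<Longrightarrow> mfilter P p = p"
  by (intro poly_mapping_eqI) (auto simp: in_keys_iff)

lemma mfilter_none: "(\<And>m. m \<in> pkeys p \<Longrightarrow> \<not> P m) \<Longrightarrow> mfilter P p = 0"
  by (intro poly_mapping_eqI) (auto simp: in_keys_iff)

lemma mfilter_zero [simp]: "mfilter P 0 = 0"
  by (rule mfilter_none) simp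

lemma mfilter_split: "p = mfilter P p + mfilter (\<lambda>m. \<not> P m) (p :: _ \<Rightarrow>\<^sub>0 'b::comm_monoid_add)"
  by (intro poly_mapping_eqI) (simp add: lookup_add)

lemma keys_mult_E:
  assumes "m \<in> pkeys (p * q)"
  obtains a b where "a \<in> pkeys p" "b \<in> pkeys q" "m = a + b"
  using keys_mult[of p q] assms by blast

lemma coef_cmult [simp]: "coef (mpoly_const c * p) m = c * coef p m"
  unfolding mpoly_const_def mult_map_scale_conv_mult[symmetric] by (simp add: map.rep_eq when_def)

lemma mpoly_const_mult: "mpoly_const c * mpoly_const d = mpoly_const (c * d)"
  by (simp add: mpoly_const_def mult_single)

lemma mpoly_const_1 [simp]: "mpoly_const 1 = 1" and mpoly_const_0 [simp]: "mpoly_const 0 = 0"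
  by (simp_all add: mpoly_const_def)

lemma mpoly_const_add: "mpoly_const (c + d) = mpoly_const c + mpoly_const d"
  by (simp add: mpoly_const_def single_add)

lemma mono_cmult: "mnm m c = mpoly_const c * mnm m 1"
  by (simp add: mpoly_const_def mult_single)

interpretation mp: vector_space "\<lambda>c (p :: 'k::field mpoly). mpoly_const c * p"
  by unfold_locales (auto simp: algebra_simps mpoly_const_add mpoly_const_mult mult.assoc[symmetric])

section \<open>Forms, homogeneous components and numbers of monomials\<close>

definition PC :: "nat \<Rightarrow> 'k::field mpoly set" where
  "PC n = {p. \<forall>m\<in>pkeys p. pkeys m \<subseteq> {..<n}}"

interpretation MP: sub_cring "mpoly_ring n :: 'k::field mpoly ring" "PC n" for n
proof
  fix x y :: "'k mpoly" assume "x \<in> PC n" "y \<in> PC n"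
  thus "x * y \<in> PC n" by (fastforce simp: PC_def keys_add_nat elim: keys_mult_E)
  show "x + y \<in> PC n" using \<open>x \<in> PC n\<close> \<open>y \<in> PC n\<close> keys_add[of x y] by (auto simp: PC_def)
qed (auto simp: mpoly_ring_def PC_def)

lemma PC_mono_iff: "mnm m c \<in> PC n \<longleftrightarrow> c = 0 \<or> pkeys m \<subseteq> {..<n}"
  by (auto simp: PC_def)

lemma const_in_PC [simp]: "mpoly_const c \<in> PC n"
  by (simp add: mpoly_const_def PC_mono_iff)

lemma mfilter_in_PC: "p \<in> PC n \<Longrightarrow> mfilter P p \<in> PC n"
  by (auto simp: PC_def)

lemma PC_sum: "(\<And>i. i \<in> A \<Longrightarrow> f i \<in> PC n) \<Longrightarrow> sum f A \<in> PC n"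
  by (induction A rule: infinite_finite_induct) auto

definition HF :: "nat \<Rightarrow> nat \<Rightarrow> 'k::field mpoly set" where
  "HF n d = {p \<in> PC n. homogeneous_mpoly d p}"

abbreviation hcomp :: "nat \<Rightarrow> 'k::field mpoly \<Rightarrow> 'k mpoly" where
  "hcomp d \<equiv> mfilter (\<lambda>m. mdeg m = d)"

lemma homogeneous_iff: "homogeneous_mpoly d p \<longleftrightarrow> (\<forall>m\<in>pkeys p. mdeg m = d)"
  by (simp add: homogeneous_mpoly_def mdeg_def)

definition monset :: "nat \<Rightarrow> nat \<Rightarrow> (nat \<Rightarrow>\<^sub>0 nat) set" where
  "monset n d = {m. pkeys m \<subseteq> {..<n} \<and> mdeg m = d}"

lemma HF_iff: "p \<in> HF n d \<longleftrightarrow> pkeys p \<subseteq> monset n d"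
  by (auto simp: HF_def PC_def homogeneous_iff monset_def)

lemma HF_PC: "p \<in> HF n d \<Longrightarrow> p \<in> PC n"
  by (simp add: HF_def)

lemma hcomp_HF: "p \<in> PC n \<Longrightarrow> hcomp d p \<in> HF n d"
  by (auto simp: HF_iff monset_def PC_def)

lemma hcomp_id: "p \<in> HF n d \<Longrightarrow> hcomp d p = p"
  by (rule mfilter_id) (auto simp: HF_iff monset_def)

lemma HF_mult: "\<lbrakk>p \<in> HF n d; q \<in> HF n e\<rbrakk> \<Longrightarrow> p * q \<in> HF n (d + e)"
  unfolding HF_def homogeneous_iff by (auto elim!: keys_mult_E)

lemma HF_add: "\<lbrakk>p \<in> HF n d; q \<in> HF n d\<rbrakk> \<Longrightarrow> p + q \<in> HF n d"
  using keys_add[of p q] by (auto simp: HF_iff)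

lemma HF_zero [simp]: "0 \<in> HF n d"
  by (simp add: HF_iff)

lemma HF_cmult: "p \<in> HF n d \<Longrightarrow> mpoly_const c * p \<in> HF n d"
  by (auto simp: HF_iff in_keys_iff)

lemma HF_subspace: "mp.subspace (HF n d)"
  by (simp add: mp.subspace_def HF_add HF_cmult)

lemma hcomp_mult:
  assumes "f \<in> HF n e" shows "hcomp (d + e) (a * f) = hcomp d a * f"
proof -
  have "a * f = hcomp d a * f + mfilter (\<lambda>m. mdeg m \<noteq> d) a * f"
    using mfilter_split[of a "\<lambda>m. mdeg m = d"] by (metis distrib_right)
  hence "hcomp (d + e) (a * f) = hcomp (d + e) (hcomp d a * f) + hcomp (d + e) (mfilter (\<lambda>m. mdeg m \<noteq> d) a * f)"
    by (metis mfilter_add)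
  also have "hcomp (d + e) (hcomp d a * f) = hcomp d a * f"
    using assms by (intro mfilter_id) (auto elim!: keys_mult_E simp: HF_iff monset_def)
  also have "hcomp (d + e) (mfilter (\<lambda>m. mdeg m \<noteq> d) a * f) = 0"
    using assms by (intro mfilter_none) (auto elim!: keys_mult_E simp: HF_iff monset_def)
  finally show ?thesis by simp
qed

lemma hcomp_mult_less: assumes "f \<in> HF n e" "d < e" shows "hcomp d (a * f) = 0"
  using assms by (intro mfilter_none) (auto elim!: keys_mult_E simp: HF_iff monset_def)

lemma sum_hcomp:
  obtains N where "\<And>d. d > N \<Longrightarrow> hcomp d p = 0" "p = (\<Sum>d\<le>N. hcomp d p)"
proof -
  obtain N where N: "\<And>m. m \<in> pkeys p \<Longrightarrow> mdeg m \<le> N"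
    using finite_nat_set_iff_bounded_le[of "mdeg ` pkeys p"] by auto
  show ?thesis
  proof
    show "hcomp d p = 0" if "d > N" for d using N that by (intro mfilter_none) fastforce
    show "p = (\<Sum>d\<le>N. hcomp d p)"
    proof (rule poly_mapping_eqI)
      fix m show "coef p m = coef (\<Sum>d\<le>N. hcomp d p) m"
        using N[of m] by (auto simp: lookup_sum in_keys_iff)
    qed
  qed
qed

lemma finite_monset [simp]: "finite (monset n d)"
proof -
  have "inj_on coef (monset n d)" by (intro inj_onI poly_mapping_eqI) simp
  moreover have "coef ` monset n d \<subseteq> {f. \<forall>i. (i \<in> {..<n} \<longrightarrow> f i \<in> {..d}) \<and> (i \<notin> {..<n} \<longrightarrow> f i = 0)}"
  proof (clarify, intro allI conjI impI)
    fix m i assume m: "m \<in> monset n d"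
    show "coef m i \<in> {..d}" using coef_le_mdeg[of m i] m by (simp add: monset_def)
    show "coef m i = 0" if "i \<notin> {..<n}"
    proof (rule ccontr)
      assume "coef m i \<noteq> 0"
      hence "i \<in> pkeys m" by (simp add: in_keys_iff)
      thus False using m that by (auto simp: monset_def)
    qed
  qed
  moreover have "finite {f. \<forall>i. (i \<in> {..<n} \<longrightarrow> f i \<in> {..d}) \<and> (i \<notin> {..<n} \<longrightarrow> f i = (0::nat))}"
    by (rule finite_set_of_finite_funs) auto
  ultimately have "finite (coef ` monset n d)" by (blast intro: finite_subset)
  thus ?thesis using \<open>inj_on coef (monset n d)\<close> by (rule finite_imageD)
qed

lemma span_monos: "mp.span ((\<lambda>m. mnm m 1) ` monset n d) = (HF n d :: 'k::field mpoly set)"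
proof (rule antisym)
  show "mp.span ((\<lambda>m. mnm m 1) ` monset n d) \<subseteq> (HF n d :: 'k mpoly set)"
    by (intro mp.span_minimal HF_subspace) (auto simp: HF_iff)
  show "HF n d \<subseteq> mp.span ((\<lambda>m. mnm m (1::'k)) ` monset n d)"
  proof
    fix p :: "'k mpoly" assume "p \<in> HF n d"
    hence "(\<Sum>m\<in>pkeys p. mnm m (coef p m)) \<in> mp.span ((\<lambda>m. mnm m (1::'k)) ` monset n d)"
      by (intro mp.span_sum, subst mono_cmult, intro mp.span_scale mp.span_base)
        (auto simp: HF_iff)
    thus "p \<in> mp.span ((\<lambda>m. mnm m 1) ` monset n d)" by (simp flip: poly_sum_monos)
  qed
qed

lemma inj_monos: "inj_on (\<lambda>m :: nat \<Rightarrow>\<^sub>0 nat. mnm m (1::'k::field)) A"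
proof (rule inj_onI)
  fix m m' :: "nat \<Rightarrow>\<^sub>0 nat" assume "mnm m (1::'k) = mnm m' 1"
  hence "pkeys (mnm m (1::'k)) = pkeys (mnm m' (1::'k))" by simp
  thus "m = m'" by simp
qed

lemma independent_monos: "mp.independent ((\<lambda>m. mnm m (1::'k::field)) ` A)"
proof (unfold mp.dependent_def, rule notI, elim bexE)
  fix p :: "'k mpoly" assume "p \<in> (\<lambda>m. mnm m 1) ` A"
  then obtain m where m: "p = mnm m 1" "m \<in> A" by auto
  assume "p \<in> mp.span ((\<lambda>m. mnm m 1) ` A - {p})"
  moreover have "mp.span ((\<lambda>m. mnm m (1::'k)) ` A - {p}) \<subseteq> {q. coef q m = 0}"
  proof (rule mp.span_minimal)
    show "(\<lambda>m. mnm m 1) ` A - {p} \<subseteq> {q. coef q m = 0}"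
      using m by (auto simp: lookup_single when_def)
    show "mp.subspace {q. coef q m = 0}" by (auto simp: mp.subspace_def lookup_add)
  qed
  ultimately show False using m by auto
qed

lemma dim_HF: "mp.dim (HF n d :: 'k::field mpoly set) = card (monset n d)"
  and findim_HF: "findim (\<lambda>c p. mpoly_const c * p) (HF n d :: 'k::field mpoly set)"
proof -
  have "mp.dim (mp.span ((\<lambda>m. mnm m (1::'k)) ` monset n d)) = card ((\<lambda>m. mnm m (1::'k)) ` monset n d)"
    by (rule mp.dim_span_eq_card_independent[OF independent_monos])
  thus "mp.dim (HF n d :: 'k mpoly set) = card (monset n d)"
    by (simp add: span_monos card_image[OF inj_monos])
  show "findim (\<lambda>c p. mpoly_const c * p) (HF n d :: 'k mpoly set)"
    unfolding findim_def using span_monos[of n d, where ?'k = 'k]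
    by (intro exI[of _ "(\<lambda>m. mnm m 1) ` monset n d"]) auto
qed

lemma card_monset_0: "card (monset 0 d) = (if d = 0 then 1 else 0)"
proof -
  have "monset 0 d = (if d = 0 then {0} else {})" by (auto simp: monset_def)
  thus ?thesis by simp
qed

lemma card_monset_degree_0 [simp]: "card (monset n 0) = 1"
proof -
  have "monset n 0 = {0}" by (auto simp: monset_def mdeg_eq_0)
  thus ?thesis by simp
qed

text \<open>Monomials either avoid the variable with index \<open>n\<close> or are divisible by it.
  This form of Pascal's rule is the source of the factor 1/(1 - X) that each variable contributes to
  \<open>HP\<close>.\<close>

lemma card_monset_Suc:
  "card (monset (Suc n) (Suc d)) = card (monset n (Suc d)) + card (monset (Suc n) d)"
proof -
  have "monset (Suc n) (Suc d) = monset n (Suc d) \<union> (\<lambda>m. m + mnm n 1) ` monset (Suc n) d" (is "?A = ?B \<union> ?C")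
  proof (intro equalityI subsetI)
    fix m assume m: "m \<in> ?A"
    show "m \<in> ?B \<union> ?C"
    proof (cases "coef m n = 0")
      case True
      hence "n \<notin> pkeys m" by (simp add: in_keys_iff)
      thus ?thesis using m by (auto simp: monset_def less_Suc_eq dest!: subsetD)
    next
      case False
      then obtain m' where "m = m' + mnm n 1" by (rule mono_split)
      thus ?thesis using m by (auto simp: monset_def keys_add_nat)
    qed
  qed (auto simp: monset_def keys_add_nat)
  moreover have "?B \<inter> ?C = {}" by (auto simp: monset_def keys_add_nat)
  moreover have "card ?C = card (monset (Suc n) d)" by (intro card_image) (auto simp: inj_on_def)
  ultimately show ?thesis by (simp add: card_Un_disjoint)
qed

lemma card_monset_mono: "d \<le> d' \<Longrightarrow> card (monset (Suc n) d) \<le> card (monset (Suc n) d')"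
  by (rule lift_Suc_mono_le[of "\<lambda>d. card (monset (Suc n) d)"]) (auto simp: card_monset_Suc)

lemma card_monset: "card (monset (Suc n) d) = (n + d) choose n"
proof (induction "n + d" arbitrary: n d rule: less_induct)
  case less
  show ?case
  proof (cases d)
    case (Suc d')
    show ?thesis
    proof (cases n)
      case 0
      have "card (monset (Suc 0) d) = 1"
        by (induction d) (simp_all add: card_monset_Suc card_monset_0)
      thus ?thesis using 0 by simp
    next
      case (Suc n')
      thus ?thesis using \<open>d = Suc d'\<close> less[of n' d] less[of n d'] by (simp add: card_monset_Suc)
    qed
  qed simp
qed

section \<open>Hilbert series and regular sequences\<close>

unbundle fps_syntax

abbreviation idl :: "nat \<Rightarrow> 'k::field mpoly set \<Rightarrow> 'k mpoly set" where
  "idl n F \<equiv> Idl\<^bsub>mpoly_ring n\<^esub> F"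

definition graded_ideal :: "nat \<Rightarrow> 'k::field mpoly set \<Rightarrow> bool" where
  "graded_ideal n I \<longleftrightarrow> MP.is_ideal n I \<and> (\<forall>d. \<forall>p\<in>I. hcomp d p \<in> I)"

lemma ideal_subspace: "MP.is_ideal n I \<Longrightarrow> mp.subspace I"
  by (auto simp: mp.subspace_def intro: MP.is_idealD)

lemma ideal_HF_subspace: "MP.is_ideal n I \<Longrightarrow> mp.subspace (I \<inter> HF n d)"
  by (intro mp.subspace_inter ideal_subspace HF_subspace)

lemma findim_ideal_HF: "findim (\<lambda>c p. mpoly_const c * p) (I \<inter> HF n d)"
  by (rule mp.findim_subset[OF findim_HF]) auto

text \<open>The Hilbert function of P/I, written as a difference of dimensions so that no quotient
  is formed. Integer values allow it to serve as the coefficients of a series that is multiplied by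
  1 - X^e.\<close>

definition hf :: "nat \<Rightarrow> 'k::field mpoly set \<Rightarrow> nat \<Rightarrow> int" where
  "hf n I d = int (card (monset n d)) - int (mp.dim (I \<inter> HF n d))"

text \<open>The Hilbert function of the annihilator of \<open>f\<close> in \<open>P/I\<close>.\<close>

definition hk :: "nat \<Rightarrow> 'k::field mpoly set \<Rightarrow> 'k mpoly \<Rightarrow> nat \<Rightarrow> int" where
  "hk n I f d = int (mp.dim {v \<in> HF n d. v * f \<in> I}) - int (mp.dim (I \<inter> HF n d))"

lemma findim_colon: "findim (\<lambda>c p. mpoly_const c * p) {v \<in> HF n d. v * f \<in> I}"
  by (rule mp.findim_subset[OF findim_HF]) auto

lemma hk_nonneg:
  assumes I: "MP.is_ideal n I" and f: "f \<in> PC n" shows "hk n I f d \<ge> 0"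
proof -
  have "I \<inter> HF n d \<subseteq> {v \<in> HF n d. v * f \<in> I}"
    using MP.is_idealD(5)[OF I f] by (auto simp: mult.commute)
  hence "mp.dim (I \<inter> HF n d) \<le> mp.dim {v \<in> HF n d. v * f \<in> I}"
    by (intro mp.dim_mono_findim findim_colon subset_trans[OF _ mp.span_superset])
  thus ?thesis by (simp add: hk_def)
qed

lemma hk_eq_0_iff:
  assumes I: "MP.is_ideal n I" and f: "f \<in> PC n"
  shows "hk n I f d = 0 \<longleftrightarrow> (\<forall>v\<in>HF n d. v * f \<in> I \<longrightarrow> v \<in> I)"
proof -
  have sub: "I \<inter> HF n d \<subseteq> {v \<in> HF n d. v * f \<in> I}"
    using MP.is_idealD(5)[OF I f] by (auto simp: mult.commute)
  show ?thesis
  proof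
    assume "hk n I f d = 0"
    hence "{v \<in> HF n d. v * f \<in> I} = I \<inter> HF n d"
      by (intro mp.subspace_dim_eq[OF ideal_HF_subspace[OF I] sub findim_colon]) (simp add: hk_def)
    thus "\<forall>v\<in>HF n d. v * f \<in> I \<longrightarrow> v \<in> I" by blast
  next
    assume "\<forall>v\<in>HF n d. v * f \<in> I \<longrightarrow> v \<in> I"
    hence "{v \<in> HF n d. v * f \<in> I} = I \<inter> HF n d" using sub by blast
    thus "hk n I f d = 0" by (simp add: hk_def)
  qed
qed

lemma linear_mult: "Vector_Spaces.linear (\<lambda>c p. mpoly_const c * p) (\<lambda>c p. mpoly_const c * p) (\<lambda>v :: 'k::field mpoly. v * f)"
  by (auto simp: Vector_Spaces.linear_iff mp.vector_space_axioms distrib_right mult.assoc)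

interpretation mp2: vector_space_pair "\<lambda>c (p :: 'k::field mpoly). mpoly_const c * p" "\<lambda>c (p :: 'k::field mpoly). mpoly_const c * p"
  by unfold_locales

context
  fixes n :: nat and I I' :: "'k::field mpoly set" and f :: "'k mpoly" and e :: nat
  assumes gr: "graded_ideal n I" and f: "f \<in> HF n e"
    and I': "I' = {x + a * f | x a. x \<in> I \<and> a \<in> PC n}"
begin

lemma I_ideal: "MP.is_ideal n I"
  using gr by (simp add: graded_ideal_def)

lemma adjoin_HF: "I' \<inter> HF n (d + e) = {x + v * f | x v. x \<in> I \<inter> HF n (d + e) \<and> v \<in> HF n d}"
proof (intro equalityI subsetI)
  fix p assume p: "p \<in> I' \<inter> HF n (d + e)"
  then obtain x a where xa: "p = x + a * f" "x \<in> I" "a \<in> PC n" by (auto simp: I')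
  have "p = hcomp (d + e) p" using p by (simp add: hcomp_id[of p n])
  also have "\<dots> = hcomp (d + e) x + hcomp d a * f" using xa f by (simp add: mfilter_add hcomp_mult)
  finally have "p = hcomp (d + e) x + hcomp d a * f" .
  moreover have "hcomp (d + e) x \<in> I \<inter> HF n (d + e)" "hcomp d a \<in> HF n d"
    using xa gr hcomp_HF MP.is_idealD(2)[OF I_ideal] by (auto simp: graded_ideal_def)
  ultimately show "p \<in> {x + v * f | x v. x \<in> I \<inter> HF n (d + e) \<and> v \<in> HF n d}" by blast
next
  fix p assume "p \<in> {x + v * f | x v. x \<in> I \<inter> HF n (d + e) \<and> v \<in> HF n d}"
  then obtain x v where xv: "p = x + v * f" "x \<in> I" "x \<in> HF n (d + e)" "v \<in> HF n d" by blast
  hence "p \<in> I'" using HF_PC unfolding I' by blast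
  thus "p \<in> I' \<inter> HF n (d + e)" using xv f by (auto intro: HF_add HF_mult)
qed

text \<open>The alternating sum of dimensions, in degree \<open>d + e\<close>, along 0 -> Ann(f)(-e)
  -> (P/I)(-e) -> P/I -> P/I' -> 0, with multiplication by \<open>f\<close> as the middle map. It
  comes from \<open>dim_sum_image\<close> with \<open>A = I \<inter> HF n (d + e)\<close>.\<close>

lemma hf_adjoin: "hf n I' (d + e) = hf n I (d + e) - hf n I d + hk n I f d"
proof -
  have "{v \<in> HF n d. v * f \<in> I \<inter> HF n (d + e)} = {v \<in> HF n d. v * f \<in> I}"
    using f HF_mult by blast
  thus ?thesis
    using mp2.dim_sum_image[OF linear_mult[of f] HF_subspace[of n d] findim_HF
        ideal_HF_subspace[OF I_ideal, of "d + e"] findim_ideal_HF]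
    by (simp add: hf_def hk_def adjoin_HF dim_HF)
qed

lemma hf_adjoin_less: assumes "d < e" shows "hf n I' d = hf n I d"
proof -
  have "I' \<inter> HF n d = I \<inter> HF n d"
  proof (intro equalityI subsetI)
    fix p assume p: "p \<in> I' \<inter> HF n d"
    then obtain x a where xa: "p = x + a * f" "x \<in> I" "a \<in> PC n" by (auto simp: I')
    have "p = hcomp d p" using p by (simp add: hcomp_id[of p n])
    also have "\<dots> = hcomp d x" using xa f assms by (simp add: mfilter_add hcomp_mult_less)
    finally show "p \<in> I \<inter> HF n d" using p xa gr by (auto simp: graded_ideal_def)
  next
    fix p assume p: "p \<in> I \<inter> HF n d"
    hence "p = p + 0 * f" by simp
    thus "p \<in> I' \<inter> HF n d" using p MP.zero_C unfolding I' by blast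
  qed
  thus ?thesis by (simp add: hf_def)
qed

lemma graded_adjoin: assumes "MP.is_ideal n I'" shows "graded_ideal n I'"
  unfolding graded_ideal_def
proof (intro conjI allI ballI assms)
  fix d p assume "p \<in> I'"
  then obtain x a where xa: "p = x + a * f" "x \<in> I" "a \<in> PC n" by (auto simp: I')
  have x: "hcomp d x \<in> I" using xa gr by (simp add: graded_ideal_def)
  show "hcomp d p \<in> I'"
  proof (cases "d < e")
    case True
    hence "hcomp d p = hcomp d x + 0 * f" using xa f by (simp add: mfilter_add hcomp_mult_less)
    thus ?thesis using x MP.zero_C unfolding I' by blast
  next
    case False
    then obtain c where "d = c + e" by (metis add.commute le_add_diff_inverse not_less)
    hence "hcomp d p = hcomp d x + hcomp c a * f" using xa f by (simp add: mfilter_add hcomp_mult)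
    thus ?thesis using x xa mfilter_in_PC unfolding I' by blast
  qed
qed

text \<open>As \<open>I\<close> is graded, it suffices to test homogeneous \<open>g\<close>: the
  component of \<open>g * f\<close> in degree \<open>d + e\<close> is
  \<open>hcomp d g * f\<close>.\<close>

lemma colon_iff: "(\<forall>g\<in>PC n. f * g \<in> I \<longrightarrow> g \<in> I) \<longleftrightarrow> (\<forall>d. hk n I f d = 0)"
proof
  assume "\<forall>g\<in>PC n. f * g \<in> I \<longrightarrow> g \<in> I"
  thus "\<forall>d. hk n I f d = 0"
    using HF_PC by (auto simp: hk_eq_0_iff[OF I_ideal HF_PC[OF f]] mult.commute)
next
  assume "\<forall>d. hk n I f d = 0"
  hence *: "v * f \<in> I \<Longrightarrow> v \<in> HF n d \<Longrightarrow> v \<in> I" for v d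
    using HF_PC[OF f] by (simp add: hk_eq_0_iff[OF I_ideal])
  show "\<forall>g\<in>PC n. f * g \<in> I \<longrightarrow> g \<in> I"
  proof (intro ballI impI)
    fix g assume g: "g \<in> PC n" "f * g \<in> I"
    have "hcomp d g \<in> I" for d
    proof -
      have "hcomp (d + e) (g * f) \<in> I" using g gr by (simp add: graded_ideal_def mult.commute)
      thus ?thesis using *[of "hcomp d g" d] hcomp_HF[OF g(1)] by (simp add: hcomp_mult[OF f])
    qed
    moreover obtain N where "g = (\<Sum>d\<le>N. hcomp d g)" by (rule sum_hcomp)
    ultimately show "g \<in> I" using MP.is_ideal_sum[OF I_ideal, of "{..N}" "\<lambda>d. hcomp d g"] by simp
  qed
qed

end

section \<open>Hilbert series and the product expected for a regular sequence\<close>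

definition HS :: "nat \<Rightarrow> 'k::field mpoly set \<Rightarrow> int fps" where
  "HS n I = Abs_fps (hf n I)"

definition HP :: "nat \<Rightarrow> int fps" where
  "HP n = Abs_fps (\<lambda>d. int (card (monset n d)))"

lemma HS_adjoin:
  assumes "graded_ideal n I" "f \<in> HF n e"
    and "I' = {x + a * f | x a. x \<in> I \<and> a \<in> PC n}"
  shows "HS n I' = (1 - fps_X ^ e) * HS n I + fps_X ^ e * Abs_fps (hk n I f)"
proof (rule fps_ext)
  fix d
  show "HS n I' $ d = ((1 - fps_X ^ e) * HS n I + fps_X ^ e * Abs_fps (hk n I f)) $ d"
  proof (cases "d < e")
    case True
    thus ?thesis using hf_adjoin_less[OF assms True]
      by (simp add: HS_def algebra_simps fps_X_power_mult_nth)
  next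
    case False
    then obtain c where "d = c + e" by (metis add.commute le_add_diff_inverse not_less)
    thus ?thesis using hf_adjoin[OF assms, of c]
      by (simp add: HS_def algebra_simps fps_X_power_mult_nth)
  qed
qed

lemma HP_Suc: "(1 - fps_X) * HP (Suc n) = HP n"
proof (rule fps_ext)
  fix d show "((1 - fps_X) * HP (Suc n)) $ d = HP n $ d"
    by (cases d) (simp_all add: algebra_simps HP_def card_monset_Suc)
qed

lemma HP_inverse: "(1 - fps_X) ^ n * HP n = 1"
proof (induction n)
  case 0 show ?case by (rule fps_ext) (simp add: HP_def card_monset_0)
next
  case (Suc n) thus ?case by (simp only: power_Suc2 mult.assoc HP_Suc)
qed

text \<open>Positivity of the lowest nonzero coefficient rather than of all coefficients:
  multiplication by 1 - X^e can introduce negative coefficients, but it keeps the lowest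
  one.\<close>

definition lexpos :: "int fps \<Rightarrow> bool" where
  "lexpos D \<longleftrightarrow> D = 0 \<or> (\<exists>N. (\<forall>j<N. D $ j = 0) \<and> D $ N > 0)"

lemma lexpos_nonneg: assumes "\<And>j. D $ j \<ge> 0" shows "lexpos D"
proof (cases "D = 0")
  case False
  thus ?thesis using assms[of "subdegree D"] nth_subdegree_nonzero[OF False]
    unfolding lexpos_def
      by (intro disjI2 exI[of _ "subdegree D"]) (auto simp: le_less nth_less_subdegree_zero)
qed (simp add: lexpos_def)

lemma one_minus_X_power_nonzero: assumes "e \<ge> 1" shows "1 - fps_X ^ e \<noteq> (0 :: int fps)"
proof
  assume "1 - fps_X ^ e = (0 :: int fps)"
  from arg_cong[OF this, of "\<lambda>f. f $ 0"] show False using assms by simp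
qed

lemma lexpos_mult:
  assumes "lexpos D" "e \<ge> 1"
  shows "lexpos ((1 - fps_X ^ e) * D)" "(1 - fps_X ^ e) * D = 0 \<longleftrightarrow> D = 0"
proof -
  show "(1 - fps_X ^ e) * D = 0 \<longleftrightarrow> D = 0"
    unfolding mult_eq_0_iff using one_minus_X_power_nonzero[OF assms(2)] by blast
  show "lexpos ((1 - fps_X ^ e) * D)"
  proof (cases "D = 0")
    case False
    then obtain N where N: "\<forall>j<N. D $ j = 0" "D $ N > 0" using assms by (auto simp: lexpos_def)
    have "((1 - fps_X ^ e) * D) $ j = D $ j" if "j \<le> N" for j
      using N that assms(2) by (simp add: left_diff_distrib fps_X_power_mult_nth)
    thus ?thesis unfolding lexpos_def using N by (intro disjI2 exI[of _ N]) auto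
  qed (simp add: lexpos_def)
qed

lemma lexpos_add:
  assumes "lexpos A" "lexpos B"
  shows "lexpos (A + B)" "A + B = 0 \<longleftrightarrow> A = 0 \<and> B = 0"
proof -
  have "lexpos (A + B) \<and> (A + B = 0 \<longleftrightarrow> A = 0 \<and> B = 0)"
  proof (cases "A = 0 \<or> B = 0")
    case False
    then obtain N M where N: "\<forall>j<N. A $ j = 0" "A $ N > 0" and M: "\<forall>j<M. B $ j = 0" "B $ M > 0"
      using assms by (auto simp: lexpos_def)
    have *: "\<forall>j<min N M. (A + B) $ j = 0" "(A + B) $ min N M > 0"
      using N M
        by (auto simp: min_def) (metis add.left_neutral add.right_neutral add_pos_pos linorder_neqE_nat not_le)+
    have "A + B \<noteq> 0"
    proof
      assume "A + B = 0"
      hence "(A + B) $ min N M = 0" by simp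
      thus False using *(2) by simp
    qed
    thus ?thesis using * False unfolding lexpos_def by blast
  qed (use assms in auto)
  thus "lexpos (A + B)" "A + B = 0 \<longleftrightarrow> A = 0 \<and> B = 0" by blast+
qed

definition forms :: "nat \<Rightarrow> ('k::field mpoly \<times> nat) list \<Rightarrow> bool" where
  "forms n fds \<longleftrightarrow> (\<forall>(f, d)\<in>set fds. f \<in> HF n d \<and> d \<ge> 1)"

text \<open>Only the recorded degrees enter. Lists carry the degrees along with the forms because
  the zero form lies in every \<open>HF n d\<close> and has no degree of its own.\<close>

definition koszul :: "('a \<times> nat) list \<Rightarrow> int fps" where
  "koszul fds = (\<Prod>x\<leftarrow>fds. 1 - fps_X ^ snd x)"

text \<open>The nonzerodivisor part of \<open>regular_sequence\<close>; that the ideal is proper is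
  checked separately.\<close>

definition wreg :: "nat \<Rightarrow> 'k::field mpoly list \<Rightarrow> bool" where
  "wreg n fs \<longleftrightarrow> (\<forall>i<length fs. \<forall>g\<in>PC n.
     fs ! i * g \<in> idl n (set (take i fs)) \<longrightarrow> g \<in> idl n (set (take i fs)))"

lemma wreg_snoc: "wreg n (fs @ [f]) \<longleftrightarrow>
    wreg n fs \<and> (\<forall>g\<in>PC n. f * g \<in> idl n (set fs) \<longrightarrow> g \<in> idl n (set fs))"
  by (auto simp: wreg_def less_Suc_eq nth_append)

lemma forms_PC: "forms n fds \<Longrightarrow> fst ` set fds \<subseteq> PC n"
  by (auto simp: forms_def HF_PC)

lemma graded_idl: "forms n fds \<Longrightarrow> graded_ideal n (idl n (fst ` set fds))"
proof (induction fds rule: rev_induct)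
  case Nil
  thus ?case using MP.is_ideal_genideal[of "{}" n] by (simp add: graded_ideal_def MP.genideal_empty)
next
  case (snoc x fds)
  obtain f d where x: "x = (f, d)" by force
  have fds: "forms n fds" "f \<in> HF n d" using snoc.prems by (auto simp: forms_def x)
  show ?case
    using graded_adjoin[OF snoc.IH[OF fds(1)] fds(2) MP.genideal_insert] forms_PC[OF snoc.prems]
      MP.is_ideal_genideal[of "fst ` set (fds @ [x])" n] by (simp add: x)
qed

lemma dim_zero: "mp.dim {0 :: 'k::field mpoly} = 0"
  by (rule mp.dim_unique[of "{}"]) (auto simp: mp.independent_empty)

text \<open>The Hilbert series of \<open>P/(f\<^sub>1, \<dots>, f\<^sub>c)\<close> exceeds the value expected for a regular
  sequence by \<open>\<Sum>\<^sub>i X\<^bsup>d\<^sub>i\<^esup> K\<^sub>i \<Prod>\<^bsub>j>i\<^esub> (1 - X\<^bsup>d\<^sub>j\<^esup>)\<close>, where \<open>K\<^sub>i\<close> is the Hilbert series of the annihilator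
  of \<open>f\<^sub>i\<close> modulo its predecessors. Lowest coefficients are positive, so nothing cancels.\<close>

lemma HS_regular:
  fixes fds :: "('k::field mpoly \<times> nat) list"
  assumes "forms n fds"
  shows "lexpos (HS n (idl n (fst ` set fds)) - koszul fds * HP n) \<and>
    (HS n (idl n (fst ` set fds)) = koszul fds * HP n \<longleftrightarrow> wreg n (map fst fds))"
  using assms
proof (induction fds rule: rev_induct)
  case Nil
  have "HS n {0 :: 'k mpoly} = HP n" by (simp add: HS_def HP_def hf_def fps_eq_iff dim_zero)
  thus ?case by (simp add: MP.genideal_empty koszul_def lexpos_def wreg_def)
next
  case (snoc x fds)
  obtain f e where x: "x = (f, e)" by force
  have fds: "forms n fds" "f \<in> HF n e" "e \<ge> 1" using snoc.prems by (auto simp: forms_def x)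
  define I where "I = idl n (fst ` set fds)"
  define K where "K = Abs_fps (hk n I f)"
  note gr = graded_idl[OF fds(1), folded I_def]
  have ins: "idl n (fst ` set (fds @ [x])) = {x + a * f | x a. x \<in> I \<and> a \<in> PC n}"
    using MP.genideal_insert[of f "fst ` set fds" n] forms_PC[OF snoc.prems] by (simp add: x I_def)
  have step: "HS n (idl n (fst ` set (fds @ [x]))) = (1 - fps_X ^ e) * HS n I + fps_X ^ e * K"
    unfolding K_def by (rule HS_adjoin[OF gr fds(2) ins])
  define D where "D = HS n I - koszul fds * HP n"
  have eq: "HS n (idl n (fst ` set (fds @ [x]))) - koszul (fds @ [x]) * HP n
     = (1 - fps_X ^ e) * D + fps_X ^ e * K"
    unfolding step D_def by (simp add: koszul_def x algebra_simps)
  have IH: "lexpos D" "D = 0 \<longleftrightarrow> wreg n (map fst fds)"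
    using snoc.IH[OF fds(1)] by (auto simp: D_def I_def)
  have K_nonneg: "K $ j \<ge> 0" for j
    using hk_nonneg[of n I f j] gr HF_PC[OF fds(2)] by (simp add: K_def graded_ideal_def)
  hence lK: "lexpos (fps_X ^ e * K)" by (intro lexpos_nonneg) (simp add: fps_X_power_mult_nth)
  have "K = 0 \<longleftrightarrow> (\<forall>d. hk n I f d = 0)" by (simp add: K_def fps_eq_iff)
  also have "\<dots> \<longleftrightarrow> (\<forall>g\<in>PC n. f * g \<in> I \<longrightarrow> g \<in> I)" using colon_iff[OF gr fds(2) ins] by simp
  finally have K0: "fps_X ^ e * K = 0 \<longleftrightarrow> (\<forall>g\<in>PC n. f * g \<in> I \<longrightarrow> g \<in> I)" by simp
  note add = lexpos_add[OF lexpos_mult(1)[OF IH(1) fds(3)] lK]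
  have "HS n (idl n (fst ` set (fds @ [x]))) = koszul (fds @ [x]) * HP n \<longleftrightarrow>
     (1 - fps_X ^ e) * D + fps_X ^ e * K = 0" unfolding eq[symmetric] by simp
  also have "\<dots> \<longleftrightarrow> wreg n (map fst (fds @ [x]))"
    unfolding add(2) lexpos_mult(2)[OF IH(1) fds(3)] IH(2) K0 by (simp add: wreg_snoc x I_def)
  finally show ?case using add(1) eq by simp
qed

lemma card_monset_le: "card (monset n d) \<le> card (monset (Suc n) d)"
  by (rule card_mono[OF finite_monset]) (auto simp: monset_def lessThan_Suc)

lemma card_monset_le': "n \<le> n' \<Longrightarrow> card (monset n d) \<le> card (monset n' d)"
  by (rule lift_Suc_mono_le[of "\<lambda>n. card (monset n d)"]) (rule card_monset_le)

text \<open>Undoing one form of degree \<open>e\<close> gives hf I d \<le> hf I' d + hf I (d - e),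
  as \<open>hk\<close> is nonnegative. Since e \<ge> 1 and the numbers of monomials grow with the
  degree, Pascal's rule turns this into a bound with one more variable. Each form thus accounts for
  one variable.\<close>

lemma growth:
  fixes fds :: "('k::field mpoly \<times> nat) list"
  assumes "forms n fds" "C \<ge> 0"
    and "\<And>d. hf n (idl n (fst ` set fds)) d \<le> C * int (card (monset (Suc j) d))"
  shows "int (card (monset n d)) \<le> C * int (card (monset (Suc j + length fds) d))"
  using assms(1,3)
proof (induction fds arbitrary: j rule: rev_induct)
  case Nil
  thus ?case using Nil(2)[of d] by (simp add: MP.genideal_empty hf_def dim_zero)
next
  case (snoc x fds)
  obtain f e where x: "x = (f, e)" by force
  have fds: "forms n fds" "f \<in> HF n e" "e \<ge> 1" using snoc.prems by (auto simp: forms_def x)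
  define I where "I = idl n (fst ` set fds)"
  define I' where "I' = idl n (fst ` set (fds @ [x]))"
  note gr = graded_idl[OF fds(1), folded I_def]
  have ins: "I' = {x + a * f | x a. x \<in> I \<and> a \<in> PC n}"
    using MP.genideal_insert[of f "fst ` set fds" n] forms_PC[OF snoc.prems(1)]
      by (simp add: x I_def I'_def)
  have bound: "hf n I' d \<le> C * int (card (monset (Suc j) d))" for d
    using snoc.prems(2) by (simp add: I'_def)
  have "hf n I d \<le> C * int (card (monset (Suc (Suc j)) d))" for d
  proof (induction d rule: less_induct)
    case (less d)
    show ?case
    proof (cases "d < e")
      case True
      have "hf n I d \<le> C * int (card (monset (Suc j) d))"
        using hf_adjoin_less[OF gr fds(2) ins True] bound[of d] by simp
      also have "\<dots> \<le> C * int (card (monset (Suc (Suc j)) d))"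
        using card_monset_le[of "Suc j" d] assms(2) by (intro mult_left_mono) auto
      finally show ?thesis .
    next
      case False
      then obtain c where c: "d = c + e" by (metis add.commute le_add_diff_inverse not_less)
      have "d > 0" using c fds(3) by simp
      then obtain d' where d': "d = Suc d'" by (rule gr0_implies_Suc[THEN exE])
      have "hf n I d \<le> hf n I' d + hf n I c"
        using hf_adjoin[OF gr fds(2) ins, of c] hk_nonneg[of n I f c] gr HF_PC[OF fds(2)] c
        by (simp add: graded_ideal_def)
      also have "\<dots> \<le> C * int (card (monset (Suc j) d)) + C * int (card (monset (Suc (Suc j)) c))"
        using bound[of d] less.IH[of c] c fds(3) by (intro add_mono) auto
      also have "\<dots> \<le> C * int (card (monset (Suc j) d)) + C * int (card (monset (Suc (Suc j)) d'))"
        using card_monset_mono[of c d' "Suc j"] assms(2) c d' fds(3)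
          by (intro add_mono mult_left_mono) auto
      also have "\<dots> = C * int (card (monset (Suc (Suc j)) d))"
        unfolding d' by (subst card_monset_Suc[of "Suc j"]) (simp add: algebra_simps)
      finally show ?thesis .
    qed
  qed
  from snoc.IH[OF fds(1), of "Suc j"] this show ?case by (simp add: I_def)
qed

text \<open>A bounded Hilbert function means dimension at most one, and each form lowers the
  dimension by at most one. The argument is a comparison of binomial coefficients.\<close>

lemma bounded_hf_imp_many_generators:
  assumes "forms n fds" "\<And>d. hf n (idl n (fst ` set fds)) d \<le> C"
  shows "n \<le> Suc (length fds)"
proof (rule ccontr)
  assume "\<not> n \<le> Suc (length fds)"
  define c where "c = length fds"
  define A where "A = max C 0"
  \<comment> \<open>The two binomial coefficients compared below have quotient (c + 1 + d)/(c + 1),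
    which for this \<open>d\<close> equals \<open>A\<close> + 1.\<close>
  define d where "d = nat (int (Suc c) * A)"
  have n: "Suc (Suc c) \<le> n" using \<open>\<not> n \<le> _\<close> by (simp add: c_def)
  have c1: "card (monset (Suc 0) d) = 1" for d using card_monset[of 0 d] by simp
  have "int (card (monset (Suc (Suc c)) d)) \<le> int (card (monset n d))"
    using card_monset_le'[OF n] by simp
  also have "\<dots> \<le> A * int (card (monset (Suc 0 + length fds) d))"
    using assms(2) by (intro growth assms(1)) (auto simp: A_def c1 max.coboundedI1)
  finally have "int ((Suc c + d) choose Suc c) \<le> A * int ((c + d) choose c)"
    unfolding card_monset by (simp add: card_monset c_def)
  hence "int (Suc c) * int ((Suc c + d) choose Suc c) \<le> int (Suc c) * (A * int ((c + d) choose c))"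
    by (intro mult_left_mono) auto
  moreover have "int (Suc c) * int ((Suc c + d) choose Suc c) = int (Suc (c + d)) * int ((c + d) choose c)"
    using Suc_times_binomial[of c "c + d"] by (metis add_Suc of_nat_mult)
  ultimately have "int (Suc (c + d)) * int ((c + d) choose c) \<le> (int (Suc c) * A) * int ((c + d) choose c)"
    by (metis mult.assoc)
  moreover have "int ((c + d) choose c) > 0" by simp
  ultimately have "int (Suc (c + d)) \<le> int (Suc c) * A" by (rule mult_right_le_imp_le)
  moreover have "int d = int (Suc c) * A" by (simp add: d_def A_def)
  ultimately show False by simp
qed

section \<open>The associated graded ring of a semigroup ring\<close>

text \<open>Lets the graded ring of cosets be replaced by a model with explicit elements. Only
  closure of the operations of \<open>R\<close> and compatibility of \<open>h\<close> enter, so the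
  ring laws for products of cosets never have to be verified.\<close>

lemma graded_complete_intersection_transfer:
  fixes R :: "('r, 'c) ring_scheme" and G :: "('g, 'b) ring_scheme" and \<iota> :: "'k::field \<Rightarrow> 'r"
  assumes bij: "bij_betw h (carrier R) (carrier G)"
    and cl: "\<And>a b. \<lbrakk>a \<in> carrier R; b \<in> carrier R\<rbrakk> \<Longrightarrow> a \<otimes>\<^bsub>R\<^esub> b \<in> carrier R"
      "\<And>a b. \<lbrakk>a \<in> carrier R; b \<in> carrier R\<rbrakk> \<Longrightarrow> a \<oplus>\<^bsub>R\<^esub> b \<in> carrier R"
      "\<one>\<^bsub>R\<^esub> \<in> carrier R" "\<zero>\<^bsub>R\<^esub> \<in> carrier R" "\<And>c. \<iota> c \<in> carrier R" "\<And>d. X d \<subseteq> carrier R" "\<And>d. Y d \<subseteq> carrier G"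
    and hom: "\<And>a b. \<lbrakk>a \<in> carrier R; b \<in> carrier R\<rbrakk> \<Longrightarrow> h (a \<otimes>\<^bsub>R\<^esub> b) = h a \<otimes>\<^bsub>G\<^esub> h b"
      "\<And>a b. \<lbrakk>a \<in> carrier R; b \<in> carrier R\<rbrakk> \<Longrightarrow> h (a \<oplus>\<^bsub>R\<^esub> b) = h a \<oplus>\<^bsub>G\<^esub> h b"
      "h \<one>\<^bsub>R\<^esub> = \<one>\<^bsub>G\<^esub>" "h \<zero>\<^bsub>R\<^esub> = \<zero>\<^bsub>G\<^esub>" "\<And>c. h (\<iota> c) = \<kappa> c"
      "\<And>a d. a \<in> carrier R \<Longrightarrow> h a \<in> Y d \<longleftrightarrow> a \<in> X d"
  shows "graded_complete_intersection \<kappa> G Y \<longleftrightarrow> graded_complete_intersection \<iota> R X"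
proof
  have hR: "h a \<in> carrier G" if "a \<in> carrier R" for a using bij that by (auto simp: bij_betw_def)
  have hinj: "a = b" if "a \<in> carrier R" "b \<in> carrier R" "h a = h b" for a b
    using bij that by (auto simp: bij_betw_def inj_on_def)
  define k where "k = inv_into (carrier R) h"
  have hk: "h (k x) = x" "k x \<in> carrier R" if "x \<in> carrier G" for x
    using that bij unfolding k_def bij_betw_def by (auto simp: f_inv_into_f inv_into_into)
  have kh: "k (h a) = a" if "a \<in> carrier R" for a
    using that bij unfolding k_def bij_betw_def by simp
  {
    assume "graded_complete_intersection \<iota> R X"
    then obtain n \<phi> fs where *: "\<phi> \<in> ring_hom (mpoly_ring n :: 'k mpoly ring) R"
        "\<forall>c. \<phi> (mpoly_const c) = \<iota> c"
        "\<forall>d. \<forall>p\<in>carrier (mpoly_ring n). homogeneous_mpoly d p \<longrightarrow> \<phi> p \<in> X d"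
        "\<phi> ` carrier (mpoly_ring n) = carrier R" "regular_sequence (mpoly_ring n) fs"
        "\<forall>f\<in>set fs. \<exists>d. homogeneous_mpoly d f" "a_kernel (mpoly_ring n) R \<phi> = Idl\<^bsub>mpoly_ring n\<^esub> (set fs)"
      unfolding graded_complete_intersection_def by blast
    have \<phi>: "\<phi> p \<in> carrier R" if "p \<in> carrier (mpoly_ring n)" for p using *(4) that by blast
    have "h \<circ> \<phi> \<in> ring_hom (mpoly_ring n) G"
      using *(1) \<phi> by (auto simp: ring_hom_def hom hR)
    moreover have "\<forall>c. (h \<circ> \<phi>) (mpoly_const c) = \<kappa> c" using * hom by simp
    moreover have "\<forall>d. \<forall>p\<in>carrier (mpoly_ring n). homogeneous_mpoly d p \<longrightarrow> (h \<circ> \<phi>) p \<in> Y d"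
      using *(3) \<phi> hom(6) by simp
    moreover have "(h \<circ> \<phi>) ` carrier (mpoly_ring n) = carrier G"
      unfolding image_comp[symmetric] *(4) using bij by (simp add: bij_betw_def)
    moreover have "h (\<phi> p) = \<zero>\<^bsub>G\<^esub> \<longleftrightarrow> \<phi> p = \<zero>\<^bsub>R\<^esub>" if "p \<in> carrier (mpoly_ring n)" for p
      using hinj[OF \<phi>[OF that] cl(4)] hom(4) by metis
    hence "a_kernel (mpoly_ring n) G (h \<circ> \<phi>) = a_kernel (mpoly_ring n) R \<phi>"
      unfolding a_kernel_def' comp_apply by blast
    hence "a_kernel (mpoly_ring n) G (h \<circ> \<phi>) = Idl\<^bsub>mpoly_ring n\<^esub> (set fs)"
      unfolding *(7)[symmetric] .
    ultimately show "graded_complete_intersection \<kappa> G Y"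
      unfolding graded_complete_intersection_def using *(5,6) by blast
  }
  {
    assume "graded_complete_intersection \<kappa> G Y"
    then obtain n \<phi> fs where *: "\<phi> \<in> ring_hom (mpoly_ring n :: 'k mpoly ring) G"
        "\<forall>c. \<phi> (mpoly_const c) = \<kappa> c"
        "\<forall>d. \<forall>p\<in>carrier (mpoly_ring n). homogeneous_mpoly d p \<longrightarrow> \<phi> p \<in> Y d"
        "\<phi> ` carrier (mpoly_ring n) = carrier G" "regular_sequence (mpoly_ring n) fs"
        "\<forall>f\<in>set fs. \<exists>d. homogeneous_mpoly d f" "a_kernel (mpoly_ring n) G \<phi> = Idl\<^bsub>mpoly_ring n\<^esub> (set fs)"
      unfolding graded_complete_intersection_def by blast
    have \<phi>: "\<phi> p \<in> carrier G" if "p \<in> carrier (mpoly_ring n)" for p using *(4) that by blast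
    have km: "k (x \<otimes>\<^bsub>G\<^esub> y) = k x \<otimes>\<^bsub>R\<^esub> k y" if "x \<in> carrier G" "y \<in> carrier G" for x y
      using kh[OF cl(1)[OF hk(2)[OF that(1)] hk(2)[OF that(2)]]] hk that by (simp add: hom)
    have ka: "k (x \<oplus>\<^bsub>G\<^esub> y) = k x \<oplus>\<^bsub>R\<^esub> k y" if "x \<in> carrier G" "y \<in> carrier G" for x y
      using kh[OF cl(2)[OF hk(2)[OF that(1)] hk(2)[OF that(2)]]] hk that by (simp add: hom)
    have k1: "k \<one>\<^bsub>G\<^esub> = \<one>\<^bsub>R\<^esub>" "k \<zero>\<^bsub>G\<^esub> = \<zero>\<^bsub>R\<^esub>" "k (\<kappa> c) = \<iota> c" for c
      using kh cl hom by metis+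
    have "k \<circ> \<phi> \<in> ring_hom (mpoly_ring n) R"
      using *(1) \<phi> by (auto simp: ring_hom_def hk km ka k1)
    moreover have "\<forall>c. (k \<circ> \<phi>) (mpoly_const c) = \<iota> c" using * k1 by simp
    moreover have "\<forall>d. \<forall>p\<in>carrier (mpoly_ring n). homogeneous_mpoly d p \<longrightarrow> (k \<circ> \<phi>) p \<in> X d"
      using *(3) \<phi> hom(6)[OF hk(2)] hk by simp
    moreover have "(k \<circ> \<phi>) ` carrier (mpoly_ring n) = carrier R"
      unfolding image_comp[symmetric] *(4) using bij_betw_inv_into[OF bij]
      by (simp add: bij_betw_def k_def)
    moreover have "k (\<phi> p) = \<zero>\<^bsub>R\<^esub> \<longleftrightarrow> \<phi> p = \<zero>\<^bsub>G\<^esub>" if "p \<in> carrier (mpoly_ring n)" for p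
      using hk(1)[OF \<phi>[OF that]] hom(4) k1(2) by metis
    hence "a_kernel (mpoly_ring n) R (k \<circ> \<phi>) = a_kernel (mpoly_ring n) G \<phi>"
      unfolding a_kernel_def' comp_apply by blast
    hence "a_kernel (mpoly_ring n) R (k \<circ> \<phi>) = Idl\<^bsub>mpoly_ring n\<^esub> (set fs)"
      unfolding *(7)[symmetric] .
    ultimately show "graded_complete_intersection \<iota> R X"
      unfolding graded_complete_intersection_def using *(5,6) by blast
  }
qed

context num_semigroup
begin

text \<open>Elements with equal residue differ by a multiple of \<open>mu\<close>, and each
  \<open>mu\<close> raises the order. Hence at most \<open>mu\<close> elements share an order, which
  bounds the Hilbert function.\<close>

lemma ord_neq_residue:
  assumes "u \<in> U" "u' \<in> U" "u mod mu = u' mod mu" "u < u'" shows "ord u < ord u'"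
proof -
  obtain k where k: "u' = u + k * mu"
    using assms(3,4)
      by (metis add.commute less_imp_le mod_eq_iff_dvd_symdiff_nat dvd_def le_add_diff_inverse mod_eq_dvd_iff_nat mult.commute)
  have "ord u + ord (k * mu) \<le> ord u'" unfolding k using assms(1) mult_in by (intro ord_add) auto
  moreover have "k > 0" using k assms(4) by (cases k) auto
  ultimately show ?thesis by (simp add: ord_mult_mu)
qed

lemma inj_mod_ord: "inj_on (\<lambda>u. u mod mu) {u \<in> U. ord u = d}"
proof (rule inj_onI)
  fix x y assume *: "x \<in> {u \<in> U. ord u = d}" "y \<in> {u \<in> U. ord u = d}" "x mod mu = y mod mu"
  show "x = y"
    using ord_neq_residue[of x y] ord_neq_residue[of y x] * by (cases x y rule: linorder_cases) auto
qed

lemma finite_ord [simp]: "finite {u \<in> U. ord u = d}" and card_ord_le: "card {u \<in> U. ord u = d} \<le> mu"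
proof -
  have sub: "(\<lambda>u. u mod mu) ` {u \<in> U. ord u = d} \<subseteq> {..<mu}" using mu_pos by auto
  thus "finite {u \<in> U. ord u = d}" using inj_mod_ord
    by (meson finite_imageD finite_lessThan finite_subset)
  show "card {u \<in> U. ord u = d} \<le> mu"
    using card_inj_on_le[OF inj_mod_ord sub] by simp
qed

section \<open>Powers of the maximal ideal\<close>

lemma gen_summand: "\<lbrakk>x \<in> U; x \<noteq> 0\<rbrakk> \<Longrightarrow> \<exists>g\<in>gens. \<exists>y\<in>U. x = g + y"
proof (induction x rule: less_induct)
  case (less x)
  show ?case
  proof (cases "x \<in> gens")
    case True thus ?thesis by (intro bexI[of _ x] bexI[of _ 0]) auto
  next
    case False
    then obtain y z where yz: "y \<in> U" "z \<in> U" "y \<noteq> 0" "z \<noteq> 0" "x = y + z"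
      using less.prems by (auto simp: minimal_generators_def)
    then obtain g w where "g \<in> gens" "w \<in> U" "y = g + w" using less.IH[of y] by auto
    thus ?thesis using yz add_in[of w z] by (auto simp: add.assoc)
  qed
qed

lemma fold_sum_Suc_gen:
  assumes "u \<in> fold_sum U (Suc i)"
  shows "\<exists>g\<in>gens. g \<le> u \<and> u - g \<in> fold_sum U i"
proof -
  obtain x y where xy: "u = x + y" "x \<in> U" "x \<noteq> 0" "y \<in> fold_sum U i" using assms by auto
  obtain g z where gz: "g \<in> gens" "z \<in> U" "x = g + z" using gen_summand[OF xy(2,3)] by blast
  have y: "y \<in> U" "i \<le> ord y" using xy(4) by (simp_all add: in_fold_sum_iff)
  hence "z + y \<in> U" "i \<le> ord (z + y)" using gz(2) add_in ord_add[of z y] by auto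
  thus ?thesis using gz xy by (intro bexI[of _ g]) (auto simp: in_fold_sum_iff)
qed

declare fold_sum.simps(2) [simp del]

lemma fold_sum_mult_in: "\<lbrakk>u \<in> fold_sum U i; v \<in> fold_sum U j\<rbrakk> \<Longrightarrow> u + v \<in> fold_sum U (i + j)"
  using ord_add[of u v] add_in by (auto simp: in_fold_sum_iff)

text \<open>The filtration by order; \<open>ideal_power_eq\<close> identifies it with the powers of
  the maximal ideal. Being defined by coefficients, it can be handled without sums of
  products.\<close>

definition filt :: "nat \<Rightarrow> 'k::field fps set" where
  "filt i = {f. \<forall>n. fps_nth f n \<noteq> 0 \<longrightarrow> n \<in> fold_sum U i}"

lemma filt_mult:
  assumes "f \<in> filt i" "g \<in> filt j" shows "f * g \<in> filt (i + j)"
  unfolding filt_def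
proof (intro CollectI allI impI)
  fix n assume "fps_nth (f * g) n \<noteq> 0"
  then obtain a where a: "a \<le> n" "fps_nth f a * fps_nth g (n - a) \<noteq> 0"
    unfolding fps_mult_nth by (meson atLeastAtMost_iff sum.not_neutral_contains_not_neutral)
  hence "a + (n - a) \<in> fold_sum U (i + j)"
    using assms by (intro fold_sum_mult_in) (auto simp: filt_def)
  thus "n \<in> fold_sum U (i + j)" using a by simp
qed

lemma filt_add: "\<lbrakk>f \<in> filt i; g \<in> filt i\<rbrakk> \<Longrightarrow> f + g \<in> filt i"
  and filt_diff: "\<lbrakk>f \<in> filt i; g \<in> filt i\<rbrakk> \<Longrightarrow> f - g \<in> filt i"
  and filt_0 [simp]: "0 \<in> filt i" and filt_uminus: "f \<in> filt i \<Longrightarrow> - f \<in> filt i"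
  by (auto simp: filt_def) (metis add.right_neutral, metis diff_0_right diff_self right_minus_eq)

lemma filt_sum: "(\<And>x. x \<in> A \<Longrightarrow> f x \<in> filt i) \<Longrightarrow> sum f A \<in> filt i"
  by (induction A rule: infinite_finite_induct) (auto intro: filt_add)

lemma filt_mono: "i \<le> j \<Longrightarrow> filt j \<subseteq> filt i"
  by (auto simp: filt_def in_fold_sum_iff)

lemma filt_in: "f \<in> filt i \<Longrightarrow> f \<in> filt 0"
  using filt_mono[of 0 i] by auto

lemma sub_cring_semigroup_ring: "sub_cring (semigroup_ring U :: 'k::field fps ring) (filt 0)"
proof
  fix x y :: "'k fps" assume "x \<in> filt 0" "y \<in> filt 0"
  thus "x * y \<in> filt 0" using filt_mult[of x 0 y 0] by simp
  show "x + y \<in> filt 0" using \<open>x \<in> filt 0\<close> \<open>y \<in> filt 0\<close> by (rule filt_add)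
qed (auto simp: semigroup_ring_def filt_uminus, auto simp: filt_def split: if_splits)

interpretation SR: sub_cring "semigroup_ring U :: 'k::field fps ring" "filt 0"
  by (rule sub_cring_semigroup_ring)

text \<open>The series may have infinitely many terms, but there are only finitely many generators:
  each exponent \<open>u\<close> is assigned one generator \<open>c u\<close>, and the terms are
  grouped by it. So finite sums of products suffice for the powers of the maximal ideal.\<close>

lemma filt_Suc_decompose:
  assumes f: "f \<in> filt (Suc i)"
  obtains h where "\<And>g. h g \<in> filt i" "f = (\<Sum>g\<in>gens. fps_X ^ g * h g)"
proof
  define c where "c u = (SOME g. g \<in> gens \<and> g \<le> u \<and> u - g \<in> fold_sum U i)" for u
  have c: "c u \<in> gens" "c u \<le> u" "u - c u \<in> fold_sum U i" if "u \<in> fold_sum U (Suc i)" for u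
    using someI_ex[of "\<lambda>g. g \<in> gens \<and> g \<le> u \<and> u - g \<in> fold_sum U i"] fold_sum_Suc_gen[OF that]
    unfolding c_def by blast+
  \<comment> \<open>The condition \<open>c (v + g) = g\<close> puts each term of \<open>f\<close>
    into exactly one summand.\<close>
  define h where "h g = Abs_fps (\<lambda>v. if v \<in> fold_sum U i \<and> c (v + g) = g then fps_nth f (v + g) else 0)" for g
  show "h g \<in> filt i" for g by (auto simp: h_def filt_def)
  show "f = (\<Sum>g\<in>gens. fps_X ^ g * h g)"
  proof (rule fps_ext)
    fix u
    have "fps_nth (\<Sum>g\<in>gens. fps_X ^ g * h g) u =
      (\<Sum>g\<in>gens. if g = c u \<and> u \<in> fold_sum U (Suc i) then fps_nth f u else 0)"
      unfolding fps_sum_nth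
    proof (rule sum.cong)
      fix g assume g: "g \<in> gens"
      show "fps_nth (fps_X ^ g * h g) u = (if g = c u \<and> u \<in> fold_sum U (Suc i) then fps_nth f u else 0)"
      proof (cases "u \<in> fold_sum U (Suc i)")
        case True
        thus ?thesis using c[OF True] by (auto simp: fps_X_power_mult_nth h_def)
      next
        case False
        hence "fps_nth f u = 0" using f unfolding filt_def by blast
        thus ?thesis using False by (auto simp: fps_X_power_mult_nth h_def)
      qed
    qed simp
    also have "\<dots> = fps_nth f u"
      using c(1)[of u] f by (cases "u \<in> fold_sum U (Suc i)") (auto simp: filt_def)
    finally show "fps_nth f u = fps_nth (\<Sum>g\<in>gens. fps_X ^ g * h g) u" by simp
  qed
qed

lemma in_fold_sum_1: "u \<in> fold_sum U (Suc 0) \<longleftrightarrow> u \<in> U \<and> u \<noteq> 0"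
  using ord_pos[of u] unfolding in_fold_sum_iff by (cases "u = 0") auto

lemma fps_X_power_in_filt: "u \<in> fold_sum U i \<Longrightarrow> fps_X ^ u \<in> filt i"
  by (auto simp: filt_def)

lemma max_ideal_eq: "semigroup_ring_max U = (filt (Suc 0) :: 'k::field fps set)"
proof
  let ?F = "{fps_X ^ s | s. s \<in> U \<and> s \<noteq> 0} :: 'k fps set"
  have F: "?F \<subseteq> filt (Suc 0)" using fps_X_power_in_filt[of _ "Suc 0"] in_fold_sum_1 by auto
  have F0: "?F \<subseteq> filt 0" using F filt_in by blast
  have "SR.is_ideal (filt (Suc 0) :: 'k fps set)"
    unfolding SR.is_ideal_def using filt_in filt_add filt_mult[of _ 0 _ "Suc 0"] by auto
  thus "semigroup_ring_max U \<subseteq> (filt (Suc 0) :: 'k fps set)"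
    unfolding semigroup_ring_max_def using F by (rule SR.genideal_least)
  note I = SR.is_ideal_genideal[OF F0]
  show "filt (Suc 0) \<subseteq> (semigroup_ring_max U :: 'k fps set)"
  proof
    fix f :: "'k fps" assume "f \<in> filt (Suc 0)"
    then obtain h where h: "\<And>g. h g \<in> filt 0" "f = (\<Sum>g\<in>gens. fps_X ^ g * h g)"
      by (rule filt_Suc_decompose) blast
    have "h g * fps_X ^ g \<in> Idl\<^bsub>semigroup_ring U\<^esub> ?F" if "g \<in> gens" for g
    proof (rule SR.is_idealD(5)[OF I h(1)])
      have "g \<in> U" "g \<noteq> 0" using gens_subset[OF that] gens_pos[OF that] by auto
      thus "fps_X ^ g \<in> Idl\<^bsub>semigroup_ring U\<^esub> ?F" using SR.genideal_superset[OF F0] by blast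
    qed
    thus "f \<in> semigroup_ring_max U"
      unfolding h(2) semigroup_ring_max_def
        by (intro SR.is_ideal_sum[OF I]) (simp add: mult.commute)
  qed
qed

lemma ideal_power_eq:
  "ideal_power (semigroup_ring U) (semigroup_ring_max U) i = (filt i :: 'k::field fps set)"
proof (induction i)
  case 0 show ?case by simp
next
  case (Suc i)
  let ?A = "semigroup_ring U :: 'k fps ring"
  have "ideal_prod ?A (filt (Suc 0)) (filt i) = filt (Suc i)"
  proof
    show "ideal_prod ?A (filt (Suc 0)) (filt i) \<subseteq> filt (Suc i)"
    proof
      fix f assume "f \<in> ideal_prod ?A (filt (Suc 0)) (filt i)"
      thus "f \<in> filt (Suc i)"
        by induction (use filt_mult[of _ "Suc 0" _ i] filt_add in auto)
    qed
    show "filt (Suc i) \<subseteq> ideal_prod ?A (filt (Suc 0)) (filt i)"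
    proof
      fix f :: "'k fps" assume "f \<in> filt (Suc i)"
      then obtain h where h: "\<And>g. h g \<in> filt i" "f = (\<Sum>g\<in>gens. fps_X ^ g * h g)"
        by (rule filt_Suc_decompose) blast
      have 1: "fps_X ^ g * a \<in> ideal_prod ?A (filt (Suc 0)) (filt i)"
        if "g \<in> gens" "a \<in> filt i" for g a
      proof -
        have "fps_X ^ g \<in> (filt (Suc 0) :: 'k fps set)"
          using that gens_subset gens_pos by (intro fps_X_power_in_filt) (force simp: in_fold_sum_1)
        thus ?thesis using ideal_prod.prod[of "fps_X ^ g" "filt (Suc 0)" a "filt i" ?A] that by simp
      qed
      have "sum (\<lambda>g. fps_X ^ g * h g) B \<in> ideal_prod ?A (filt (Suc 0)) (filt i)"
        if "finite B" "B \<subseteq> gens" for B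
        using that
      proof (induction B rule: finite_induct)
        case empty
        thus ?case using 1[OF mu_gens filt_0] by simp
      next
        case (insert x B)
        thus ?case
          using ideal_prod.sum[of "fps_X ^ x * h x" ?A "filt (Suc 0)" "filt i" "\<Sum>g\<in>B. fps_X ^ g * h g"] 1[OF _ h(1)]
          by simp
      qed
      thus "f \<in> ideal_prod ?A (filt (Suc 0)) (filt i)" unfolding h(2) by simp
    qed
  qed
  thus ?case using Suc by (simp add: max_ideal_eq)
qed

section \<open>A model of the associated graded ring with a basis indexed by the semigroup\<close>

definition gr_carrier :: "'k::field fps set" where
  "gr_carrier = {a. finite {u. fps_nth a u \<noteq> 0} \<and> (\<forall>u. fps_nth a u \<noteq> 0 \<longrightarrow> u \<in> U)}"

text \<open>The class of \<open>t\<^sup>u\<close> sits in degree \<open>ord u\<close>, and the product of the classes of \<open>t\<^sup>v\<close> and \<open>t\<^sup>w\<close>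
  vanishes unless the orders add up.\<close>

definition gr_mult :: "'k::field fps \<Rightarrow> 'k fps \<Rightarrow> 'k fps" where
  "gr_mult a b = Abs_fps (\<lambda>u. \<Sum>v\<le>u. if ord v + ord (u - v) = ord u
     then fps_nth a v * fps_nth b (u - v) else 0)"

text \<open>Power series serve only as finitely supported families of coefficients: the one at
  \<open>u\<close> belongs to the class of t^u in degree \<open>ord u\<close>. As each degree
  contains finitely many \<open>u\<close>, finite support in \<open>U\<close> matches finitely many
  nonzero degrees.\<close>

definition gr_ring :: "'k::field fps ring" where
  "gr_ring = \<lparr>carrier = gr_carrier, monoid.mult = gr_mult, one = 1, zero = 0, add = (+)\<rparr>"

definition gr_comp :: "nat \<Rightarrow> 'k::field fps set" where
  "gr_comp d = {a \<in> gr_carrier. \<forall>u. fps_nth a u \<noteq> 0 \<longrightarrow> ord u = d}"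

definition to_cosets :: "'k::field fps \<Rightarrow> nat \<Rightarrow> 'k fps set" where
  "to_cosets a i = {f \<in> filt i. \<forall>u\<in>U. ord u = i \<longrightarrow> fps_nth f u = fps_nth a u}"

abbreviation A\<^sub>U :: "'k::field fps ring" where "A\<^sub>U \<equiv> semigroup_ring U"
abbreviation G\<^sub>U :: "(nat \<Rightarrow> 'k::field fps set) ring" where
  "G\<^sub>U \<equiv> assoc_graded (semigroup_ring U) (semigroup_ring_max U)"

text \<open>An exponent in \<open>fold_sum U i\<close> that is not of order \<open>i\<close> lies in
  \<open>fold_sum U (Suc i)\<close>, so a coset remembers just the coefficients at exponents of
  order \<open>i\<close>.\<close>

lemma coset_eq:
  assumes f: "f \<in> filt i"
  shows "filt (Suc i) +>\<^bsub>A\<^sub>U\<^esub> f = {g \<in> filt i. \<forall>u\<in>U. ord u = i \<longrightarrow> fps_nth g u = fps_nth f u}"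
proof (intro equalityI subsetI)
  fix g assume "g \<in> filt (Suc i) +>\<^bsub>A\<^sub>U\<^esub> f"
  then obtain h where h: "h \<in> filt (Suc i)" "g = h + f" by (auto simp: a_r_coset_def')
  have "fps_nth h u = 0" if "ord u = i" for u
    using h(1) that by (force simp: filt_def in_fold_sum_iff)
  moreover have "g \<in> filt i" using h f filt_add filt_mono[of i "Suc i"] by auto
  ultimately show "g \<in> {g \<in> filt i. \<forall>u\<in>U. ord u = i \<longrightarrow> fps_nth g u = fps_nth f u}" using h by simp
next
  fix g assume g: "g \<in> {g \<in> filt i. \<forall>u\<in>U. ord u = i \<longrightarrow> fps_nth g u = fps_nth f u}"
  have "g - f \<in> filt (Suc i)" unfolding filt_def
  proof (intro CollectI allI impI)
    fix u assume u: "fps_nth (g - f) u \<noteq> 0"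
    have "g - f \<in> filt i" using g f filt_diff by auto
    hence "u \<in> fold_sum U i" using u unfolding filt_def by blast
    moreover have "\<not> (u \<in> U \<and> ord u = i)" using u g by auto
    ultimately show "u \<in> fold_sum U (Suc i)" by (auto simp: in_fold_sum_iff)
  qed
  moreover have "g = (g - f) + f" by simp
  ultimately have "\<exists>h\<in>filt (Suc i). g = h + f" by blast
  thus "g \<in> filt (Suc i) +>\<^bsub>A\<^sub>U\<^esub> f" by (simp add: a_r_coset_def')
qed

definition part :: "'k::field fps \<Rightarrow> nat \<Rightarrow> 'k fps" where
  "part a i = Abs_fps (\<lambda>u. if u \<in> U \<and> ord u = i then fps_nth a u else 0)"

lemma part_filt: "part a i \<in> filt i" and part_in: "part a i \<in> to_cosets a i"
proof -
  show "part a i \<in> filt i" by (auto simp: part_def filt_def in_fold_sum_iff)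
  thus "part a i \<in> to_cosets a i" by (auto simp: to_cosets_def part_def)
qed

lemma to_cosets_coset: "to_cosets a i = filt (Suc i) +>\<^bsub>A\<^sub>U\<^esub> part a i"
  unfolding coset_eq[OF part_filt] by (auto simp: to_cosets_def part_def)

lemma to_cosets_zero:
  fixes a :: "'k::field fps"
  assumes a: "\<And>u. u \<in> U \<Longrightarrow> ord u = i \<Longrightarrow> fps_nth a u = 0"
  shows "to_cosets a i = filt (Suc i)"
proof (intro equalityI subsetI)
  fix f :: "'k fps"
  {
    assume f: "f \<in> to_cosets a i"
    show "f \<in> filt (Suc i)" unfolding filt_def
    proof (intro CollectI allI impI)
      fix u assume u: "fps_nth f u \<noteq> 0"
      hence "u \<in> fold_sum U i" using f unfolding to_cosets_def filt_def by blast
      moreover have "\<not> (u \<in> U \<and> ord u = i)" using u f a by (auto simp: to_cosets_def)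
      ultimately show "u \<in> fold_sum U (Suc i)" by (auto simp: in_fold_sum_iff)
    qed
  }
  assume f: "f \<in> filt (Suc i)"
  have "fps_nth f u = 0" if "ord u = i" for u
    using f that by (force simp: filt_def in_fold_sum_iff)
  thus "f \<in> to_cosets a i" using f a filt_mono[of i "Suc i"] by (auto simp: to_cosets_def)
qed

lemma to_cosets_nonzero:
  assumes "u \<in> U" "fps_nth a u \<noteq> 0" shows "to_cosets a (ord u) \<noteq> filt (Suc (ord u))"
proof
  assume "to_cosets a (ord u) = filt (Suc (ord u))"
  hence "part a (ord u) \<in> filt (Suc (ord u))" using part_in by blast
  moreover have "fps_nth (part a (ord u)) u \<noteq> 0" using assms by (simp add: part_def)
  ultimately show False by (auto simp: filt_def in_fold_sum_iff)
qed

lemma inj_to_cosets: "inj_on to_cosets (gr_carrier :: 'k::field fps set)"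
proof (rule inj_onI, rule fps_ext)
  fix a b :: "'k fps" and u
  assume ab: "a \<in> gr_carrier" "b \<in> gr_carrier" "to_cosets a = to_cosets b"
  show "fps_nth a u = fps_nth b u"
  proof (cases "u \<in> U")
    case True
    have "part a (ord u) \<in> to_cosets b (ord u)" using part_in ab(3) by metis
    thus ?thesis using True by (auto simp: to_cosets_def part_def)
  next
    case False
    hence "fps_nth a u = 0" "fps_nth b u = 0" using ab unfolding gr_carrier_def by blast+
    thus ?thesis by simp
  qed
qed

lemma assoc_graded_carrier:
  "x \<in> carrier (G\<^sub>U :: (nat \<Rightarrow> 'k::field fps set) ring) \<longleftrightarrow>
    (\<forall>i. \<exists>f\<in>filt i. x i = filt (Suc i) +>\<^bsub>A\<^sub>U\<^esub> f) \<and> finite {i. x i \<noteq> filt (Suc i)}"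
  unfolding assoc_graded_def ideal_power_eq by simp

lemma to_cosets_carrier: assumes "a \<in> gr_carrier" shows "to_cosets a \<in> carrier G\<^sub>U"
proof -
  have "{i. to_cosets a i \<noteq> filt (Suc i)} \<subseteq> ord ` {u. fps_nth a u \<noteq> 0}"
  proof clarify
    fix i assume "to_cosets a i \<noteq> filt (Suc i)"
    then obtain u where "u \<in> U" "ord u = i" "fps_nth a u \<noteq> 0" using to_cosets_zero[of i a] by blast
    thus "i \<in> ord ` {u. fps_nth a u \<noteq> 0}" by auto
  qed
  moreover have "finite {u. fps_nth a u \<noteq> 0}" using assms by (simp add: gr_carrier_def)
  ultimately show ?thesis unfolding assoc_graded_carrier
    using to_cosets_coset part_filt finite_surj by (metis (no_types, lifting))
qed

lemma carrier_image: "to_cosets ` gr_carrier = carrier G\<^sub>U"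
proof (intro equalityI subsetI)
  fix x :: "nat \<Rightarrow> 'k::field fps set" assume x: "x \<in> carrier G\<^sub>U"
  then obtain f where f: "\<And>i. f i \<in> filt i" "\<And>i. x i = filt (Suc i) +>\<^bsub>A\<^sub>U\<^esub> f i"
    unfolding assoc_graded_carrier by metis
  have fin: "finite {i. x i \<noteq> filt (Suc i)}" using x assoc_graded_carrier by blast
  define a where "a = Abs_fps (\<lambda>u. if u \<in> U then fps_nth (f (ord u)) u else 0)"
  have xa: "x = to_cosets a"
  proof
    fix i show "x i = to_cosets a i" unfolding f(2) coset_eq[OF f(1)] to_cosets_def
      by (auto simp: a_def)
  qed
  have "{u. fps_nth a u \<noteq> 0} \<subseteq> (\<Union>d\<in>{i. x i \<noteq> filt (Suc i)}. {u \<in> U. ord u = d})"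
    using to_cosets_nonzero[of _ a] unfolding xa by (auto simp: a_def split: if_splits)
  hence "finite {u. fps_nth a u \<noteq> 0}" by (rule finite_subset) (simp add: fin)
  hence "a \<in> gr_carrier" by (auto simp: gr_carrier_def a_def)
  thus "x \<in> to_cosets ` gr_carrier" using xa by blast
qed (use to_cosets_carrier in auto)

lemma ord_less_imp_coef_zero: "\<lbrakk>f \<in> filt i; ord u < i\<rbrakk> \<Longrightarrow> fps_nth f u = 0"
  by (force simp: filt_def in_fold_sum_iff)

text \<open>Every choice of representatives gives the same coset (\<open>key\<close>), so the union
  in the definition of the product collapses.\<close>

lemma to_cosets_mult:
  fixes a b :: "'k::field fps"
  assumes "a \<in> gr_carrier" "b \<in> gr_carrier"
  shows "to_cosets (gr_mult a b) = to_cosets a \<otimes>\<^bsub>G\<^sub>U\<^esub> to_cosets b"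
proof
  fix n
  have supp: "fps_nth a u = 0" "fps_nth b u = 0" if "u \<notin> U" for u using assms that
    by (auto simp: gr_carrier_def)
  have key: "filt (Suc n) +>\<^bsub>A\<^sub>U\<^esub> (\<Oplus>\<^bsub>A\<^sub>U\<^esub>i\<in>{..n}. f i \<otimes>\<^bsub>A\<^sub>U\<^esub> g (n - i)) = to_cosets (gr_mult a b) n"
    if f: "\<forall>i\<le>n. f i \<in> to_cosets a i" and g: "\<forall>i\<le>n. g i \<in> to_cosets b i" for f g
  proof -
    have ff: "f i \<in> filt i" "g i \<in> filt i" if "i \<le> n" for i using f g that
      by (auto simp: to_cosets_def)
    have prod: "f i * g (n - i) \<in> filt n" if "i \<le> n" for i
      using filt_mult[OF ff(1)[OF that] ff(2)[of "n - i"]] that by simp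
    have sum: "(\<Oplus>\<^bsub>A\<^sub>U\<^esub>i\<in>{..n}. f i \<otimes>\<^bsub>A\<^sub>U\<^esub> g (n - i)) = (\<Sum>i\<le>n. f i * g (n - i))"
      using prod filt_in by (subst SR.finsum_R) auto
    have sumn: "(\<Sum>i\<le>n. f i * g (n - i)) \<in> filt n" using prod by (intro filt_sum) auto
    have "fps_nth (\<Sum>i\<le>n. f i * g (n - i)) u = fps_nth (gr_mult a b) u"
      if u: "u \<in> U" "ord u = n" for u
    proof -
      have "fps_nth (\<Sum>i\<le>n. f i * g (n - i)) u = (\<Sum>i\<le>n. \<Sum>v\<le>u. fps_nth (f i) v * fps_nth (g (n - i)) (u - v))"
        by (simp add: fps_sum_nth fps_mult_nth atLeast0AtMost)
      also have "\<dots> = (\<Sum>v\<le>u. \<Sum>i\<le>n. fps_nth (f i) v * fps_nth (g (n - i)) (u - v))"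
        by (rule sum.swap)
      also have "\<dots> = (\<Sum>v\<le>u. if ord v + ord (u - v) = ord u then fps_nth a v * fps_nth b (u - v) else 0)"
      proof (rule sum.cong)
        fix v assume v: "v \<in> {..u}"
        \<comment> \<open>An element of \<open>filt i\<close> has no terms of order below
          \<open>i\<close>, and \<open>ord v + ord (u - v) \<le> n\<close>. So a term survives only
          if the orders are exactly \<open>i\<close> and \<open>n - i\<close>, where representatives
          have the coefficients of \<open>a\<close> and \<open>b\<close>.\<close>
        have tm: "fps_nth (f i) v * fps_nth (g (n - i)) (u - v) =
           (if i = ord v \<and> ord v + ord (u - v) = n then fps_nth a v * fps_nth b (u - v) else 0)"
          if i: "i \<le> n" for i
        proof (cases "v \<in> U \<and> u - v \<in> U")
          case False
          have "fps_nth (f i) v = 0 \<or> fps_nth (g (n - i)) (u - v) = 0"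
            using False ff[of i] ff[of "n - i"] i by (auto simp: filt_def in_fold_sum_iff)
          moreover have "fps_nth a v = 0 \<or> fps_nth b (u - v) = 0" using False supp by auto
          ultimately show ?thesis by auto
        next
          case True
          have le: "ord v + ord (u - v) \<le> n" using ord_add[of v "u - v"] True v u by simp
          consider "ord v < i" | "ord (u - v) < n - i" | "ord v = i" "ord (u - v) = n - i"
            using le i by linarith
          thus ?thesis
          proof cases
            case 1 thus ?thesis using ord_less_imp_coef_zero[OF ff(1)[OF i]] by auto
          next
            case 2 thus ?thesis using ord_less_imp_coef_zero[OF ff(2)[of "n - i"]] i by auto
          next
            case 3
            have "fps_nth (f i) v = fps_nth a v" using f i True 3 by (auto simp: to_cosets_def)
            moreover have "fps_nth (g (n - i)) (u - v) = fps_nth b (u - v)"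
              using g True 3 by (auto simp: to_cosets_def)
            ultimately show ?thesis using 3 i by simp
          qed
        qed
        have "(\<Sum>i\<le>n. fps_nth (f i) v * fps_nth (g (n - i)) (u - v)) =
          (\<Sum>i\<le>n. if i = ord v \<and> ord v + ord (u - v) = n then fps_nth a v * fps_nth b (u - v) else 0)"
          by (rule sum.cong) (use tm in auto)
        also have "\<dots> = (if ord v + ord (u - v) = ord u then fps_nth a v * fps_nth b (u - v) else 0)"
          using u by (cases "ord v + ord (u - v) = n") auto
        finally show "(\<Sum>i\<le>n. fps_nth (f i) v * fps_nth (g (n - i)) (u - v)) =
          (if ord v + ord (u - v) = ord u then fps_nth a v * fps_nth b (u - v) else 0)" .
      qed simp
      finally show ?thesis by (simp add: gr_mult_def)
    qed
    thus ?thesis unfolding sum coset_eq[OF sumn] to_cosets_def by auto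
  qed
  have "(to_cosets a \<otimes>\<^bsub>G\<^sub>U\<^esub> to_cosets b) n = (\<Union>f\<in>{f. \<forall>i\<le>n. f i \<in> to_cosets a i}. \<Union>g\<in>{g. \<forall>i\<le>n. g i \<in> to_cosets b i}.
     filt (Suc n) +>\<^bsub>A\<^sub>U\<^esub> (\<Oplus>\<^bsub>A\<^sub>U\<^esub>i\<in>{..n}. f i \<otimes>\<^bsub>A\<^sub>U\<^esub> g (n - i)))"
    unfolding assoc_graded_def ideal_power_eq by simp
  also have "\<dots> = (\<Union>f\<in>{f. \<forall>i\<le>n. f i \<in> to_cosets a i}. \<Union>g\<in>{g. \<forall>i\<le>n. g i \<in> to_cosets b i}.
     to_cosets (gr_mult a b) n)"
    by (intro SUP_cong refl key) auto
  also have "\<dots> = to_cosets (gr_mult a b) n"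
  proof -
    have "{f. \<forall>i\<le>n. f i \<in> to_cosets a i} \<noteq> {}" "{g. \<forall>i\<le>n. g i \<in> to_cosets b i} \<noteq> {}"
      using part_in[of a] part_in[of b] by blast+
    thus ?thesis by (simp only: UN_constant if_False)
  qed
  finally show "to_cosets (gr_mult a b) n = (to_cosets a \<otimes>\<^bsub>G\<^sub>U\<^esub> to_cosets b) n" by simp
qed

lemma to_cosets_add:
  fixes a b :: "'k::field fps"
  shows "to_cosets (a + b) = to_cosets a \<oplus>\<^bsub>G\<^sub>U\<^esub> to_cosets b"
proof
  fix i
  have "(to_cosets a \<oplus>\<^bsub>G\<^sub>U\<^esub> to_cosets b) i = {f + g | f g. f \<in> to_cosets a i \<and> g \<in> to_cosets b i}"
    by (auto simp: assoc_graded_def set_add_def')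
  also have "\<dots> = to_cosets (a + b) i"
  proof (intro equalityI subsetI)
    fix h assume "h \<in> {f + g | f g. f \<in> to_cosets a i \<and> g \<in> to_cosets b i}"
    thus "h \<in> to_cosets (a + b) i" by (auto simp: to_cosets_def filt_add)
  next
    fix h assume h: "h \<in> to_cosets (a + b) i"
    have "h - part a i \<in> filt i" using h by (intro filt_diff part_filt) (simp add: to_cosets_def)
    hence "h - part a i \<in> to_cosets b i" using h by (auto simp: to_cosets_def part_def)
    moreover have "h = part a i + (h - part a i)" by simp
    ultimately show "h \<in> {f + g | f g. f \<in> to_cosets a i \<and> g \<in> to_cosets b i}" using part_in
      by blast
  qed
  finally show "to_cosets (a + b) i = (to_cosets a \<oplus>\<^bsub>G\<^sub>U\<^esub> to_cosets b) i" by simp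
qed

lemma to_cosets_const:
  "to_cosets (fps_const c) = degree_zero_class A\<^sub>U (semigroup_ring_max U) (fps_const (c :: 'k::field))"
proof
  fix i
  have c0: "fps_const c \<in> filt 0" by (auto simp: filt_def split: if_splits)
  have "to_cosets (fps_const c) i = filt (Suc i)" if "i > 0"
    using that by (intro to_cosets_zero) auto
  moreover have "to_cosets (fps_const c) 0 = filt (Suc 0) +>\<^bsub>A\<^sub>U\<^esub> fps_const c"
    unfolding coset_eq[OF c0] to_cosets_def by auto
  ultimately show "to_cosets (fps_const c) i = degree_zero_class A\<^sub>U (semigroup_ring_max U) (fps_const c) i"
    unfolding degree_zero_class_def ideal_power_eq by auto
qed

lemma gr_mult_in: assumes "a \<in> gr_carrier" "b \<in> gr_carrier" shows "gr_mult a b \<in> gr_carrier"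
proof -
  have *: "\<exists>v w. fps_nth a v \<noteq> 0 \<and> fps_nth b w \<noteq> 0 \<and> u = v + w"
    if "fps_nth (gr_mult a b) u \<noteq> 0" for u
  proof -
    have "(\<Sum>v\<le>u. if ord v + ord (u - v) = ord u then fps_nth a v * fps_nth b (u - v) else 0) \<noteq> 0"
      using that by (simp add: gr_mult_def)
    then obtain v where v: "v \<in> {..u}" "(if ord v + ord (u - v) = ord u then fps_nth a v * fps_nth b (u - v) else 0) \<noteq> 0"
      by (rule sum.not_neutral_contains_not_neutral)
    hence "fps_nth a v \<noteq> 0 \<and> fps_nth b (u - v) \<noteq> 0" by (simp split: if_splits)
    thus ?thesis using v(1) by (metis atMost_iff le_add_diff_inverse)
  qed
  hence "{u. fps_nth (gr_mult a b) u \<noteq> 0} \<subseteq> (\<lambda>(v, w). v + w) ` ({u. fps_nth a u \<noteq> 0} \<times> {u. fps_nth b u \<noteq> 0})"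
  proof clarify
    fix u assume "fps_nth (gr_mult a b) u \<noteq> 0"
    then obtain v w where "fps_nth a v \<noteq> 0" "fps_nth b w \<noteq> 0" "u = v + w" using * by blast
    thus "u \<in> (\<lambda>(v, w). v + w) ` ({u. fps_nth a u \<noteq> 0} \<times> {u. fps_nth b u \<noteq> 0})"
      by (intro image_eqI[of _ _ "(v, w)"]) auto
  qed
  moreover have "finite ({u. fps_nth a u \<noteq> 0} \<times> {u. fps_nth b u \<noteq> 0})" using assms
    by (simp add: gr_carrier_def)
  ultimately have "finite {u. fps_nth (gr_mult a b) u \<noteq> 0}" by (blast intro: finite_subset)
  thus ?thesis using * assms add_in unfolding gr_carrier_def by blast
qed

lemma gr_add_in: assumes "a \<in> gr_carrier" "b \<in> gr_carrier" shows "a + b \<in> gr_carrier"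
proof -
  have "{u. fps_nth (a + b) u \<noteq> 0} \<subseteq> {u. fps_nth a u \<noteq> 0} \<union> {u. fps_nth b u \<noteq> 0}" by auto
  moreover have "finite ({u. fps_nth a u \<noteq> 0} \<union> {u. fps_nth b u \<noteq> 0})" using assms
    by (simp add: gr_carrier_def)
  ultimately have "finite {u. fps_nth (a + b) u \<noteq> 0}" by (rule finite_subset)
  moreover have "u \<in> U" if "fps_nth (a + b) u \<noteq> 0" for u
    using that assms unfolding gr_carrier_def
      by (metis (mono_tags, lifting) add.right_neutral fps_add_nth mem_Collect_eq)
  ultimately show ?thesis by (simp add: gr_carrier_def)
qed

lemma gr_const_in: "fps_const c \<in> gr_carrier"
proof -
  have "{u. fps_nth (fps_const c) u \<noteq> 0} \<subseteq> {0}" by auto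
  thus ?thesis using finite_subset by (auto simp: gr_carrier_def split: if_splits)
qed

lemma assoc_graded_component_iff:
  assumes a: "a \<in> gr_carrier"
  shows "to_cosets a \<in> assoc_graded_component A\<^sub>U (semigroup_ring_max U) d \<longleftrightarrow> a \<in> gr_comp d"
proof
  assume *: "to_cosets a \<in> assoc_graded_component A\<^sub>U (semigroup_ring_max U) d"
  have "ord u = d" if "fps_nth a u \<noteq> 0" for u
  proof (rule ccontr)
    assume "ord u \<noteq> d"
    hence "to_cosets a (ord u) = filt (Suc (ord u))"
      using * by (simp add: assoc_graded_component_def ideal_power_eq del: ideal_power.simps)
    moreover have "u \<in> U" using a that by (auto simp: gr_carrier_def)
    ultimately show False using to_cosets_nonzero that by blast
  qed
  thus "a \<in> gr_comp d" using a by (simp add: gr_comp_def)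
next
  assume "a \<in> gr_comp d"
  hence "fps_nth a u = 0" if "ord u \<noteq> d" for u using that by (auto simp: gr_comp_def)
  hence "to_cosets a i = filt (Suc i)" if "i \<noteq> d" for i using that by (intro to_cosets_zero) auto
  thus "to_cosets a \<in> assoc_graded_component A\<^sub>U (semigroup_ring_max U) d"
    using to_cosets_carrier[OF a]
      by (simp add: assoc_graded_component_def ideal_power_eq del: ideal_power.simps)
qed

lemma gr_CI_iff_gr_ring:
  "gr_semigroup_ring_CI TYPE('k::field) U \<longleftrightarrow>
     graded_complete_intersection (fps_const :: 'k \<Rightarrow> 'k fps) gr_ring gr_comp"
  unfolding gr_semigroup_ring_CI_def Let_def
proof (rule graded_complete_intersection_transfer[where h = to_cosets])
  show "bij_betw to_cosets (carrier gr_ring) (carrier (G\<^sub>U :: (nat \<Rightarrow> 'k fps set) ring))"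
    unfolding bij_betw_def using inj_to_cosets carrier_image by (simp add: gr_ring_def)
  show "to_cosets \<one>\<^bsub>gr_ring\<^esub> = \<one>\<^bsub>G\<^sub>U :: (nat \<Rightarrow> 'k fps set) ring\<^esub>"
    using to_cosets_const[of "1 :: 'k"] by (simp add: gr_ring_def assoc_graded_def)
  show "to_cosets \<zero>\<^bsub>gr_ring\<^esub> = \<zero>\<^bsub>G\<^sub>U :: (nat \<Rightarrow> 'k fps set) ring\<^esub>"
    unfolding assoc_graded_def ideal_power_eq by (simp add: gr_ring_def to_cosets_zero fun_eq_iff)
  show "assoc_graded_component A\<^sub>U (semigroup_ring_max U) d \<subseteq> carrier (G\<^sub>U :: (nat \<Rightarrow> 'k fps set) ring)" for d
    by (auto simp: assoc_graded_component_def)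
  show "to_cosets a \<in> assoc_graded_component A\<^sub>U (semigroup_ring_max U) d \<longleftrightarrow> a \<in> gr_comp d"
    if "a \<in> carrier gr_ring" for a :: "'k fps" and d
    using assoc_graded_component_iff[of a d] that by (simp add: gr_ring_def)
  show "\<one>\<^bsub>gr_ring\<^esub> \<in> carrier (gr_ring :: 'k fps ring)" "\<zero>\<^bsub>gr_ring\<^esub> \<in> carrier (gr_ring :: 'k fps ring)"
    using gr_const_in[of "0 :: 'k"] gr_const_in[of "1 :: 'k"] by (simp_all add: gr_ring_def)
qed (simp_all add: gr_ring_def gr_mult_in gr_add_in gr_const_in to_cosets_mult to_cosets_add
    to_cosets_const, auto simp: gr_comp_def)

end

section \<open>The presentation by the minimal generators\<close>

text \<open>Linear extension of a function on monomials. The scalar multiplication is a parameter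
  because the values are power series for \<open>Phi\<close> and polynomials for
  \<open>psubst\<close>.\<close>

definition lext :: "('k::field \<Rightarrow> 'b::ab_group_add \<Rightarrow> 'b) \<Rightarrow> ((nat \<Rightarrow>\<^sub>0 nat) \<Rightarrow> 'b) \<Rightarrow> 'k mpoly \<Rightarrow> 'b" where
  "lext s B p = (\<Sum>m\<in>pkeys p. s (coef p m) (B m))"

context
  fixes s :: "'k::field \<Rightarrow> 'b::ab_group_add \<Rightarrow> 'b"
  assumes vs: "vector_space s"
begin

interpretation vector_space s by (rule vs)

lemma lext_superset: "\<lbrakk>finite A; pkeys p \<subseteq> A\<rbrakk> \<Longrightarrow> lext s B p = (\<Sum>m\<in>A. s (coef p m) (B m))"
  unfolding lext_def by (rule sum.mono_neutral_left) (auto simp: in_keys_iff scale_zero_left)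

lemma lext_add: "lext s B (p + q) = lext s B p + lext s B q"
proof -
  let ?A = "pkeys p \<union> pkeys q"
  have "lext s B (p + q) = (\<Sum>m\<in>?A. s (coef (p + q) m) (B m))"
    using keys_add[of p q] by (intro lext_superset) auto
  also have "\<dots> = (\<Sum>m\<in>?A. s (coef p m) (B m)) + (\<Sum>m\<in>?A. s (coef q m) (B m))"
    by (simp add: lookup_add scale_left_distrib sum.distrib)
  also have "\<dots> = lext s B p + lext s B q" by (simp add: lext_superset[of ?A])
  finally show ?thesis .
qed

lemma lext_zero [simp]: "lext s B 0 = 0"
  by (simp add: lext_def)

lemma lext_mnm: "lext s B (mnm m c) = s c (B m)"
  by (subst lext_superset[of "{m}"]) auto

lemma lext_cmult: "lext s B (mpoly_const c * p) = s c (lext s B p)"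
proof -
  have "lext s B (mpoly_const c * p) = (\<Sum>m\<in>pkeys p. s (coef (mpoly_const c * p) m) (B m))"
    by (rule lext_superset) (auto simp: in_keys_iff)
  thus ?thesis by (simp add: lext_def scale_sum_right)
qed

end

lemma vector_space_fps: "vector_space (\<lambda>c (f :: 'k::field fps). fps_const c * f)"
  by unfold_locales (auto simp: algebra_simps simp flip: fps_const_add fps_const_mult)

interpretation fv: vector_space "\<lambda>c (f :: 'k::field fps). fps_const c * f"
  by (rule vector_space_fps)

interpretation mf: vector_space_pair "\<lambda>c (p :: 'k::field mpoly). mpoly_const c * p" "\<lambda>c (f :: 'k::field fps). fps_const c * f"
  by unfold_locales

lemma independent_fps_X_powers: "fv.independent ((\<lambda>u. fps_X ^ u :: 'k::field fps) ` V)"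
proof (unfold fv.dependent_def, rule notI, elim bexE)
  fix f :: "'k fps" assume "f \<in> (\<lambda>u. fps_X ^ u) ` V"
  then obtain u where u: "f = fps_X ^ u" "u \<in> V" by auto
  assume "f \<in> fv.span ((\<lambda>u. fps_X ^ u) ` V - {f})"
  moreover have "fv.span ((\<lambda>u. fps_X ^ u :: 'k fps) ` V - {f}) \<subseteq> {q. fps_nth q u = 0}"
  proof (rule fv.span_minimal)
    show "(\<lambda>u. fps_X ^ u) ` V - {f} \<subseteq> {q. fps_nth q u = 0}" using u by auto
    show "fv.subspace {q. fps_nth q u = 0}" by (auto simp: fv.subspace_def)
  qed
  ultimately show False using u by auto
qed

lemma inj_fps_X_powers: "inj_on (\<lambda>u. fps_X ^ u :: 'k::field fps) V"
proof (rule inj_onI)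
  fix u v assume "(fps_X ^ u :: 'k fps) = fps_X ^ v"
  hence "fps_nth (fps_X ^ u :: 'k fps) u = fps_nth (fps_X ^ v) u" by simp
  thus "u = v" by (simp split: if_splits)
qed

context num_semigroup
begin

lemma gr_mult_add_left: "gr_mult (a + a') b = gr_mult a b + gr_mult a' (b :: 'k::field fps)"
  and gr_mult_add_right: "gr_mult b (a + a') = gr_mult b a + gr_mult b a'"
  and gr_mult_zero_left [simp]: "gr_mult 0 b = 0" and gr_mult_zero_right [simp]: "gr_mult b 0 = 0"
  by (auto simp: fps_eq_iff gr_mult_def algebra_simps simp flip: sum.distrib intro!: sum.cong sum.neutral)

lemma gr_mult_X:
  "gr_mult (fps_const c * fps_X ^ v) (fps_const d * fps_X ^ w) =
    (if ord v + ord w = ord (v + w) then fps_const (c * d) * fps_X ^ (v + w) else (0 :: 'k::field fps))"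
proof (rule fps_ext)
  fix u
  have "fps_nth (gr_mult (fps_const c * fps_X ^ v) (fps_const d * fps_X ^ w)) u =
    (\<Sum>v'\<le>u. if v' = v \<and> ord v + ord w = ord u \<and> u = v + w then c * d else 0)"
    unfolding gr_mult_def fps_nth_Abs_fps by (rule sum.cong) auto
  also have "\<dots> = (if ord v + ord w = ord u \<and> u = v + w then c * d else 0)"
  proof (cases "ord v + ord w = ord u \<and> u = v + w")
    case True
    hence "(\<Sum>v'\<le>u. if v' = v \<and> ord v + ord w = ord u \<and> u = v + w then c * d else 0) = (\<Sum>v'\<le>u. if v' = v then c * d else 0)"
      by (intro sum.cong) auto
    also have "\<dots> = c * d" using True by simp
    finally show ?thesis using True by simp
  qed auto
  finally show "fps_nth (gr_mult (fps_const c * fps_X ^ v) (fps_const d * fps_X ^ w)) u =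
    fps_nth (if ord v + ord w = ord (v + w) then fps_const (c * d) * fps_X ^ (v + w) else 0) u" by auto
qed

lemma gr_comp_subspace: "fv.subspace (gr_comp d :: 'k::field fps set)"
proof -
  have "fps_const c * a \<in> gr_comp d" if "a \<in> gr_comp d" for c and a :: "'k fps"
  proof -
    have "{u. fps_nth (fps_const c * a) u \<noteq> 0} \<subseteq> {u. fps_nth a u \<noteq> 0}" by auto
    thus ?thesis using that unfolding gr_comp_def gr_carrier_def
      by (auto intro: finite_subset)
  qed
  moreover have "a + b \<in> gr_comp d" if "a \<in> gr_comp d" "b \<in> gr_comp d" for a b :: "'k fps"
    using that gr_add_in[of a b] unfolding gr_comp_def by (auto, metis add.right_neutral)
  moreover have "(0 :: 'k fps) \<in> gr_comp d" using gr_const_in[of "0 :: 'k"]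
    by (simp add: gr_comp_def)
  ultimately show ?thesis unfolding fv.subspace_def by blast
qed

lemma X_in_gr_comp: "u \<in> U \<Longrightarrow> fps_X ^ u \<in> (gr_comp (ord u) :: 'k::field fps set)"
proof -
  have "{v. fps_nth (fps_X ^ u :: 'k::field fps) v \<noteq> 0} \<subseteq> {u}" by auto
  hence "finite {v. fps_nth (fps_X ^ u :: 'k::field fps) v \<noteq> 0}" by (rule finite_subset) simp
  thus "u \<in> U \<Longrightarrow> fps_X ^ u \<in> (gr_comp (ord u) :: 'k fps set)"
    by (auto simp: gr_comp_def gr_carrier_def)
qed

lemma gr_carrier_sum:
  assumes "a \<in> gr_carrier"
  shows "a = (\<Sum>u | fps_nth a u \<noteq> 0. fps_const (fps_nth a u) * fps_X ^ u)"
proof (rule fps_ext)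
  fix v
  have "fps_nth (\<Sum>u | fps_nth a u \<noteq> 0. fps_const (fps_nth a u) * fps_X ^ u) v =
    (\<Sum>u | fps_nth a u \<noteq> 0. if u = v then fps_nth a v else 0)"
    unfolding fps_sum_nth by (rule sum.cong) auto
  also have "\<dots> = fps_nth a v"
    using assms by (subst sum.delta) (auto simp: gr_carrier_def)
  finally show "fps_nth a v = fps_nth (\<Sum>u | fps_nth a u \<noteq> 0. fps_const (fps_nth a u) * fps_X ^ u) v"
    by simp
qed

lemma gr_comp_span: "gr_comp d = fv.span ((\<lambda>u. fps_X ^ u :: 'k::field fps) ` {u \<in> U. ord u = d})"
proof
  show "fv.span ((\<lambda>u. fps_X ^ u :: 'k fps) ` {u \<in> U. ord u = d}) \<subseteq> gr_comp d"
    by (intro fv.span_minimal gr_comp_subspace) (auto simp: X_in_gr_comp)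
  show "gr_comp d \<subseteq> fv.span ((\<lambda>u. fps_X ^ u :: 'k fps) ` {u \<in> U. ord u = d})"
  proof
    fix a :: "'k fps" assume a: "a \<in> gr_comp d"
    hence "(\<Sum>u | fps_nth a u \<noteq> 0. fps_const (fps_nth a u) * fps_X ^ u) \<in>
       fv.span ((\<lambda>u. fps_X ^ u :: 'k fps) ` {u \<in> U. ord u = d})"
      by (intro fv.span_sum fv.span_scale fv.span_base imageI) (auto simp: gr_comp_def gr_carrier_def)
    thus "a \<in> fv.span ((\<lambda>u. fps_X ^ u :: 'k fps) ` {u \<in> U. ord u = d})"
      using gr_carrier_sum[of a] a by (simp add: gr_comp_def)
  qed
qed

lemma dim_gr_comp: "fv.dim (gr_comp d :: 'k::field fps set) = card {u \<in> U. ord u = d}"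
  unfolding gr_comp_span
  by (subst fv.dim_span_eq_card_independent[OF independent_fps_X_powers]) (rule card_image[OF inj_fps_X_powers])

definition HU :: "int fps" where
  "HU = Abs_fps (\<lambda>d. int (card {u \<in> U. ord u = d}))"

text \<open>Rank-nullity in every degree. The map \<open>\<phi>'\<close> stands in for
  \<open>\<phi>\<close>: a presentation is controlled only on \<open>PC n\<close>, while linearity
  is required on the whole type.\<close>

lemma HS_kernel:
  fixes \<phi> :: "'k::field mpoly \<Rightarrow> 'k fps"
  assumes "Vector_Spaces.linear (\<lambda>c p. mpoly_const c * p) (\<lambda>c f. fps_const c * f) \<phi>'"
    and "\<And>p. p \<in> PC n \<Longrightarrow> \<phi>' p = \<phi> p" and "\<And>d. \<phi> ` HF n d = gr_comp d"
  shows "HS n {p \<in> PC n. \<phi> p = 0} = HU"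
proof (rule fps_ext)
  fix d
  have 0: "fv.subspace {0}" "findim (\<lambda>c (f :: 'k fps). fps_const c * f) {0}" "fv.dim {0 :: 'k fps} = 0"
    using fv.findim_finite[of "{0}"] fv.dim_unique[of "{}" "{0}" 0] fv.independent_empty
    by (auto simp: fv.subspace_def)
  have "\<phi>' ` HF n d = \<phi> ` HF n d" by (rule image_cong) (auto intro: assms(2) HF_PC)
  moreover have "{a + \<phi>' v | a v. a \<in> {0} \<and> v \<in> HF n d} = \<phi>' ` HF n d" by auto
  ultimately have "{a + \<phi>' v | a v. a \<in> {0} \<and> v \<in> HF n d} = gr_comp d" using assms(3) by simp
  moreover have "{v \<in> HF n d. \<phi>' v \<in> {0}} = {p \<in> PC n. \<phi> p = 0} \<inter> HF n d"
    using assms(2) HF_PC by auto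
  ultimately have "card {u \<in> U. ord u = d} + mp.dim ({p \<in> PC n. \<phi> p = 0} \<inter> HF n d) = card (monset n d)"
    using mf.dim_sum_image[OF assms(1) HF_subspace[of n d] findim_HF 0(1,2)] 0(3)
      by (simp add: dim_gr_comp dim_HF)
  thus "fps_nth (HS n {p \<in> PC n. \<phi> p = 0}) d = fps_nth HU d"
    by (simp add: HS_def hf_def HU_def)
qed

end

locale enumerated_semigroup = num_semigroup +
  fixes n :: nat and G :: "nat \<Rightarrow> nat"
  assumes enum: "bij_betw G {..<n} gens"
begin

definition val :: "(nat \<Rightarrow>\<^sub>0 nat) \<Rightarrow> nat" where
  "val m = (\<Sum>i\<in>pkeys m. coef m i * G i)"

lemma G_gens: "i < n \<Longrightarrow> G i \<in> gens"
  using enum by (auto simp: bij_betw_def)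

lemma G_inj: "\<lbrakk>i < n; j < n; G i = G j\<rbrakk> \<Longrightarrow> i = j"
  using enum by (auto simp: bij_betw_def inj_on_def)

lemma val_add [simp]: "val (m + m') = val m + val m'"
  unfolding val_def by (rule wsum_add)

lemma val_0 [simp]: "val 0 = 0" and val_single [simp]: "val (mnm i k) = k * G i"
  by (simp_all add: val_def)

lemma val_in_ord: "pkeys m \<subseteq> {..<n} \<Longrightarrow> val m \<in> U \<and> mdeg m \<le> ord (val m)"
proof (induction "mdeg m" arbitrary: m)
  case 0
  hence "m = 0" by (simp add: mdeg_eq_0)
  thus ?case by simp
next
  case (Suc d)
  hence "m \<noteq> 0" by auto
  then obtain i where i: "coef m i \<noteq> 0" by (metis lookup_zero poly_mapping_eqI)
  then obtain m' where m': "m = m' + mnm i 1" by (rule mono_split)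
  have *: "i < n" "pkeys m' \<subseteq> {..<n}" using Suc.prems by (auto simp: m' keys_add_nat)
  have "val m' \<in> U" "mdeg m' \<le> ord (val m')" using Suc.hyps(1)[of m'] Suc.hyps(2) *
    by (auto simp: m')
  thus ?case
    using ord_add[of "val m'" "G i"] gens_subset[OF G_gens[OF *(1)]] ord_gen[OF G_gens[OF *(1)]] add_in
    by (auto simp: m')
qed

definition maxm :: "(nat \<Rightarrow>\<^sub>0 nat) \<Rightarrow> bool" where
  "maxm m \<longleftrightarrow> ord (val m) = mdeg m"

lemma exists_maxm:
  assumes "u \<in> U"
  obtains m where "pkeys m \<subseteq> {..<n}" "val m = u" "maxm m"
proof -
  obtain c where c: "maximal_representation U u c" using maximal_rep_exists assms by blast
  define m where "m = Abs_poly_mapping (\<lambda>i. if i < n then c (G i) else 0)"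
  have m: "coef m i = (if i < n then c (G i) else 0)" for i
    unfolding m_def by (subst lookup_Abs_poly_mapping) auto
  have keys: "pkeys m \<subseteq> {..<n}" by (auto simp: in_keys_iff m split: if_splits)
  have "val m = (\<Sum>i<n. c (G i) * G i)"
    unfolding val_def by (subst sum_superset_keys[OF _ keys]) (auto simp: m)
  also have "\<dots> = (\<Sum>g\<in>gens. c g * g)" by (rule sum.reindex_bij_betw[OF enum])
  finally have val: "val m = u" using c
    by (simp add: maximal_representation_def semigroup_representation_def)
  have "mdeg m = (\<Sum>i<n. c (G i))"
    using sum_superset_keys[OF _ keys, of "\<lambda>_. 1"] by (simp add: mdeg_def m)
  also have "\<dots> = (\<Sum>g\<in>gens. c g)" by (rule sum.reindex_bij_betw[OF enum])
  finally have "maxm m" using c val by (simp add: maxm_def maximal_representation_def)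
  thus ?thesis using that keys val by blast
qed

text \<open>The product of the generator classes prescribed by \<open>m\<close> lives in degree
  \<open>mdeg m\<close>, where t^(val m) has class zero unless
  \<open>ord (val m) = mdeg m\<close>.\<close>

definition phim :: "(nat \<Rightarrow>\<^sub>0 nat) \<Rightarrow> 'k::field fps" where
  "phim m = (if maxm m then fps_X ^ val m else 0)"

definition Phi :: "'k::field mpoly \<Rightarrow> 'k fps" where
  "Phi = lext (\<lambda>c f. fps_const c * f) phim"

lemma Phi_add: "Phi (p + q) = Phi p + Phi q" and Phi_0 [simp]: "Phi 0 = 0"
  and Phi_mnm: "Phi (mnm m c) = fps_const c * phim m"
    and Phi_cmult: "Phi (mpoly_const c * p) = fps_const c * Phi p"
  unfolding Phi_def
  by (simp_all add: lext_add[OF vector_space_fps] lext_zero[OF vector_space_fps] lext_mnm[OF vector_space_fps]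
      lext_cmult[OF vector_space_fps])

lemma Phi_linear: "Vector_Spaces.linear (\<lambda>c p. mpoly_const c * p) (\<lambda>c f. fps_const c * f) Phi"
  by (simp add: Vector_Spaces.linear_iff mp.vector_space_axioms fv.vector_space_axioms Phi_add Phi_cmult)

lemma Phi_sum: "Phi (sum f A) = (\<Sum>x\<in>A. Phi (f x))"
  by (induction A rule: infinite_finite_induct) (auto simp: Phi_add)

lemma Phi_nth: "fps_nth (Phi p) u = (\<Sum>m\<in>pkeys p. if maxm m \<and> val m = u then coef p m else 0)"
  unfolding Phi_def lext_def fps_sum_nth by (rule sum.cong) (auto simp: phim_def)

lemma Phi_const: "Phi (mpoly_const c) = fps_const c"
  by (simp add: mpoly_const_def Phi_mnm phim_def maxm_def)

lemma Phi_1 [simp]: "Phi 1 = 1"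
  using Phi_const[of 1] by simp

text \<open>On monomials, \<open>mdeg m \<le> ord (val m)\<close> and the superadditivity of
  \<open>ord\<close> form a chain. So \<open>m + m'\<close> is maximal exactly if both factors are
  and their orders add up, which is the condition in \<open>gr_mult\<close>.\<close>

lemma Phi_mult:
  assumes p: "p \<in> PC n" and q: "q \<in> PC n"
  shows "Phi (p * q) = gr_mult (Phi p) (Phi q)"
proof (rule poly_induct[where r = p and P = "\<lambda>p. Phi (p * q) = gr_mult (Phi p) (Phi q)"])
  fix m c assume "m \<in> pkeys p"
  hence m: "pkeys m \<subseteq> {..<n}" using p by (auto simp: PC_def)
  show "Phi (mnm m c * q) = gr_mult (Phi (mnm m c)) (Phi q)"
  proof (rule poly_induct[where r = q and P = "\<lambda>q. Phi (mnm m c * q) = gr_mult (Phi (mnm m c)) (Phi q)"])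
    fix m' d assume "m' \<in> pkeys q"
    hence m': "pkeys m' \<subseteq> {..<n}" using q by (auto simp: PC_def)
    have val: "val m \<in> U" "mdeg m \<le> ord (val m)" "val m' \<in> U" "mdeg m' \<le> ord (val m')"
      using val_in_ord m m' by auto
    hence "ord (val m) + ord (val m') \<le> ord (val m + val m')" using ord_add by blast
    hence "maxm (m + m') \<longleftrightarrow> maxm m \<and> maxm m' \<and> ord (val m) + ord (val m') = ord (val m + val m')"
      using val by (auto simp: maxm_def)
    thus "Phi (mnm m c * mnm m' d) = gr_mult (Phi (mnm m c)) (Phi (mnm m' d))"
      by (simp add: mult_single Phi_mnm phim_def gr_mult_X)
  qed (auto simp: distrib_left Phi_add gr_mult_add_right)
qed (auto simp: distrib_right Phi_add gr_mult_add_left)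

lemma Phi_HF: assumes "p \<in> HF n d" shows "Phi p \<in> gr_comp d"
proof -
  have "fps_const (coef p m) * phim m \<in> gr_comp d" if "m \<in> pkeys p" for m
    using that assms X_in_gr_comp[of "val m"] val_in_ord[of m] gr_comp_subspace[of d]
    by (intro fv.subspace_scale[OF gr_comp_subspace])
       (auto simp: phim_def maxm_def HF_iff monset_def fv.subspace_0[OF gr_comp_subspace])
  thus ?thesis unfolding Phi_def lext_def by (intro fv.subspace_sum[OF gr_comp_subspace])
qed

lemma Phi_image_HF: "Phi ` HF n d = gr_comp d"
proof (intro equalityI subsetI)
  fix a :: "'a fps" assume a: "a \<in> gr_comp d"
  have "\<exists>m. u \<in> U \<longrightarrow> pkeys m \<subseteq> {..<n} \<and> val m = u \<and> maxm m" for u using exists_maxm by metis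
  then obtain M where M: "\<And>u. u \<in> U \<Longrightarrow> pkeys (M u) \<subseteq> {..<n} \<and> val (M u) = u \<and> maxm (M u)" by metis
  define p where "p = (\<Sum>u | fps_nth a u \<noteq> 0. mnm (M u) (fps_nth a u))"
  have supp: "u \<in> U" "ord u = d" if "fps_nth a u \<noteq> 0" for u
    using a that by (auto simp: gr_comp_def gr_carrier_def)
  have "mnm (M u) (fps_nth a u) \<in> HF n d" if "fps_nth a u \<noteq> 0" for u
    using M[OF supp(1)[OF that]] supp(2)[OF that] by (auto simp: HF_iff monset_def maxm_def)
  hence "p \<in> HF n d" unfolding p_def by (intro mp.subspace_sum[OF HF_subspace]) auto
  moreover have "Phi p = (\<Sum>u | fps_nth a u \<noteq> 0. fps_const (fps_nth a u) * fps_X ^ u)"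
    unfolding p_def Phi_sum by (rule sum.cong) (auto simp: Phi_mnm phim_def M supp)
  hence "Phi p = a" using gr_carrier_sum[of a] a by (simp add: gr_comp_def)
  ultimately show "a \<in> Phi ` HF n d" by blast
qed (use Phi_HF in auto)

definition ker :: "'k::field mpoly set" where
  "ker = {p \<in> PC n. Phi p = 0}"

lemma HS_ker: "HS n (ker :: 'k::field mpoly set) = HU"
  unfolding ker_def by (rule HS_kernel[OF Phi_linear]) (auto simp: Phi_image_HF)

text \<open>Distinct variables have distinct generators as values, all of order one. The absence of
  linear relations makes this presentation minimal and lets its relations start in degree
  two.\<close>

lemma Phi_inj_HF1: assumes "p \<in> HF n 1" "Phi p = 0" shows "p = 0"
proof (rule poly_mapping_eqI)
  have monset1: "\<exists>i<n. m = mnm i 1" if "m \<in> monset n 1" for m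
  proof -
    have "m \<noteq> 0" using that by (auto simp: monset_def)
    then obtain i where "coef m i \<noteq> 0" by (metis lookup_zero poly_mapping_eqI)
    then obtain m' where m': "m = m' + mnm i 1" by (rule mono_split)
    hence "m' = 0" "i < n" using that by (auto simp: monset_def mdeg_eq_0 keys_add_nat)
    thus ?thesis using m' by auto
  qed
  fix m show "coef p m = coef 0 m"
  proof (cases "m \<in> pkeys p")
    case True
    then obtain i where i: "i < n" "m = mnm i 1" using assms monset1 by (auto simp: HF_iff)
    have "(if maxm m' \<and> val m' = G i then coef p m' else 0) = (if m' = m then coef p m else 0)"
      if m': "m' \<in> pkeys p" for m'
    proof -
      obtain j where j: "j < n" "m' = mnm j 1" using m' assms monset1 by (auto simp: HF_iff)
      have "val m' = G i \<longleftrightarrow> m' = m"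
      proof
        assume "val m' = G i"
        thus "m' = m" using G_inj[of j i] i j by simp
      qed (simp add: i)
      moreover have "maxm m'" using j ord_gen[OF G_gens] by (simp add: maxm_def)
      ultimately show ?thesis by auto
    qed
    hence "fps_nth (Phi p) (G i) = (\<Sum>m'\<in>pkeys p. if m' = m then coef p m else 0)"
      unfolding Phi_nth by (intro sum.cong) auto
    thus ?thesis using assms True by simp
  qed (simp add: in_keys_iff)
qed

lemma ker_ideal: "MP.is_ideal n ker"
  unfolding MP.is_ideal_def ker_def by (auto simp: Phi_add Phi_mult)

lemma one_notin_ker: "1 \<notin> ker"
  by (simp add: ker_def)

end

section \<open>Substitution of linear forms, and low coefficients of the product
  \<open>koszul\<close>\<close>

lemma monomial_induct [consumes 1, case_names zero add]:
  fixes m :: "nat \<Rightarrow>\<^sub>0 nat"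
  assumes "pkeys m \<subseteq> {..<n}" "P 0"
    and "\<And>m i. \<lbrakk>i < n; pkeys m \<subseteq> {..<n}; P m\<rbrakk> \<Longrightarrow> P (m + mnm i (1::nat))"
  shows "P m"
  using assms(1)
proof (induction "mdeg m" arbitrary: m)
  case 0
  thus ?case using assms(2) by (simp add: mdeg_eq_0)
next
  case (Suc d)
  hence "m \<noteq> 0" by auto
  then obtain i where i: "coef m i \<noteq> 0" by (metis lookup_zero poly_mapping_eqI)
  then obtain m' where m': "m = m' + mnm i 1" by (rule mono_split)
  have "i < n" "pkeys m' \<subseteq> {..<n}" using Suc.prems by (auto simp: m' keys_add_nat)
  thus ?case using Suc.hyps assms(3)[of i m'] by (auto simp: m')
qed

definition monsub :: "(nat \<Rightarrow> 'k::field mpoly) \<Rightarrow> (nat \<Rightarrow>\<^sub>0 nat) \<Rightarrow> 'k mpoly" where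
  "monsub l m = (\<Prod>i\<in>pkeys m. l i ^ coef m i)"

definition psubst :: "(nat \<Rightarrow> 'k::field mpoly) \<Rightarrow> 'k mpoly \<Rightarrow> 'k mpoly" where
  "psubst l = lext (\<lambda>c p. mpoly_const c * p) (monsub l)"

lemma monsub_add: "monsub l (m + m') = monsub l m * monsub l m'"
proof -
  let ?A = "pkeys m \<union> pkeys m'"
  have *: "monsub l k = (\<Prod>i\<in>?A. l i ^ coef k i)" if "pkeys k \<subseteq> ?A" for k
    unfolding monsub_def by (rule prod.mono_neutral_left) (use that in \<open>auto simp: in_keys_iff\<close>)
  show ?thesis using keys_add_nat[of m m'] by (simp add: * lookup_add power_add prod.distrib)
qed

lemma monsub_0 [simp]: "monsub l 0 = 1" and monsub_single [simp]: "monsub l (mnm i (Suc 0)) = l i"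
  by (simp_all add: monsub_def)

lemma psubst_add: "psubst l (p + q) = psubst l p + psubst l q" and psubst_0 [simp]: "psubst l 0 = 0"
  and psubst_mnm: "psubst l (mnm m c) = mpoly_const c * monsub l m"
  and psubst_cmult: "psubst l (mpoly_const c * p) = mpoly_const c * psubst l p"
  unfolding psubst_def
  by (simp_all add: lext_add[OF mp.vector_space_axioms] lext_zero[OF mp.vector_space_axioms]
      lext_mnm[OF mp.vector_space_axioms] lext_cmult[OF mp.vector_space_axioms])

lemma psubst_1 [simp]: "psubst l 1 = 1"
  using psubst_mnm[of l 0 1] by simp

lemma psubst_mult: "psubst l (p * q) = psubst l p * psubst l q"
proof (induction p rule: poly_induct)
  case (mnm m c)
  show ?case
  proof (induction q rule: poly_induct)
    case (mnm m' d)
    show ?case by (simp only: mult_single psubst_mnm monsub_add mpoly_const_mult[symmetric] mult_ac)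
  qed (auto simp: distrib_left psubst_add)
qed (auto simp: distrib_right psubst_add)

lemma psubst_HF:
  assumes l: "\<And>i. i < N \<Longrightarrow> l i \<in> HF n 1" and p: "p \<in> HF N d"
  shows "psubst l p \<in> HF n d"
proof -
  have mon: "monsub l m \<in> HF n (mdeg m)" if "pkeys m \<subseteq> {..<N}" for m
    using that
  proof (induction rule: monomial_induct)
    case zero show ?case by (simp add: HF_iff monset_def)
  next
    case (add m i)
    thus ?case using HF_mult[OF add(3) l[OF add(1)]] by (simp add: monsub_add)
  qed
  have "monsub l m \<in> HF n d" if "m \<in> pkeys p" for m
  proof -
    have "pkeys m \<subseteq> {..<N}" "mdeg m = d" using p that by (auto simp: HF_iff monset_def)
    thus ?thesis using mon[of m] by simp
  qed
  thus ?thesis unfolding psubst_def lext_def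
    by (intro mp.subspace_sum[OF HF_subspace] HF_cmult)
qed

lemma subspace_PC: "mp.subspace (PC n)"
  by (simp add: mp.subspace_def)

lemma psubst_PC:
  assumes l: "\<And>i. i < N \<Longrightarrow> l i \<in> HF n 1" and p: "p \<in> PC N"
  shows "psubst l p \<in> PC n"
proof -
  obtain K where "p = (\<Sum>d\<le>K. hcomp d p)" by (rule sum_hcomp)
  moreover have "psubst l (sum f A) = (\<Sum>x\<in>A. psubst l (f x))" for f :: "nat \<Rightarrow> 'a mpoly" and A
    by (induction A rule: infinite_finite_induct) (auto simp: psubst_add)
  ultimately have "psubst l p = (\<Sum>d\<le>K. psubst l (hcomp d p))" by metis
  also have "\<dots> \<in> PC n"
  proof (rule PC_sum)
    fix d show "psubst l (hcomp d p) \<in> PC n"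
      by (rule HF_PC[where d = d], rule psubst_HF[where N = N]) (use l hcomp_HF[OF p] in auto)
  qed
  finally show ?thesis .
qed

lemma koszul_Cons [simp]: "koszul (x # fds) = (1 - fps_X ^ snd x) * koszul fds"
  and koszul_Nil [simp]: "koszul [] = 1"
  by (simp_all add: koszul_def)

text \<open>Separates the linear forms: their factors 1 - X alone influence the linear coefficient
  of the product.\<close>

lemma koszul_filter:
  assumes "\<And>x. x \<in> set fds \<Longrightarrow> snd x \<ge> 1"
  shows "koszul fds = (1 - fps_X) ^ length (filter (\<lambda>x. snd x = 1) fds) * koszul (filter (\<lambda>x. snd x \<ge> 2) fds)"
  using assms
proof (induction fds)
  case (Cons x fds)
  have IH: "koszul fds = (1 - fps_X) ^ length (filter (\<lambda>x. snd x = 1) fds) *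
      koszul (filter (\<lambda>x. snd x \<ge> 2) fds)" using Cons by simp
  have "snd x \<ge> 1" using Cons.prems[of x] by simp
  then consider "snd x = 1" | "snd x \<ge> 2" by linarith
  thus ?case by cases (simp_all add: IH mult.assoc mult.left_commute)
qed simp

lemma koszul_nth_0: assumes "\<And>x. x \<in> set fds \<Longrightarrow> snd x \<ge> 2" shows "fps_nth (koszul fds) 0 = 1" "fps_nth (koszul fds) (Suc 0) = 0"
proof -
  have "fps_nth (koszul fds) 0 = 1 \<and> fps_nth (koszul fds) (Suc 0) = 0"
    using assms
  proof (induction fds)
    case (Cons x fds)
    have "snd x \<ge> 2" using Cons.prems[of x] by simp
    moreover have "fps_nth (koszul fds) 0 = 1 \<and> fps_nth (koszul fds) (Suc 0) = 0"
      by (rule Cons.IH) (simp add: Cons.prems)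
    ultimately show ?case by (simp add: left_diff_distrib fps_X_power_mult_nth)
  qed simp
  thus "fps_nth (koszul fds) 0 = 1" "fps_nth (koszul fds) (Suc 0) = 0" by auto
qed

lemma one_minus_X_power_nth: "fps_nth ((1 - fps_X :: int fps) ^ k) 0 = 1" "fps_nth ((1 - fps_X :: int fps) ^ k) (Suc 0) = - int k"
  by (induction k) (simp_all add: fps_mult_nth)

context enumerated_semigroup
begin

lemma ord_0_iff: "{u \<in> U. ord u = 0} = {0}" 
  using ord_pos by fastforce

lemma ord_1: "{u \<in> U. ord u = Suc 0} = gens"
  by (auto simp: gens_iff_ord)

lemma HU_nth: "fps_nth HU 0 = 1" "fps_nth HU (Suc 0) = int n"
  using bij_betw_same_card[OF enum] by (simp_all add: HU_def ord_0_iff ord_1)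

text \<open>By \<open>HS_regular\<close>, the last equation says that the forms are a regular sequence.\<close>

definition CI_data :: "('k::field mpoly \<times> nat) list \<Rightarrow> bool" where
  "CI_data fds \<longleftrightarrow> (\<forall>(f, d)\<in>set fds. f \<in> HF n d \<and> d \<ge> 2) \<and> idl n (fst ` set fds) = ker \<and>
     (1 - fps_X) ^ n * HU = koszul fds"

lemma Phi_image: "Phi ` PC n = (gr_carrier :: 'k::field fps set)"
proof (intro equalityI subsetI)
  fix a :: "'k fps" assume "a \<in> Phi ` PC n"
  then obtain p where p: "p \<in> PC n" "a = Phi p" by auto
  obtain K where K: "p = (\<Sum>d\<le>K. hcomp d p)" by (rule sum_hcomp)
  have "a = (\<Sum>d\<le>K. Phi (hcomp d p))" unfolding p(2) by (subst K) (simp add: Phi_sum)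
  moreover have "(\<Sum>d\<in>A. Phi (hcomp d p)) \<in> gr_carrier" for A
    using Phi_HF[OF hcomp_HF[OF p(1)]] gr_const_in[of "0 :: 'k"]
    by (induction A rule: infinite_finite_induct) (auto intro!: gr_add_in simp: gr_comp_def)
  ultimately show "a \<in> gr_carrier" by simp
next
  fix a :: "'k fps" assume a: "a \<in> gr_carrier"
  have sub: "fv.subspace (Phi ` PC n :: 'k fps set)"
    using mf.linear_subspace_image[OF Phi_linear subspace_PC] .
  have "fps_X ^ u \<in> (Phi ` PC n :: 'k fps set)" if "fps_nth a u \<noteq> 0" for u
    using X_in_gr_comp[of u] Phi_image_HF[of "ord u"] that a HF_PC by (force simp: gr_carrier_def)
  hence "(\<Sum>u | fps_nth a u \<noteq> 0. fps_const (fps_nth a u) * fps_X ^ u) \<in> Phi ` PC n"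
    by (intro fv.subspace_sum[OF sub] fv.subspace_scale[OF sub]) auto
  thus "a \<in> Phi ` PC n" using gr_carrier_sum[OF a] by simp
qed

lemma CI_data_imp_CI:
  assumes "CI_data (fds :: ('k::field mpoly \<times> nat) list)"
  shows "graded_complete_intersection (fps_const :: 'k \<Rightarrow> 'k fps) gr_ring gr_comp"
proof -
  have fds: "f \<in> HF n d" "d \<ge> 2" if "(f, d) \<in> set fds" for f d using assms that
    by (auto simp: CI_data_def)
  have idl: "idl n (fst ` set fds) = ker" and HU: "(1 - fps_X) ^ n * HU = koszul fds"
    using assms by (auto simp: CI_data_def)
  have forms: "forms n fds" using fds by (fastforce simp: forms_def)
  have "koszul fds * HP n = HU * ((1 - fps_X) ^ n * HP n)" unfolding HU[symmetric]
    by (simp add: ac_simps)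
  hence "koszul fds * HP n = HU" by (simp add: HP_inverse)
  hence "wreg n (map fst fds)" using HS_regular[OF forms] by (simp add: idl HS_ker)
  hence "regular_sequence (mpoly_ring n) (map fst fds)"
    using forms_PC[OF forms] one_notin_ker MP.one_C[of n]
    unfolding regular_sequence_def wreg_def by (auto simp: idl)
  moreover have "Phi \<in> ring_hom (mpoly_ring n) (gr_ring :: 'k fps ring)"
    using Phi_image by (auto simp: ring_hom_def gr_ring_def Phi_mult Phi_add)
  moreover have "\<forall>d. \<forall>p\<in>carrier (mpoly_ring n :: 'k mpoly ring). homogeneous_mpoly d p \<longrightarrow> Phi p \<in> gr_comp d"
    using Phi_HF[unfolded HF_def] by auto
  moreover have "Phi ` carrier (mpoly_ring n) = carrier (gr_ring :: 'k fps ring)"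
    by (simp add: gr_ring_def Phi_image)
  moreover have "\<forall>f\<in>set (map fst fds). \<exists>d. homogeneous_mpoly d f"
    using fds(1) unfolding HF_def by fastforce
  moreover have "a_kernel (mpoly_ring n) (gr_ring :: 'k fps ring) Phi = idl n (set (map fst fds))"
    by (simp add: a_kernel_def' idl) (simp add: ker_def gr_ring_def)
  ultimately show ?thesis unfolding graded_complete_intersection_def using Phi_const by blast
qed

lemma gr_mult_const: "gr_mult (fps_const c) b = fps_const c * b"
proof (rule fps_ext)
  fix u
  have "fps_nth (gr_mult (fps_const c) b) u = (\<Sum>v\<le>u. if v = 0 then c * fps_nth b u else 0)"
    unfolding gr_mult_def fps_nth_Abs_fps by (rule sum.cong) auto
  thus "fps_nth (gr_mult (fps_const c) b) u = fps_nth (fps_const c * b) u" by simp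
qed

text \<open>An arbitrary presentation \<open>\<phi>\<close> in \<open>N\<close> variables factors through the minimal one by a graded
  surjection of polynomial rings. The forms of degree one among the relations become zero, and
  comparing the linear coefficients of the Hilbert series shows that there are exactly \<open>N - n\<close> of them.\<close>

lemma CI_imp_CI_data:
  assumes "graded_complete_intersection (fps_const :: 'k::field \<Rightarrow> 'k fps) gr_ring gr_comp"
  shows "\<exists>fds :: ('k mpoly \<times> nat) list. CI_data fds"
proof -
  obtain N \<phi> fs where hom: "\<phi> \<in> ring_hom (mpoly_ring N :: 'k mpoly ring) gr_ring"
      and const: "\<forall>c. \<phi> (mpoly_const c) = fps_const c"
      and gr: "\<forall>d. \<forall>p\<in>carrier (mpoly_ring N). homogeneous_mpoly d p \<longrightarrow> \<phi> p \<in> gr_comp d"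
      and surj: "\<phi> ` carrier (mpoly_ring N) = carrier gr_ring"
        and reg: "regular_sequence (mpoly_ring N) fs"
      and homog: "\<forall>f\<in>set fs. \<exists>d. homogeneous_mpoly d f"
        and kern: "a_kernel (mpoly_ring N) gr_ring \<phi> = idl N (set fs)"
    using assms unfolding graded_complete_intersection_def by blast
  have phi_mult: "\<phi> (p * q) = gr_mult (\<phi> p) (\<phi> q)" and phi_add: "\<phi> (p + q) = \<phi> p + \<phi> q"
    if "p \<in> PC N" "q \<in> PC N" for p q
    using hom that by (auto simp: ring_hom_def gr_ring_def)
  have phi_HF: "\<phi> p \<in> gr_comp d" if "p \<in> HF N d" for p d
    using gr that by (auto simp: HF_def)
  have phi_cmult: "\<phi> (mpoly_const c * p) = fps_const c * \<phi> p" if "p \<in> PC N" for c p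
    using phi_mult[OF const_in_PC that] const by (simp add: gr_mult_const)
  \<comment> \<open>Lifting the images of the variables through \<open>Phi\<close> in degree one
    yields linear forms \<open>l j\<close>; substituting them makes \<open>\<phi>\<close> factor
    through \<open>Phi\<close> on \<open>PC N\<close>.\<close>
  have "\<exists>q\<in>HF n 1. Phi q = \<phi> (mnm (mnm j 1) 1)" if "j < N" for j
  proof -
    have "\<phi> (mnm (mnm j 1) 1) \<in> gr_comp 1" using that
      by (intro phi_HF) (auto simp: HF_iff monset_def)
    thus ?thesis unfolding Phi_image_HF[symmetric] by force
  qed
  then obtain l where l: "\<And>j. j < N \<Longrightarrow> l j \<in> HF n 1" "\<And>j. j < N \<Longrightarrow> Phi (l j) = \<phi> (mnm (mnm j 1) 1)"
    by metis
  define \<psi> where "\<psi> = (\<lambda>p. Phi (psubst l p))"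
  have psub: "psubst l p \<in> PC n" if "p \<in> PC N" for p by (rule psubst_PC[OF l(1) that])
  have psi_add: "\<psi> (p + q) = \<psi> p + \<psi> q" for p q by (simp add: \<psi>_def psubst_add Phi_add)
  have psi_0: "\<psi> 0 = 0" by (simp add: \<psi>_def)
  have psi_cmult: "\<psi> (mpoly_const c * p) = fps_const c * \<psi> p" for c p
    by (simp add: \<psi>_def psubst_cmult Phi_cmult)
  have psi_linear: "Vector_Spaces.linear (\<lambda>c p. mpoly_const c * p) (\<lambda>c f. fps_const c * f) \<psi>"
    by (simp add: Vector_Spaces.linear_iff mp.vector_space_axioms fv.vector_space_axioms psi_add psi_cmult)
  have psi_sum: "\<psi> (sum f A) = (\<Sum>x\<in>A. \<psi> (f x))" for f :: "nat \<Rightarrow> 'k mpoly" and A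
    by (induction A rule: infinite_finite_induct) (auto simp: psi_add psi_0)
  have agree_mon: "\<phi> (mnm m 1) = \<psi> (mnm m 1)" if "pkeys m \<subseteq> {..<N}" for m
    using that
  proof (induction rule: monomial_induct)
    case zero
    show ?case using const[rule_format, of 1] by (simp add: \<psi>_def)
  next
    case (add m i)
    have *: "mnm (m + mnm i 1) (1 :: 'k) = mnm m 1 * mnm (mnm i 1) 1" by (simp add: mult_single)
    have PC: "mnm m (1 :: 'k) \<in> PC N" "mnm (mnm i 1) (1 :: 'k) \<in> PC N" using add
      by (auto simp: PC_def)
    have "\<psi> (mnm (mnm i 1) 1) = \<phi> (mnm (mnm i 1) 1)" using l(2)[OF add(1)]
      by (simp add: \<psi>_def psubst_mnm)
    thus ?case unfolding * phi_mult[OF PC] add.IH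
      unfolding \<psi>_def psubst_mult by (simp add: Phi_mult psub PC del: One_nat_def)
  qed
  have agree: "\<phi> p = \<psi> p" if p: "p \<in> PC N" for p
  proof -
    have "p \<in> PC N \<and> \<phi> p = \<psi> p"
    proof (rule poly_induct[where r = p and P = "\<lambda>p. p \<in> PC N \<and> \<phi> p = \<psi> p"])
      show "0 \<in> PC N \<and> \<phi> 0 = \<psi> 0" using const[rule_format, of 0] by (simp add: \<psi>_def)
    next
      fix m c assume "m \<in> pkeys p"
      hence m: "pkeys m \<subseteq> {..<N}" using p by (auto simp: PC_def)
      hence "mnm m (1 :: 'k) \<in> PC N" by (simp add: PC_mono_iff)
      thus "mnm m c \<in> PC N \<and> \<phi> (mnm m c) = \<psi> (mnm m c)"
        using m agree_mon by (subst (2 3) mono_cmult) (simp add: phi_cmult psi_cmult PC_mono_iff)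
    qed (auto simp: phi_add psi_add)
    thus ?thesis by simp
  qed
  \<comment> \<open>Surjectivity is given only for the whole ring. The component in degree
    \<open>d\<close> of a preimage of \<open>a\<close> still maps to \<open>a\<close>, as the images
    of the other components live at exponents of other orders.\<close>
  have phi_im: "\<phi> ` HF N d = gr_comp d" for d
  proof (intro equalityI subsetI)
    fix a :: "'k fps" assume a: "a \<in> gr_comp d"
    then obtain p where p: "p \<in> PC N" "a = \<phi> p" using surj by (auto simp: gr_comp_def gr_ring_def)
    obtain K where K: "\<And>d. d > K \<Longrightarrow> hcomp d p = 0" "p = (\<Sum>e\<le>K. hcomp e p)" by (rule sum_hcomp) blast
    have hc: "\<psi> (hcomp e p) \<in> gr_comp e" for e
      using phi_HF[OF hcomp_HF[OF p(1)]] agree[OF mfilter_in_PC[OF p(1)]] by simp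
    have "a = \<psi> (hcomp d p)"
    proof (rule fps_ext)
      fix u
      show "fps_nth a u = fps_nth (\<psi> (hcomp d p)) u"
      proof (cases "ord u = d")
        case True
        have "a = (\<Sum>e\<le>K. \<psi> (hcomp e p))" using p agree[OF p(1)] K(2) psi_sum by metis
        hence "fps_nth a u = (\<Sum>e\<le>K. fps_nth (\<psi> (hcomp e p)) u)" by (simp add: fps_sum_nth)
        also have "\<dots> = (\<Sum>e\<le>K. if e = d then fps_nth (\<psi> (hcomp d p)) u else 0)"
          using hc True by (intro sum.cong) (auto simp: gr_comp_def)
        also have "\<dots> = fps_nth (\<psi> (hcomp d p)) u" using K(1)[of d] by (auto simp: \<psi>_def)
        finally show ?thesis .
      next
        case False
        have "fps_nth a u = 0" using a False unfolding gr_comp_def by blast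
        moreover have "fps_nth (\<psi> (hcomp d p)) u = 0" using hc[of d] False unfolding gr_comp_def
          by blast
        ultimately show ?thesis by simp
      qed
    qed
    hence "a = \<phi> (hcomp d p)" using agree[OF mfilter_in_PC[OF p(1)], of "\<lambda>m. mdeg m = d"] by simp
    thus "a \<in> \<phi> ` HF N d" using hcomp_HF[OF p(1), of d] by blast
  qed (use phi_HF in auto)
  have fsPC: "set fs \<subseteq> PC N" and wr: "wreg N fs" and proper: "idl N (set fs) \<noteq> PC N"
    using reg unfolding regular_sequence_def wreg_def by auto
  have kern': "idl N (set fs) = {p \<in> PC N. \<phi> p = 0}"
    unfolding kern[symmetric] a_kernel_def' by (simp add: gr_ring_def)
  note idealN = MP.is_ideal_genideal[OF fsPC]
  \<comment> \<open>A nonzero constant among the forms would generate the whole ring. The zero form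
    is homogeneous of every degree and may be given degree one.\<close>
  have "\<exists>d\<ge>1. f \<in> HF N d" if f: "f \<in> set fs" for f
  proof -
    obtain d where d: "f \<in> HF N d" using homog f fsPC by (auto simp: HF_def)
    show ?thesis
    proof (cases d)
      case 0
      have fc: "f = mpoly_const (coef f 0)"
      proof (rule poly_mapping_eqI)
        fix m
        have "coef f m = 0" if "m \<noteq> 0"
        proof (rule ccontr)
          assume "coef f m \<noteq> 0"
          hence "m \<in> monset N 0" using d by (auto simp: 0 HF_iff in_keys_iff subset_iff)
          thus False using that by (simp add: monset_def mdeg_eq_0)
        qed
        thus "coef f m = coef (mpoly_const (coef f 0)) m"
          by (auto simp: mpoly_const_def lookup_single when_def)
      qed
      show ?thesis
      proof (cases "coef f 0 = 0")
        case True
        hence "f = 0" using fc by simp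
        thus ?thesis by (intro exI[of _ 1]) simp
      next
        case False
        hence "mpoly_const (inverse (coef f 0)) * mpoly_const (coef f 0) = 1"
          by (simp add: mpoly_const_mult)
        hence inv: "mpoly_const (inverse (coef f 0)) * f = 1" unfolding fc[symmetric] .
        have "f \<in> idl N (set fs)" using MP.genideal_superset[OF fsPC] f by blast
        hence one: "1 \<in> idl N (set fs)" using MP.is_idealD(5)[OF idealN const_in_PC] inv by metis
        have "p \<in> idl N (set fs)" if "p \<in> PC N" for p using MP.is_idealD(5)[OF idealN that one]
          by simp
        thus ?thesis using proper MP.is_idealD(1)[OF idealN] by blast
      qed
    qed (use d in auto)
  qed
  then obtain \<delta> where \<delta>: "\<And>f. f \<in> set fs \<Longrightarrow> \<delta> f \<ge> 1 \<and> f \<in> HF N (\<delta> f)" by metis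
  define fds0 where "fds0 = map (\<lambda>f. (f, \<delta> f)) fs"
  have fst0: "map fst fds0 = fs" by (simp add: fds0_def comp_def)
  hence set0: "fst ` set fds0 = set fs" by (metis set_map)
  have forms0: "forms N fds0" using \<delta> by (auto simp: forms_def fds0_def)
  have "koszul fds0 * HP N = HU"
  proof -
    have "HS N (idl N (set fs)) = HU" unfolding kern'
      by (rule HS_kernel[OF psi_linear]) (auto simp: agree phi_im)
    thus ?thesis using HS_regular[OF forms0] wr by (simp add: set0 fst0)
  qed
  hence "(1 - fps_X) ^ N * HU = koszul fds0 * ((1 - fps_X) ^ N * HP N)" by (simp add: ac_simps)
  hence HU0: "(1 - fps_X) ^ N * HU = koszul fds0" by (simp add: HP_inverse)
  define fds1 where "fds1 = map (\<lambda>x. (psubst l (fst x), snd x)) fds0"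
  define fds where "fds = filter (\<lambda>x. snd x \<ge> 2) fds1"
  define a where "a = length (filter (\<lambda>x. snd x = 1) fds1)"
  have k1: "koszul fds1 = koszul fds0" by (simp add: fds1_def koszul_def comp_def)
  have HF1: "f \<in> HF n d \<and> d \<ge> 1 \<and> f \<in> ker" if fd: "(f, d) \<in> set fds1" for f d
  proof -
    obtain g where g: "g \<in> set fs" "f = psubst l g" "d = \<delta> g" using fd
      by (auto simp: fds1_def fds0_def)
    have "\<phi> g = 0" "g \<in> PC N" using g(1) MP.genideal_superset[OF fsPC] kern' by auto
    hence "Phi f = 0" "f \<in> PC n" using agree[of g] psub[of g] by (auto simp: g(2) \<psi>_def)
    moreover have "psubst l g \<in> HF n (\<delta> g)"
      by (rule psubst_HF[where N = N]) (use l(1) \<delta>[OF g(1)] in auto)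
    ultimately show ?thesis using \<delta>[OF g(1)] g by (simp add: ker_def)
  qed
  have kz: "koszul fds1 = (1 - fps_X) ^ a * koszul fds"
    unfolding a_def fds_def
  proof (rule koszul_filter)
    fix x assume "x \<in> set fds1"
    thus "snd x \<ge> 1" using HF1[of "fst x" "snd x"] by simp
  qed
  have eq: "(1 - fps_X) ^ N * HU = (1 - fps_X) ^ a * koszul fds" using HU0 k1 kz by simp
  have kn: "fps_nth (koszul fds) 0 = 1" "fps_nth (koszul fds) (Suc 0) = 0"
    by (rule koszul_nth_0; simp add: fds_def)+
  \<comment> \<open>The linear coefficient of \<open>HU\<close> is the number \<open>n\<close> of
    generators, while \<open>koszul fds\<close> has constant coefficient 1 and linear coefficient
    0.\<close>
  have "fps_nth ((1 - fps_X) ^ N * HU) (Suc 0) = int n - int N"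
    by (simp add: fps_mult_nth HU_nth one_minus_X_power_nth)
  moreover have "fps_nth ((1 - fps_X) ^ a * koszul fds) (Suc 0) = - int a"
    by (simp add: fps_mult_nth kn one_minus_X_power_nth)
  ultimately have "N = a + n" using eq by simp
  hence "(1 - fps_X) ^ a * ((1 - fps_X) ^ n * HU) = (1 - fps_X) ^ a * koszul fds"
    using eq by (simp add: power_add mult.assoc)
  moreover have "(1 - fps_X :: int fps) ^ a \<noteq> 0" using one_minus_X_power_nth(1)[of a]
    by (metis fps_zero_nth zero_neq_one)
  ultimately have HU: "(1 - fps_X) ^ n * HU = koszul fds" by (metis mult_left_cancel)
  have F1: "fst ` set fds1 \<subseteq> PC n" using HF1 HF_PC by force
  have F: "fst ` set fds \<subseteq> PC n" using F1 by (auto simp: fds_def)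
  have sub: "fst ` set fds1 \<subseteq> idl n (fst ` set fds)"
  proof
    fix f assume "f \<in> fst ` set fds1"
    then obtain d where d: "(f, d) \<in> set fds1" by auto
    show "f \<in> idl n (fst ` set fds)"
    proof (cases "d \<ge> 2")
      case True
      hence "f \<in> fst ` set fds" using d by (force simp: fds_def)
      thus ?thesis using MP.genideal_superset[OF F] by blast
    next
      case False
      hence "d = 1" using HF1[OF d] by simp
      hence "f = 0" using HF1[OF d] Phi_inj_HF1[of f] by (simp add: ker_def)
      thus ?thesis using MP.is_idealD(3)[OF MP.is_ideal_genideal[OF F]] by simp
    qed
  qed
  \<comment> \<open>\<open>Phi\<close> is injective on linear forms, so a linear form
    \<open>r\<close> whose image under \<open>\<phi>\<close> is that of a variable under
    \<open>Phi\<close> is sent by the substitution to this variable.\<close>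
  have onto: "\<exists>q\<in>PC N. psubst l q = p" if p: "p \<in> PC n" for p
  proof (rule poly_induct[where r = p and P = "\<lambda>p. \<exists>q\<in>PC N. psubst l q = p"])
    show "\<exists>q\<in>PC N. psubst l q = 0" by (intro bexI[of _ 0]) auto
  next
    fix p q assume "\<exists>q\<in>PC N. psubst l q = p" "\<exists>r\<in>PC N. psubst l r = q"
    thus "\<exists>r\<in>PC N. psubst l r = p + q" using psubst_add MP.add_C by metis
  next
    fix m c assume "m \<in> pkeys p"
    hence "pkeys m \<subseteq> {..<n}" using p by (auto simp: PC_def)
    hence "\<exists>q\<in>PC N. psubst l q = mnm m 1"
    proof (induction rule: monomial_induct)
      case zero show ?case by (intro bexI[of _ 1]) auto
    next
      case (add m i)
      then obtain q where q: "q \<in> PC N" "psubst l q = mnm m 1" by auto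
      have xi: "mnm (mnm i 1) (1 :: 'k) \<in> HF n 1" using add(1) by (auto simp: HF_iff monset_def)
      have "Phi (mnm (mnm i 1) (1 :: 'k)) \<in> gr_comp 1" using xi by (rule Phi_HF)
      then obtain r where r: "r \<in> HF N 1" "\<phi> r = Phi (mnm (mnm i 1) 1)" unfolding phi_im[symmetric]
        by force
      have "psubst l r - mnm (mnm i 1) 1 \<in> HF n 1"
        by (rule mp.subspace_diff[OF HF_subspace _ xi], rule psubst_HF[where N = N]) (use l(1) r(1) in auto)
      moreover have "Phi (psubst l r - mnm (mnm i 1) 1) = 0"
        using r agree[OF HF_PC[OF r(1)]] Phi_add[of "psubst l r - mnm (mnm i 1) 1" "mnm (mnm i 1) 1"] by (simp add: \<psi>_def)
      ultimately have "psubst l r - mnm (mnm i 1) 1 = 0" by (rule Phi_inj_HF1)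
      hence "psubst l (q * r) = mnm (m + mnm i 1) 1" using q by (simp add: psubst_mult mult_single)
      thus ?case using q r HF_PC MP.mult_C by metis
    qed
    then obtain q where "q \<in> PC N" "psubst l q = mnm m 1" by blast
    thus "\<exists>q\<in>PC N. psubst l q = mnm m c"
      by (intro bexI[of _ "mpoly_const c * q"]) (auto simp: psubst_cmult mono_cmult[of m c])
  qed
  have "idl n (fst ` set fds) = ker"
  proof
    have "fst ` set fds \<subseteq> ker" using HF1 by (force simp: fds_def)
    thus "idl n (fst ` set fds) \<subseteq> ker" by (rule MP.genideal_least[OF ker_ideal])
    note I = MP.is_ideal_genideal[OF F]
    \<comment> \<open>The preimage of the ideal under the substitution contains \<open>fs\<close>,
      hence the whole kernel of \<open>\<phi>\<close>. As the substitution is onto, this carries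
      over to \<open>ker\<close>.\<close>
    have J: "MP.is_ideal N {q \<in> PC N. psubst l q \<in> idl n (fst ` set fds)}"
      unfolding MP.is_ideal_def using MP.is_idealD[OF I] psub
      by (auto simp: psubst_add psubst_mult)
    have "set fs \<subseteq> {q \<in> PC N. psubst l q \<in> idl n (fst ` set fds)}"
    proof
      fix f assume f: "f \<in> set fs"
      hence "(psubst l f, \<delta> f) \<in> set fds1" by (auto simp: fds1_def fds0_def)
      hence "psubst l f \<in> fst ` set fds1" by force
      thus "f \<in> {q \<in> PC N. psubst l q \<in> idl n (fst ` set fds)}" using f fsPC sub by blast
    qed
    hence J': "idl N (set fs) \<subseteq> {q \<in> PC N. psubst l q \<in> idl n (fst ` set fds)}"
      by (rule MP.genideal_least[OF J])
    show "ker \<subseteq> idl n (fst ` set fds)"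
    proof
      fix p :: "'k mpoly" assume "p \<in> ker"
      then obtain q where q: "q \<in> PC N" "psubst l q = p" "Phi p = 0" using onto
        by (auto simp: ker_def)
      hence "q \<in> idl N (set fs)" using agree[OF q(1)] by (simp add: kern' \<psi>_def)
      thus "p \<in> idl n (fst ` set fds)" using J' q(2) by blast
    qed
  qed
  moreover have "\<forall>(f, d)\<in>set fds. f \<in> HF n d \<and> d \<ge> 2" using HF1 by (auto simp: fds_def)
  ultimately show ?thesis unfolding CI_data_def using HU by blast
qed

theorem gr_CI_iff_CI_data:
  "gr_semigroup_ring_CI TYPE('k::field) U \<longleftrightarrow> (\<exists>fds :: ('k mpoly \<times> nat) list. CI_data fds)"
  unfolding gr_CI_iff_gr_ring using CI_data_imp_CI CI_imp_CI_data by blast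

end

section \<open>The complete intersection property of the duplication\<close>

text \<open>Each factor 1 - X^d is 1 - X times a polynomial, the sum of the powers of X below
  d.\<close>

lemma koszul_poly: "\<exists>q. koszul fds = (1 - fps_X) ^ length fds * fps_of_poly q"
proof (induction fds)
  case Nil show ?case by (intro exI[of _ 1]) simp
next
  case (Cons x fds)
  then obtain q where q: "koszul fds = (1 - fps_X) ^ length fds * fps_of_poly q" by blast
  have "1 - fps_X ^ snd x = (1 - fps_X) * fps_of_poly (\<Sum>i<snd x. [:0, 1:] ^ i :: int poly)"
    by (simp add: one_diff_power_eq fps_of_poly_sum fps_of_poly_power)
  thus ?case using q
    by (intro exI[of _ "(\<Sum>i<snd x. [:0, 1:] ^ i) * q"]) (simp add: fps_of_poly_mult mult.assoc mult.left_commute)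
qed

lemma (in num_semigroup) HU_pos: "fps_nth HU d > 0"
proof -
  have "d * mu \<in> {u \<in> U. ord u = d}" using mult_in[OF mu_in] ord_mult_mu by simp
  hence "card {u \<in> U. ord u = d} > 0" using finite_ord[of d] card_gt_0_iff by blast
  thus ?thesis by (simp add: HU_def)
qed

text \<open>With at least \<open>n\<close> forms the factors 1 - X would cancel the denominator of
  \<open>HU\<close> and leave a polynomial, but all coefficients of \<open>HU\<close> are
  positive.\<close>

lemma (in enumerated_semigroup) CI_data_length: assumes "CI_data fds" shows "length fds < n"
proof (rule ccontr)
  assume "\<not> length fds < n"
  then obtain k where k: "length fds = n + k" by (metis le_Suc_ex not_less)
  obtain q where q: "koszul fds = (1 - fps_X) ^ length fds * fps_of_poly q" using koszul_poly
    by blast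
  have "(1 - fps_X) ^ n * HU = (1 - fps_X) ^ n * ((1 - fps_X) ^ k * fps_of_poly q)"
    using assms q by (simp add: CI_data_def k power_add mult.assoc)
  moreover have "(1 - fps_X :: int fps) ^ n \<noteq> 0" using one_minus_X_power_nth(1)[of n]
    by (metis fps_zero_nth zero_neq_one)
  ultimately have "HU = (1 - fps_X) ^ k * fps_of_poly q" by (metis mult_left_cancel)
  also have "\<dots> = fps_of_poly ([:1, -1:] ^ k * q)"
    by (simp add: fps_of_poly_mult fps_of_poly_power fps_of_poly_pCons)
  finally have "fps_nth HU (Suc (degree ([:1, -1:] ^ k * q))) = 0"
    by (simp add: coeff_eq_0)
  thus False using HU_pos by (metis less_irrefl)
qed

text \<open>Generators of degree above two do not reach degree two, and quadrics enter there with
  constant coefficients. Ideal membership of quadrics thus becomes linear algebra, where basis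
  exchange is available.\<close>

lemma hcomp_2_in_span:
  assumes "\<And>f d. (f, d) \<in> set fds \<Longrightarrow> f \<in> HF n d \<and> d \<ge> 2" and "q \<in> idl n (fst ` set fds)"
  shows "hcomp 2 q \<in> mp.span {f. (f, 2) \<in> set fds}"
  using assms
proof (induction fds arbitrary: q)
  case Nil thus ?case by (simp add: MP.genideal_empty mp.span_zero)
next
  case (Cons y fds)
  obtain f d where y: "y = (f, d)" by force
  have fd: "f \<in> HF n d" "d \<ge> 2" using Cons.prems(1) by (auto simp: y)
  have "fst ` set (y # fds) \<subseteq> PC n" using Cons.prems(1) HF_PC by force
  hence "idl n (fst ` set (y # fds)) = {x + a * f | x a. x \<in> idl n (fst ` set fds) \<and> a \<in> PC n}"
    using MP.genideal_insert[of f "fst ` set fds" n] by (simp add: y)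
  then obtain x a where xa: "q = x + a * f" "x \<in> idl n (fst ` set fds)" using Cons.prems(2) by blast
  have "hcomp 2 x \<in> mp.span {f. (f, 2) \<in> set fds}"
    by (rule Cons.IH[OF _ xa(2)], rule Cons.prems(1)) simp
  hence x: "hcomp 2 x \<in> mp.span {f. (f, 2) \<in> set (y # fds)}"
    using mp.span_mono[of "{f. (f, 2) \<in> set fds}" "{f. (f, 2) \<in> set (y # fds)}"] by auto
  have "hcomp 2 (a * f) \<in> mp.span {f. (f, 2) \<in> set (y # fds)}"
  proof (cases "d = 2")
    case True
    have c: "hcomp 0 a = mpoly_const (coef a 0)"
      by (rule poly_mapping_eqI) (auto simp: mpoly_const_def lookup_single when_def mdeg_eq_0)
    have eq: "hcomp 2 (a * f) = mpoly_const (coef a 0) * f" using hcomp_mult[OF fd(1), of 0 a]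
      by (simp only: True c add_0)
    show ?thesis unfolding eq by (intro mp.span_scale mp.span_base) (simp add: y True)
  next
    case False
    thus ?thesis using hcomp_mult_less[OF fd(1), of 2 a] fd(2) by (simp add: mp.span_zero)
  qed
  thus ?case using x xa(1) by (simp add: mfilter_add mp.span_add)
qed

locale enumerated_duplication = semigroup_duplication S E T b + ES: enumerated_semigroup S p G
  for S E T :: "nat set" and b p :: nat and G :: "nat \<Rightarrow> nat" +
  fixes r :: nat and H :: "nat \<Rightarrow> nat"
  assumes enum_odd: "bij_betw H {..<r} odd_gens"
begin

text \<open>Even generators come before odd ones, so that polynomials for \<open>S\<close> are
  literally the polynomials for \<open>T\<close> in the first \<open>p\<close> variables.\<close>

definition GT :: "nat \<Rightarrow> nat" where
  "GT i = (if i < p then 2 * G i else H (i - p))"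

lemma GT_bij: "bij_betw GT {..<p + r} T.gens"
proof -
  have "bij_betw GT ({..<p} \<union> {p..<p + r}) ((*) 2 ` S.gens \<union> odd_gens)"
  proof (rule bij_betw_combine)
    have "bij_betw ((*) 2 \<circ> G) {..<p} ((*) 2 ` S.gens)"
      by (rule bij_betw_trans[OF ES.enum]) (auto simp: bij_betw_def inj_on_def)
    thus "bij_betw GT {..<p} ((*) 2 ` S.gens)"
      by (rule bij_betw_cong[THEN iffD1, rotated]) (simp add: GT_def)
    have "bij_betw (\<lambda>i. i - p) {p..<p + r} {..<r}"
      by (rule bij_betw_byWitness[where f' = "\<lambda>i. i + p"]) auto
    hence "bij_betw (H \<circ> (\<lambda>i. i - p)) {p..<p + r} odd_gens" using enum_odd by (rule bij_betw_trans)
    thus "bij_betw GT {p..<p + r} odd_gens"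
      by (rule bij_betw_cong[THEN iffD1, rotated]) (simp add: GT_def)
    show "(*) 2 ` S.gens \<inter> odd_gens = {}" by auto
  qed
  moreover have "{..<p} \<union> {p..<p + r} = {..<p + r}" by auto
  ultimately show ?thesis by (simp add: gens_T)
qed

sublocale ET: enumerated_semigroup T "p + r" GT
  by unfold_locales (rule GT_bij)

lemma GT_odd: assumes "p \<le> i" "i < p + r" shows "odd (GT i)"
proof -
  have "H (i - p) \<in> odd_gens" using enum_odd assms by (auto simp: bij_betw_def)
  thus ?thesis using odd_gensD assms by (simp add: GT_def)
qed

lemma val_T: "pkeys m \<subseteq> {..<p} \<Longrightarrow> ET.val m = 2 * ES.val m"
  unfolding ET.val_def ES.val_def sum_distrib_left by (rule sum.cong) (auto simp: GT_def)

lemma maxm_T: "pkeys m \<subseteq> {..<p} \<Longrightarrow> ET.maxm m \<longleftrightarrow> ES.maxm m"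
  using ES.val_in_ord[of m] by (simp add: ET.maxm_def ES.maxm_def val_T ord_T_even)

text \<open>If the value were even, removing one odd variable would leave an odd value, and by
  \<open>ord_odd_odd\<close> the order would exceed the degree.\<close>

lemma maxm_T_odd:
  assumes m: "pkeys m \<subseteq> {..<p + r}" "\<not> pkeys m \<subseteq> {..<p}" "ET.maxm m"
  shows "odd (ET.val m)"
proof
  assume even: "even (ET.val m)"
  obtain i where i: "i \<in> pkeys m" "p \<le> i" "i < p + r" using m by force
  then obtain m' where m': "m = m' + mnm i 1" using mono_split[of m i] by (auto simp: in_keys_iff)
  have k: "pkeys m' \<subseteq> {..<p + r}" using m(1) by (auto simp: m' keys_add_nat)
  note v = ET.val_in_ord[OF k]
  have "odd (GT i)" "GT i \<in> T" using GT_odd i T.gens_subset ET.G_gens by auto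
  moreover from this have "odd (ET.val m')" using even by (simp add: m')
  ultimately have "T.ord (GT i) + T.ord (ET.val m') < T.ord (GT i + ET.val m')"
    using v by (intro ord_odd_odd) auto
  moreover have "T.ord (GT i) = 1" using T.ord_gen ET.G_gens i by blast
  ultimately show False using m(3) v by (simp add: ET.maxm_def m' add.commute)
qed

text \<open>Sets the odd variables to zero: a ring homomorphism (\<open>rho_mult\<close>) and a
  retraction onto the polynomials for \<open>S\<close> (\<open>rho_id\<close>).\<close>

abbreviation rho :: "'k::field mpoly \<Rightarrow> 'k mpoly" where
  "rho \<equiv> mfilter (\<lambda>m. pkeys m \<subseteq> {..<p})"

lemma rho_PC: "rho q \<in> PC p"
  by (auto simp: PC_def)

lemma PC_mono: "q \<in> PC p \<Longrightarrow> q \<in> PC (p + r)"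
  by (force simp: PC_def)

lemma rho_id: "q \<in> PC p \<Longrightarrow> rho q = q"
  by (rule mfilter_id) (auto simp: PC_def)

lemma rho_mult: "rho (q * q') = rho q * rho q'"
proof -
  let ?N = "mfilter (\<lambda>m. \<not> pkeys m \<subseteq> {..<p})"
  have 1: "rho (rho q * rho q') = rho q * rho q'" by (intro rho_id MP.mult_C rho_PC)
  have 2: "rho (?N q * x) = 0" "rho (x * ?N q) = 0" for x q
    by (rule mfilter_none, auto elim!: keys_mult_E simp: keys_add_nat)+
  have "q * q' = rho q * rho q' + (rho q * ?N q' + ?N q * q')"
    using mfilter_split[of q "\<lambda>m. pkeys m \<subseteq> {..<p}"] mfilter_split[of q' "\<lambda>m. pkeys m \<subseteq> {..<p}"]
    by (metis (no_types, lifting) add.assoc distrib_left distrib_right)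
  hence "rho (q * q') = rho (rho q * rho q' + (rho q * ?N q' + ?N q * q'))" by (rule arg_cong)
  also have "\<dots> = rho q * rho q'" by (simp only: mfilter_add 1 2 add_0_right)
  finally show ?thesis .
qed

lemma rho_HF: "q \<in> HF (p + r) d \<Longrightarrow> rho q \<in> HF p d"
  by (auto simp: HF_iff monset_def)

lemma HF_mono: "q \<in> HF p d \<Longrightarrow> q \<in> HF (p + r) d"
  by (force simp: HF_iff monset_def)

text \<open>Maximal monomials with an odd variable have odd value, so even exponents see only the
  even variables. Together with \<open>Phi_T_odd\<close> this compares the two kernels in both
  directions.\<close>

lemma Phi_rho:
  assumes "q \<in> PC (p + r)"
  shows "fps_nth (ES.Phi (rho q)) s = fps_nth (ET.Phi q) (2 * s)"
  unfolding ES.Phi_nth ET.Phi_nth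
proof (rule sum.mono_neutral_cong_left)
  show "\<forall>m\<in>pkeys q - pkeys (rho q). (if ET.maxm m \<and> ET.val m = 2 * s then coef q m else 0) = 0"
  proof
    fix m assume m: "m \<in> pkeys q - pkeys (rho q)"
    hence "pkeys m \<subseteq> {..<p + r}" "\<not> pkeys m \<subseteq> {..<p}" using assms by (auto simp: PC_def)
    thus "(if ET.maxm m \<and> ET.val m = 2 * s then coef q m else 0) = 0"
      using maxm_T_odd[of m] by auto
  qed
qed (auto simp: val_T maxm_T)

lemma Phi_T_odd: assumes "q \<in> PC p" "odd u" shows "fps_nth (ET.Phi q) u = 0"
  unfolding ET.Phi_nth
proof (rule sum.neutral, rule ballI)
  fix m assume "m \<in> pkeys q"
  hence "ET.val m = 2 * ES.val m" using assms by (intro val_T) (auto simp: PC_def)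
  thus "(if ET.maxm m \<and> ET.val m = u then coef q m else 0) = 0" using assms(2) by auto
qed

lemma rho_ker: "q \<in> ET.ker \<Longrightarrow> rho q \<in> ES.ker"
  using rho_PC Phi_rho[of q] by (auto simp: ET.ker_def ES.ker_def fps_eq_iff)

lemma ker_mono: assumes "q \<in> ES.ker" shows "q \<in> ET.ker"
proof -
  have q: "q \<in> PC p" "ES.Phi q = 0" using assms by (auto simp: ES.ker_def)
  have "fps_nth (ET.Phi q) u = 0" for u
  proof (cases "even u")
    case True
    then obtain s where "u = 2 * s" by auto
    thus ?thesis using Phi_rho[OF PC_mono[OF q(1)], of s] q by (simp add: rho_id)
  qed (use Phi_T_odd q in auto)
  thus ?thesis using PC_mono[OF q(1)] by (simp add: ET.ker_def fps_eq_iff)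
qed

lemma odd_mon_ker:
  assumes "p \<le> i" "i < p + r" "p \<le> j" "j < p + r"
  shows "mnm (mnm i 1 + mnm j 1) 1 \<in> (ET.ker :: 'k::field mpoly set)"
proof -
  let ?m = "mnm i 1 + mnm j 1 :: nat \<Rightarrow>\<^sub>0 nat"
  have k: "pkeys ?m = {i, j}" by (auto simp: keys_add_nat)
  have "even (ET.val ?m)" using GT_odd assms by simp
  hence "\<not> ET.maxm ?m" using maxm_T_odd[of ?m] assms k by auto
  thus ?thesis using k assms by (simp add: ET.ker_def ET.Phi_mnm ET.phim_def PC_mono_iff)
qed

end

section \<open>The duplication with a single odd generator\<close>

context semigroup_duplication
begin

text \<open>Here every \<open>f \<in> E\<close> is \<open>e + v\<close> with
  \<open>v \<in> S\<close>. A decomposition \<open>e + s = f + t\<close> gives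
  \<open>s = v + t\<close>, hence \<open>S.ord t \<le> S.ord s\<close>, which turns the lower bound
  \<open>ord_T_odd_ge\<close> into an equality.\<close>

lemma odd_gens_singleton:
  assumes o: "odd_gens = {z}"
  shows "\<And>s. s \<in> S \<Longrightarrow> 2 * s + z \<in> T \<and> T.ord (2 * s + z) = Suc (S.ord s)"
    and "\<And>x. \<lbrakk>x \<in> T; odd x\<rbrakk> \<Longrightarrow> \<exists>s\<in>S. x = 2 * s + z"
proof -
  have "z \<in> T" "odd z" using o odd_gensD T.gens_subset by auto
  then obtain e where e: "e \<in> E" "z = 2 * e + b" using odd_T by blast
  have gen: "\<exists>s\<in>S. f = e + s" if "f \<in> E" for f using E_generated[OF that] o e by auto
  show "\<exists>s\<in>S. x = 2 * s + z" if x: "x \<in> T" "odd x" for x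
  proof -
    obtain f where f: "f \<in> E" "x = 2 * f + b" using odd_T[OF x] by blast
    thus ?thesis using gen[OF f(1)] e by auto
  qed
  show "2 * s + z \<in> T \<and> T.ord (2 * s + z) = Suc (S.ord s)" if s: "s \<in> S" for s
  proof -
    have eq: "2 * s + z = 2 * (e + s) + b" using e by simp
    have es: "e + s \<in> E" using E_add e s by blast
    obtain f t where ft: "f \<in> E" "t \<in> S" "e + s = f + t" "T.ord (2 * (e + s) + b) \<le> Suc (S.ord t)"
      using ord_T_odd_le[OF es] by blast
    obtain v where v: "v \<in> S" "f = e + v" using gen ft by blast
    have "S.ord t \<le> S.ord s" using S.ord_add[OF v(1) ft(2)] ft(3) v(2) by simp
    hence "T.ord (2 * (e + s) + b) = Suc (S.ord s)" using ord_T_odd_ge[OF e(1) s] ft(4) by linarith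
    moreover have "2 * (e + s) + b \<in> T" by (rule odd_in_iff[THEN iffD2, OF es])
    ultimately show ?thesis unfolding eq by blast
  qed
qed

text \<open>Splitting by parity: \<open>2 * s\<close> keeps the order of \<open>s\<close>, and
  \<open>2 * s + z\<close> raises it by one. The factor 1 + X is (1 - X^2)/(1 - X), the contribution
  of one new variable with square zero.\<close>

lemma HU_T: assumes o: "odd_gens = {z}" shows "T.HU = (1 + fps_X) * S.HU"
proof (rule fps_ext)
  fix d
  note s = odd_gens_singleton[OF o]
  have oz: "odd z" using o odd_gensD by auto
  have "{u \<in> T. T.ord u = d} = (*) 2 ` {s \<in> S. S.ord s = d} \<union> (\<lambda>s. 2 * s + z) ` {s \<in> S. Suc (S.ord s) = d}" (is "_ = ?A \<union> ?B")
  proof (intro equalityI subsetI)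
    fix u assume u: "u \<in> {u \<in> T. T.ord u = d}"
    show "u \<in> ?A \<union> ?B"
    proof (cases "even u")
      case True
      then obtain t where "t \<in> S" "u = 2 * t" using even_T u by blast
      thus ?thesis using u by (auto simp: ord_T_even)
    next
      case False
      then obtain t where "t \<in> S" "u = 2 * t + z" using s(2)[of u] u by blast
      thus ?thesis using u s(1)[of t] by auto
    qed
  next
    fix u assume "u \<in> ?A \<union> ?B"
    thus "u \<in> {u \<in> T. T.ord u = d}" using s(1) by (auto simp: ord_T_even)
  qed
  moreover have fin: "finite {s \<in> S. Suc (S.ord s) = d}"
    by (cases d) (auto simp: S.finite_ord)
  moreover have "?A \<inter> ?B = {}" using oz by (auto, presburger)
  moreover have "card ?A = card {s \<in> S. S.ord s = d}" "card ?B = card {s \<in> S. Suc (S.ord s) = d}"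
    by (intro card_image; simp add: inj_on_def)+
  ultimately have "card {u \<in> T. T.ord u = d} = card {s \<in> S. S.ord s = d} + card {s \<in> S. Suc (S.ord s) = d}"
    by (simp add: card_Un_disjoint)
  thus "fps_nth T.HU d = fps_nth ((1 + fps_X) * S.HU) d"
    by (cases d) (simp_all add: T.HU_def S.HU_def distrib_right)
qed

end

context enumerated_duplication
begin

section \<open>Exchange of relations for products of odd variables\<close>

lemma r_eq: "r = card odd_gens"
  using bij_betw_same_card[OF enum_odd] by simp

lemma r_pos: "r \<ge> 1"
  using odd_gens_ne by (simp add: r_eq card_gt_0_iff Suc_leI)

text \<open>The squares of the odd variables and, for \<open>r \<ge> 2\<close>, one mixed product.
  The surplus of one over \<open>r\<close> excludes several odd variables; for \<open>r = 1\<close>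
  the single square is the expected new relation.\<close>

definition odd_quadrics :: "(nat \<Rightarrow>\<^sub>0 nat) set" where
  "odd_quadrics = (\<lambda>i. mnm i 1 + mnm i 1) ` {p..<p + r} \<union> (if r \<ge> 2 then {mnm p 1 + mnm (Suc p) 1} else {})"

lemma keys_square: "pkeys (mnm i (Suc 0) + mnm j (Suc 0)) = {i, j}"
  by (auto simp: keys_add_nat)

lemma card_odd_quadrics: "card odd_quadrics = r + (if r \<ge> 2 then 1 else 0)"
proof -
  have "inj_on (\<lambda>i. mnm i 1 + mnm i 1 :: nat \<Rightarrow>\<^sub>0 nat) {p..<p + r}"
  proof (rule inj_onI)
    fix i j assume "mnm i 1 + mnm i 1 = (mnm j 1 + mnm j 1 :: nat \<Rightarrow>\<^sub>0 nat)"
    hence "pkeys (mnm i 1 + mnm i 1 :: nat \<Rightarrow>\<^sub>0 nat) = pkeys (mnm j 1 + mnm j 1 :: nat \<Rightarrow>\<^sub>0 nat)"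
      by simp
    thus "i = j" by (simp add: keys_square)
  qed
  hence c: "card ((\<lambda>i. mnm i 1 + mnm i 1 :: nat \<Rightarrow>\<^sub>0 nat) ` {p..<p + r}) = r"
    by (simp add: card_image)
  have "mnm p 1 + mnm (Suc p) 1 \<notin> (\<lambda>i. mnm i 1 + mnm i 1 :: nat \<Rightarrow>\<^sub>0 nat) ` {p..<p + r}"
  proof
    assume "mnm p 1 + mnm (Suc p) 1 \<in> (\<lambda>i. mnm i 1 + mnm i 1 :: nat \<Rightarrow>\<^sub>0 nat) ` {p..<p + r}"
    then obtain i where "mnm p 1 + mnm (Suc p) 1 = (mnm i 1 + mnm i 1 :: nat \<Rightarrow>\<^sub>0 nat)" by blast
    hence "pkeys (mnm p 1 + mnm (Suc p) 1 :: nat \<Rightarrow>\<^sub>0 nat) = pkeys (mnm i 1 + mnm i 1 :: nat \<Rightarrow>\<^sub>0 nat)" by simp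
    hence "{p, Suc p} = {i, i}" by (simp only: keys_square One_nat_def)
    hence "p \<in> {i, i}" "Suc p \<in> {i, i}" by (metis insertCI)+
    thus False by simp
  qed
  thus ?thesis using c by (simp add: odd_quadrics_def)
qed

lemma finite_odd_quadrics [simp]: "finite odd_quadrics"
  by (simp add: odd_quadrics_def)

lemma odd_quadricE:
  assumes "m \<in> odd_quadrics"
  obtains i j where "p \<le> i" "i < p + r" "p \<le> j" "j < p + r" "m = mnm i 1 + mnm j 1"
proof -
  consider i where "i \<in> {p..<p + r}" "m = mnm i 1 + mnm i 1" | "r \<ge> 2" "m = mnm p 1 + mnm (Suc p) 1"
    using assms by (auto simp: odd_quadrics_def split: if_splits)
  thus ?thesis
  proof cases
    case (1 i) thus ?thesis using that[of i i] by simp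
  next
    case 2 thus ?thesis using that[of p "Suc p"] by simp
  qed
qed

text \<open>Products of two odd variables vanish in the associated graded ring. They are linearly
  independent quadrics, so by exchange they replace as many of the given relations; the remaining
  relations, restricted to the even variables, still generate the ideal of \<open>S\<close>, which needs at least
  \<open>p - 1\<close> generators. This forces a single odd variable.\<close>

lemma CI_data_T_imp:
  assumes CI: "ET.CI_data (fds :: ('k::field mpoly \<times> nat) list)"
  shows "r = 1" and "\<exists>gs :: ('k mpoly \<times> nat) list. ES.CI_data gs"
proof -
  let ?n = "p + r"
  have fd: "f \<in> HF ?n d \<and> d \<ge> 2" if "(f, d) \<in> set fds" for f d using CI that
    by (auto simp: ET.CI_data_def)
  have idl: "idl ?n (fst ` set fds) = ET.ker" and HUT: "(1 - fps_X) ^ ?n * T.HU = koszul fds"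
    using CI by (auto simp: ET.CI_data_def)
  have FPC: "fst ` set fds \<subseteq> PC ?n" using fd HF_PC by force
  define A2 A3 where "A2 = {x \<in> set fds. snd x = 2}" and "A3 = {x \<in> set fds. snd x \<ge> 3}"
  define F2 where "F2 = {f. (f, 2) \<in> set fds}"
  define Y where "Y = (\<lambda>m. mnm m (1 :: 'k)) ` odd_quadrics"
  have F2: "F2 = fst ` A2" by (force simp: F2_def A2_def)
  have A23: "set fds = A2 \<union> A3" "A2 \<inter> A3 = {}" "finite A2" "finite A3"
    using fd by (force simp: A2_def A3_def)+
  have cF2: "card F2 = card A2" unfolding F2 by (rule card_image) (auto simp: A2_def inj_on_def)
  have finF2: "finite F2" by (simp add: F2 A23)
  have cY: "card Y = r + (if r \<ge> 2 then 1 else 0)"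
    unfolding Y_def by (simp add: card_image[OF inj_monos] card_odd_quadrics)
  have Yker: "Y \<subseteq> ET.ker" using odd_mon_ker by (auto simp: Y_def elim!: odd_quadricE)
  have YHF: "Y \<subseteq> HF ?n 2" by (auto simp: Y_def HF_iff monset_def keys_square elim!: odd_quadricE)
  have "Y \<subseteq> mp.span F2"
  proof
    fix y assume y: "y \<in> Y"
    hence "hcomp 2 y \<in> mp.span F2" unfolding F2_def
      by (intro hcomp_2_in_span[where n = ?n] fd) (use y Yker idl in auto)
    thus "y \<in> mp.span F2" using y YHF hcomp_id[of y ?n 2] by auto
  qed
  moreover have "mp.independent Y" unfolding Y_def by (rule independent_monos)
  \<comment> \<open>Exchange: \<open>Y\<close> is extended by elements of \<open>F2\<close> to a
    basis of the span of \<open>F2\<close>. The added elements form \<open>C\<close> below, so there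
    are at most \<open>card F2 - card Y\<close> of them.\<close>
  ultimately obtain t where t: "Y \<subseteq> t" "t \<subseteq> Y \<union> F2" "mp.independent t" "Y \<union> F2 \<subseteq> mp.span t"
    using mp.maximal_independent_subset_extend[of Y "Y \<union> F2"] by blast
  have "t \<subseteq> mp.span F2" using t(2) \<open>Y \<subseteq> mp.span F2\<close> mp.span_superset[of F2] by blast
  hence ct: "finite t" "card t \<le> card F2" using mp.independent_span_bound[OF finF2 t(3)] by auto
  define C where "C = t - Y"
  have C: "C \<subseteq> F2" "finite C" "card C + card Y \<le> card F2"
    using t ct card_mono[OF ct(1) t(1)] card_Diff_subset[OF finite_subset[OF t(1) ct(1)] t(1)]
    by (auto simp: C_def)
  define P where "P = C \<times> {2} \<union> A3"
  have finP: "finite P" using C A23 by (simp add: P_def)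
  have cP: "card P = card C + card A3"
    unfolding P_def using C A23
      by (subst card_Un_disjoint) (auto simp: A3_def card_cartesian_product)
  have Psub: "P \<subseteq> set fds" using C(1) A23 by (auto simp: P_def F2_def)
  obtain xs where xs: "set xs = P" "distinct xs" using finite_distinct_list[OF finP] by blast
  define gs where "gs = map (\<lambda>x. (rho (fst x), snd x)) xs"
  have len: "length gs = card P" using xs by (simp add: gs_def distinct_card[symmetric])
  have fgs: "fst ` set gs = rho ` fst ` P" by (force simp: gs_def xs(1))
  define W where "W = Y \<union> fst ` P"
  have WPC: "W \<subseteq> PC ?n" unfolding W_def using YHF HF_PC FPC Psub by blast
  note IW = MP.is_ideal_genideal[OF WPC]
  have "fst ` set fds \<subseteq> idl ?n W"
  proof
    fix f assume "f \<in> fst ` set fds"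
    then consider "f \<in> F2" | "f \<in> fst ` A3" unfolding A23 F2 by blast
    thus "f \<in> idl ?n W"
    proof cases
      case 1
      have "t \<subseteq> W" by (force simp: W_def P_def C_def)
      hence "mp.span t \<subseteq> idl ?n W"
        using MP.genideal_superset[OF WPC] by (intro mp.span_minimal ideal_subspace[OF IW]) blast
      thus ?thesis using 1 t(4) by blast
    next
      case 2
      thus ?thesis using MP.genideal_superset[OF WPC] by (auto simp: W_def P_def)
    qed
  qed
  hence kerW: "ET.ker \<subseteq> idl ?n W" unfolding idl[symmetric] by (rule MP.genideal_least[OF IW])
  have Pker: "fst ` P \<subseteq> ET.ker" using Psub MP.genideal_superset[OF FPC] idl by blast
  have gsPC: "fst ` set gs \<subseteq> PC p" unfolding fgs using rho_PC by blast
  note Ig = MP.is_ideal_genideal[OF gsPC]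
  have idlS: "idl p (fst ` set gs) = ES.ker"
  proof
    show "idl p (fst ` set gs) \<subseteq> ES.ker"
      using Pker rho_ker unfolding fgs by (intro MP.genideal_least[OF ES.ker_ideal]) blast
    \<comment> \<open>The preimage of the ideal under \<open>rho\<close> contains \<open>W\<close>,
      because \<open>rho\<close> kills \<open>Y\<close>. Hence the images of \<open>P\<close> alone
      generate the ideal of \<open>S\<close>.\<close>
    have J: "MP.is_ideal ?n {q \<in> PC ?n. rho q \<in> idl p (fst ` set gs)}"
      unfolding MP.is_ideal_def
      using MP.is_idealD(3,4)[OF Ig] MP.is_idealD(5)[OF Ig rho_PC]
        by (auto simp: mfilter_add rho_mult)
    have "rho y = 0" if "y \<in> Y" for y
      using that by (intro mfilter_none) (auto simp: Y_def keys_square elim!: odd_quadricE)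
    hence "W \<subseteq> {q \<in> PC ?n. rho q \<in> idl p (fst ` set gs)}"
      using WPC MP.genideal_superset[OF gsPC] MP.is_idealD(3)[OF Ig] by (auto simp: W_def fgs)
    hence "idl ?n W \<subseteq> {q \<in> PC ?n. rho q \<in> idl p (fst ` set gs)}" by (rule MP.genideal_least[OF J])
    thus "ES.ker \<subseteq> idl p (fst ` set gs)"
      using kerW ker_mono rho_id by (force simp: ES.ker_def)
  qed
  have gsHF: "f \<in> HF p d \<and> d \<ge> 2" if "(f, d) \<in> set gs" for f d
    using that fd Psub rho_HF by (force simp: gs_def xs(1))
  have "forms p gs" using gsHF by (fastforce simp: forms_def)
  moreover have "hf p (idl p (fst ` set gs)) d \<le> int S.mu" for d
  proof -
    have "hf p (idl p (fst ` set gs)) d = fps_nth (HS p (ES.ker :: 'k mpoly set)) d"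
      by (simp add: HS_def idlS)
    also have "\<dots> = int (card {u \<in> S. S.ord u = d})" by (simp add: ES.HS_ker S.HU_def)
    finally show ?thesis using S.card_ord_le[of d] by simp
  qed
  ultimately have "p \<le> Suc (length gs)" by (rule bounded_hf_imp_many_generators)
  hence p: "p \<le> Suc (card C + card A3)" by (simp add: len cP)
  have lenT: "length fds < p + r" by (rule ET.CI_data_length[OF CI])
  have cT: "card (set fds) = card A2 + card A3" unfolding A23(1) using A23
    by (intro card_Un_disjoint) auto
  \<comment> \<open>The chain is p - 1 \<le> card C + card A3 \<le> card A2 - card Y + card A3 \<le>
    length fds - card Y < p + r - card Y.\<close>
  have "card Y \<le> r" using p lenT cT C(3) cF2 card_length[of fds] by linarith
  thus r1: "r = 1" using r_pos cY by (simp split: if_splits)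
  \<comment> \<open>For \<open>r = 1\<close> the chain is tight: \<open>fds\<close> has no
    repetitions and exactly one quadric was exchanged. This allows products over lists to be
    compared as products over sets.\<close>
  have "card (set fds) = length fds"
    using p lenT cT C(3) cF2 card_length[of fds] cY r1 by simp
  hence dist: "distinct fds" by (rule card_distinct)
  have "koszul fds = (\<Prod>x\<in>A2 \<union> A3. 1 - fps_X ^ snd x)"
    unfolding koszul_def A23(1)[symmetric]
      using prod.distinct_set_conv_list[OF dist, of "\<lambda>x. 1 - fps_X ^ snd x :: int fps"] by simp
  also have "\<dots> = (\<Prod>x\<in>A2. 1 - fps_X ^ snd x) * (\<Prod>x\<in>A3. 1 - fps_X ^ snd x)"
    using A23 by (intro prod.union_disjoint) auto
  also have "(\<Prod>x\<in>A2. 1 - fps_X ^ snd x) = (\<Prod>x\<in>A2. 1 - fps_X ^ 2 :: int fps)"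
    by (rule prod.cong) (auto simp: A2_def)
  also have "\<dots> = (1 - fps_X ^ 2) * (1 - fps_X ^ 2) ^ card C"
  proof -
    have "card A2 = Suc (card C)"
      using p lenT cT C(3) cF2 card_length[of fds] cY r1 by simp
    thus ?thesis by simp
  qed
  finally have kT: "koszul fds = (1 - fps_X ^ 2) * ((1 - fps_X ^ 2) ^ card C * (\<Prod>x\<in>A3. 1 - fps_X ^ snd x))"
    by (simp add: mult.assoc)
  have "koszul gs = koszul xs" by (simp add: gs_def koszul_def comp_def)
  also have "\<dots> = (\<Prod>x\<in>C \<times> {2} \<union> A3. 1 - fps_X ^ snd x)"
    unfolding koszul_def P_def[symmetric] xs(1)[symmetric]
    using prod.distinct_set_conv_list[OF xs(2), of "\<lambda>x. 1 - fps_X ^ snd x :: int fps"] by simp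
  also have "\<dots> = (\<Prod>x\<in>C \<times> {2}. 1 - fps_X ^ snd x) * (\<Prod>x\<in>A3. 1 - fps_X ^ snd x)"
    using A23 C by (intro prod.union_disjoint) (auto simp: A3_def)
  also have "(\<Prod>x\<in>C \<times> {2}. 1 - fps_X ^ snd x) = (\<Prod>x\<in>C \<times> {2 :: nat}. 1 - fps_X ^ 2 :: int fps)"
    by (rule prod.cong) auto
  also have "\<dots> = (1 - fps_X ^ 2) ^ card C" by (simp add: card_cartesian_product)
  finally have kS: "koszul gs = (1 - fps_X ^ 2) ^ card C * (\<Prod>x\<in>A3. 1 - fps_X ^ snd x)" .
  obtain z where z: "odd_gens = {z}" using r1 r_eq card_1_singletonE by metis
  \<comment> \<open>By (1 - X)^(p+1) (1 + X) = (1 - X^2) (1 - X)^p, the factor 1 - X^2 of the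
    exchanged square can be cancelled.\<close>
  have "(1 - fps_X ^ 2) * ((1 - fps_X) ^ p * S.HU) = (1 - fps_X) ^ ?n * T.HU"
    unfolding HU_T[OF z] r1 by (simp add: power2_eq_square algebra_simps)
  also have "\<dots> = (1 - fps_X ^ 2) * koszul gs" unfolding HUT kT kS ..
  finally have "(1 - fps_X ^ 2) * ((1 - fps_X) ^ p * S.HU) = (1 - fps_X ^ 2) * koszul gs" .
  moreover have "(1 - fps_X ^ 2 :: int fps) \<noteq> 0" by (rule one_minus_X_power_nonzero) simp
  ultimately have "(1 - fps_X) ^ p * S.HU = koszul gs" by (metis mult_left_cancel)
  hence "ES.CI_data gs" unfolding ES.CI_data_def using gsHF idlS by blast
  thus "\<exists>gs :: ('k mpoly \<times> nat) list. ES.CI_data gs" ..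
qed

text \<open>Multiplication by the odd variable moves the exponent from \<open>2 * s\<close> to
  \<open>2 * s + z\<close> and raises degree and order both by one, so maximality of monomials is
  kept.\<close>

lemma Phi_T_odd_shift:
  assumes o: "odd_gens = {z}" and r: "r = 1" and q: "q \<in> PC p"
  shows "fps_nth (ET.Phi (mnm (mnm p 1) 1 * q)) (2 * s + z) = fps_nth (ES.Phi (q :: 'k::field mpoly)) s"
proof -
  have GTp: "GT p = z"
  proof -
    have "H 0 \<in> odd_gens" using enum_odd r by (auto simp: bij_betw_def)
    thus ?thesis using o by (simp add: GT_def)
  qed
  show ?thesis
  proof (rule poly_induct[where r = q and P = "\<lambda>q. fps_nth (ET.Phi (mnm (mnm p 1) 1 * q)) (2 * s + z) = fps_nth (ES.Phi q) s"])
    fix m and c :: 'k assume "m \<in> pkeys q"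
    hence m: "pkeys m \<subseteq> {..<p}" using q by (auto simp: PC_def)
    have val: "ET.val (mnm p 1 + m) = 2 * ES.val m + z" using val_T[OF m] GTp by simp
    moreover have "ES.val m \<in> S" using ES.val_in_ord m by blast
    ultimately have "ET.maxm (mnm p 1 + m) \<longleftrightarrow> ES.maxm m"
      using odd_gens_singleton(1)[OF o, of "ES.val m"] by (simp add: ET.maxm_def ES.maxm_def)
    thus "fps_nth (ET.Phi (mnm (mnm p 1) 1 * mnm m c)) (2 * s + z) = fps_nth (ES.Phi (mnm m c)) s"
      using val by (simp add: mult_single ET.Phi_mnm ES.Phi_mnm ET.phim_def ES.phim_def)
  qed (auto simp: distrib_left ET.Phi_add ES.Phi_add)
qed

lemma keys_restrict:
  assumes "pkeys m \<subseteq> {..<Suc p}" "coef m p = (0 :: nat)" shows "pkeys m \<subseteq> {..<p}"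
proof
  fix i assume i: "i \<in> pkeys m"
  have "i < Suc p" using i assms(1) by auto
  moreover have "i \<noteq> p" using i assms(2) by (auto simp: in_keys_iff)
  ultimately show "i \<in> {..<p}" by simp
qed

text \<open>With y the odd variable, a polynomial is modulo y^2 of the form \<open>rho q\<close> + y
  \<open>q1\<close> with both parts in the even variables. \<open>Phi\<close> sends the two summands
  to even and odd exponents respectively, so a relation of \<open>T\<close> splits into two
  relations of \<open>S\<close>.\<close>

lemma CI_data_S_imp:
  assumes r: "r = 1" and CI: "ES.CI_data (gs :: ('k::field mpoly \<times> nat) list)"
  shows "ET.CI_data ((mnm (mnm p 1 + mnm p 1) 1, 2) # gs)"
proof -
  let ?n = "p + r"
  let ?y = "mnm (mnm p 1) 1 :: 'k mpoly"
  obtain z where z: "odd_gens = {z}" using r r_eq card_1_singletonE by metis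
  have gs: "f \<in> HF p d \<and> d \<ge> 2" if "(f, d) \<in> set gs" for f d using CI that
    by (auto simp: ES.CI_data_def)
  have idl: "idl p (fst ` set gs) = ES.ker" and HUS: "(1 - fps_X) ^ p * S.HU = koszul gs"
    using CI by (auto simp: ES.CI_data_def)
  define F where "F = fst ` set ((mnm (mnm p 1 + mnm p 1) 1, 2) # gs)"
  have y2: "mnm (mnm p 1 + mnm p 1) 1 = ?y * ?y" by (simp add: mult_single)
  have HF: "f \<in> HF ?n d \<and> d \<ge> 2" if "(f, d) \<in> set ((mnm (mnm p 1 + mnm p 1) 1, 2) # gs)" for f d
  proof (cases "(f, d) \<in> set gs")
    case True thus ?thesis using gs HF_mono by blast
  next
    case False
    hence "f = mnm (mnm p 1 + mnm p 1) 1" "d = 2" using that by auto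
    thus ?thesis using r by (auto simp: HF_iff monset_def keys_square)
  qed
  have gsPC: "fst ` set gs \<subseteq> PC p" using gs HF_PC by force
  have FPC: "F \<subseteq> PC ?n" unfolding F_def using HF HF_PC by force
  note IF = MP.is_ideal_genideal[OF FPC]
  have FI: "F \<subseteq> idl ?n F" by (rule MP.genideal_superset[OF FPC])
  have yy: "?y * ?y \<in> idl ?n F" unfolding y2[symmetric]
    by (rule subsetD[OF FI]) (simp add: F_def)
  have kerS: "ES.ker \<subseteq> idl ?n F"
  proof -
    have "MP.is_ideal p (idl ?n F \<inter> PC p)"
      unfolding MP.is_ideal_def using MP.is_idealD(3,4)[OF IF] MP.is_idealD(5)[OF IF PC_mono]
        by auto
    moreover have "fst ` set gs \<subseteq> idl ?n F \<inter> PC p" using FI gsPC by (auto simp: F_def)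
    ultimately have "idl p (fst ` set gs) \<subseteq> idl ?n F \<inter> PC p" by (rule MP.genideal_least)
    thus ?thesis unfolding idl by blast
  qed
  have y_ker: "mnm (mnm p 1 + mnm p 1) 1 \<in> (ET.ker :: 'k mpoly set)"
    by (rule odd_mon_ker) (use r in auto)
  have "F \<subseteq> ET.ker"
    using y_ker ker_mono MP.genideal_superset[OF gsPC] idl by (auto simp: F_def)
  hence sub: "idl ?n F \<subseteq> ET.ker" by (rule MP.genideal_least[OF ET.ker_ideal])
  have "ET.ker \<subseteq> idl ?n F"
  proof
    fix q :: "'k mpoly" assume q: "q \<in> ET.ker"
    have qPC: "q \<in> PC ?n" "ET.Phi q = 0" using q by (auto simp: ET.ker_def)
    \<comment> \<open>Monomials without y, with exactly one y and with at least two go to the three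
      summands in turn; the last are multiples of y^2.\<close>
    have split: "\<exists>q1 q2. q1 \<in> PC p \<and> q2 \<in> idl ?n F \<and> q = rho q + ?y * q1 + q2"
    proof (rule poly_induct[where r = q and P = "\<lambda>q. \<exists>q1 q2. q1 \<in> PC p \<and> q2 \<in> idl ?n F \<and> q = rho q + ?y * q1 + q2"])
      show "\<exists>q1 q2. q1 \<in> PC p \<and> q2 \<in> idl ?n F \<and> 0 = rho 0 + ?y * q1 + q2"
        using MP.is_idealD(3)[OF IF] by (intro exI[of _ 0]) auto
    next
      fix u v assume "\<exists>q1 q2. q1 \<in> PC p \<and> q2 \<in> idl ?n F \<and> u = rho u + ?y * q1 + q2"
        "\<exists>q1 q2. q1 \<in> PC p \<and> q2 \<in> idl ?n F \<and> v = rho v + ?y * q1 + q2"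
      then obtain q1 q2 q1' q2' where *: "q1 \<in> PC p" "q2 \<in> idl ?n F" "u = rho u + ?y * q1 + q2"
        "q1' \<in> PC p" "q2' \<in> idl ?n F" "v = rho v + ?y * q1' + q2'" by blast
      have "u + v = (rho u + rho v) + ?y * (q1 + q1') + (q2 + q2')"
        by (subst *(3), subst *(6)) (simp add: algebra_simps)
      hence "u + v = rho (u + v) + ?y * (q1 + q1') + (q2 + q2')" unfolding mfilter_add .
      thus "\<exists>q1 q2. q1 \<in> PC p \<and> q2 \<in> idl ?n F \<and> u + v = rho (u + v) + ?y * q1 + q2"
        using * MP.is_idealD(4)[OF IF] MP.add_C by blast
    next
      fix m and c :: 'k assume "m \<in> pkeys q"
      hence m: "pkeys m \<subseteq> {..<Suc p}" using qPC r by (auto simp: PC_def)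
      show "\<exists>q1 q2. q1 \<in> PC p \<and> q2 \<in> idl ?n F \<and> mnm m c = rho (mnm m c) + ?y * q1 + q2"
      proof (cases "coef m p = 0")
        case True
        hence "pkeys m \<subseteq> {..<p}" by (rule keys_restrict[OF m])
        hence "rho (mnm m c) = mnm m c" by (intro mfilter_id) (auto split: if_splits)
        thus ?thesis using MP.is_idealD(3)[OF IF] by (intro exI[of _ 0]) auto
      next
        case False
        then obtain m' where m': "m = m' + mnm p 1" by (rule mono_split)
        have rho0: "rho (mnm m c) = 0"
          by (rule mfilter_none) (auto simp: m' keys_add_nat split: if_splits)
        have eq: "mnm m c = ?y * mnm m' c" by (simp add: m' mult_single add.commute)
        show ?thesis
        proof (cases "coef m' p = 0")
          case True
          hence "pkeys m' \<subseteq> {..<p}" using m by (intro keys_restrict) (simp_all add: m' keys_add_nat)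
          hence "mnm m' c \<in> PC p" by (simp add: PC_mono_iff)
          moreover have "mnm m c = rho (mnm m c) + ?y * mnm m' c + 0" unfolding rho0
            by (simp add: eq)
          ultimately show ?thesis using MP.is_idealD(3)[OF IF] by blast
        next
          case False
          then obtain m'' where m'': "m' = m'' + mnm p 1" by (rule mono_split)
          have "mnm m'' c \<in> PC ?n" using m r by (auto simp: m' m'' keys_add_nat PC_mono_iff)
          hence "mnm m'' c * (?y * ?y) \<in> idl ?n F" using yy by (rule MP.is_idealD(5)[OF IF])
          moreover have "mnm m c = mnm m'' c * (?y * ?y)"
            by (simp add: m' m'' mult_single add.assoc)
          ultimately have "mnm m c \<in> idl ?n F" by simp
          moreover have "mnm m c = rho (mnm m c) + ?y * 0 + mnm m c" unfolding rho0 by simp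
          ultimately show ?thesis using MP.zero_C by blast
        qed
      qed
    qed
    then obtain q1 q2 where q12: "q1 \<in> PC p" "q2 \<in> idl ?n F" "q = rho q + ?y * q1 + q2" by blast
    have "ET.Phi q2 = 0" using q12(2) sub by (auto simp: ET.ker_def)
    hence Phi: "ET.Phi (rho q) + ET.Phi (?y * q1) = 0" using qPC(2) q12(3)
      by (metis ET.Phi_add add_0_right)
    have "fps_nth (ES.Phi q1) s = 0" for s
    proof -
      have "odd (2 * s + z)" using z odd_gensD by auto
      hence "fps_nth (ET.Phi (rho q)) (2 * s + z) = 0" by (rule Phi_T_odd[OF rho_PC])
      moreover have "fps_nth (ET.Phi (rho q)) (2 * s + z) + fps_nth (ET.Phi (?y * q1)) (2 * s + z) = 0"
        using arg_cong[OF Phi, of "\<lambda>f. fps_nth f (2 * s + z)"] by simp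
      ultimately show ?thesis using Phi_T_odd_shift[OF z r q12(1), of s] by simp
    qed
    hence "q1 \<in> ES.ker" using q12(1) by (simp add: ES.ker_def fps_eq_iff)
    hence q1: "q1 \<in> idl ?n F" using kerS by blast
    have "?y \<in> PC ?n" using r by (auto simp: PC_mono_iff)
    hence "?y * q1 \<in> idl ?n F" using q1 by (rule MP.is_idealD(5)[OF IF])
    moreover have "rho q \<in> idl ?n F" using rho_ker[OF q] kerS by blast
    ultimately have "rho q + ?y * q1 + q2 \<in> idl ?n F" using q12(2) MP.is_idealD(4)[OF IF] by blast
    thus "q \<in> idl ?n F" unfolding q12(3)[symmetric] .
  qed
  hence "idl ?n F = ET.ker" using sub by blast
  moreover have "(1 - fps_X) ^ ?n * T.HU = koszul ((mnm (mnm p 1 + mnm p 1) (1 :: 'k), 2) # gs)"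
  proof -
    have "(1 - fps_X) ^ ?n * T.HU = (1 - fps_X ^ 2) * ((1 - fps_X) ^ p * S.HU)"
      unfolding HU_T[OF z] r by (simp add: power2_eq_square algebra_simps)
    thus ?thesis unfolding HUS by simp
  qed
  ultimately show ?thesis unfolding ET.CI_data_def using HF by (auto simp: F_def)
qed

lemma gr_CI_T_iff:
  "gr_semigroup_ring_CI TYPE('k::field) T \<longleftrightarrow>
     gr_semigroup_ring_CI TYPE('k) S \<and> principal_semigroup_ideal S E"
proof -
  have pr: "principal_semigroup_ideal S E \<longleftrightarrow> r = 1"
    unfolding principal_iff r_eq by (auto simp: card_1_singleton_iff)
  show ?thesis
    unfolding ES.gr_CI_iff_CI_data ET.gr_CI_iff_CI_data pr
    using CI_data_T_imp CI_data_S_imp by blast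
qed

end

theorem proposition3p12:
  fixes S E T :: "nat set" and b :: nat
  assumes "numerical_semigroup S"
    and "semigroup_ideal S E"
    and "0 \<notin> E"
    and "b \<in> S"
    and "odd b"
    and "T = numerical_duplication S b E"
  shows "(gamma_rectangular T \<longleftrightarrow> gamma_rectangular S \<and> principal_semigroup_ideal S E) \<and>
    (beta_rectangular T \<longleftrightarrow> beta_rectangular S \<and> principal_semigroup_ideal S E) \<and>
    (gr_semigroup_ring_CI TYPE('k::field) T \<longleftrightarrow>
       gr_semigroup_ring_CI TYPE('k) S \<and> principal_semigroup_ideal S E)"
proof -
  interpret semigroup_duplication S E T b
    using assms by unfold_locales auto
  obtain G where G: "bij_betw G {..<card S.gens} S.gens"
    using ex_bij_betw_nat_finite[OF S.finite_gens] by (auto simp: atLeast0LessThan)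
  obtain H where H: "bij_betw H {..<card odd_gens} odd_gens"
    using ex_bij_betw_nat_finite[OF finite_odd_gens] by (auto simp: atLeast0LessThan)
  interpret enumerated_duplication S E T b "card S.gens" G "card odd_gens" H
    using G H by unfold_locales
  show ?thesis using gamma_rectangular_T beta_rectangular_T gr_CI_T_iff by blast
qed

end
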